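(* Let $f\in L^p(\Omega)$ with $p>\frac Q2$. Then the (weak) solution $u$ of $$X^*(A(x)Xu)=f\ \text{ in }\Omega,\qquad u=0\ \text{ on }\partial\Omega$$ belongs to $L^\infty(\Omega)$, and there exists a constant $C$, which depends only on $Q,\Omega,p$ and $\alpha$ (the family $X$ being fixed), such that $$\|u\|_{L^\infty(\Omega)}\le C\|f\|_{L^p(\Omega)} .$$
   Context: Setting. $N\ge2$, $\Omega\subset\mathbb R^N$ is open and bounded, and $X=\{X_1,\dots,X_m\}$ is a fixed family of locally Lipschitz vector fields on $\mathbb R^N$, $X_j=\sum_{k=1}^N c_{jk}\partial_{x_k}$; for $u\in C^1$, $Xu=(X_1u,\dots,X_mu)$ is the $X$-gradient. An absolutely continuous path $\gamma:[0,T]\to\mathbb R^N$ is $X$-subunit if $\dot\gamma(t)=\sum_{j}\theta_j(t)X_j(\gamma(t))$ with $\sum_j\theta_j^2(t)\le1$ for a.e. $t$. It is assumed that any two points of $\Omega$ are joined by an $X$-subunit path in $\Omega$; $d_X(x,y)$ is the infimum of all $T>0$ for which there is an $X$-subunit $\gamma:[0,T]\to\mathbb R^N$ with $\gamma(0)=x$, $\gamma(T)=y$; $B_r$ denotes a $d_X$-ball of radius $r$ and $B_{cr}$ the concentric ball of radius $cr$. Standing assumptions: (i) $|y-x|\to0$ implies $d_X(x,y)\to0$; (ii) $(\Omega,d_X,\mathcal L^N)$ is doubling: there is $Q>2$ with $0<\mathcal L^N(B_{2r})\le2^Q\mathcal L^N(B_r)$; (iii) there are $C_P,\nu>0$ such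 that $\frac1{|B_r|}\int_{B_r}|u-u_r|\,dx\le C_P\,r\,\frac1{|B_{\nu r}|}\int_{B_{\nu r}}|Xu|\,dx$ for every $d_X$-ball $B_r$ and $u\in C^1(\overline{B_{\nu r}})$, with $u_r=\frac1{|B_r|}\int_{B_r}u\,dx$. $W^{1,p}_0(\Omega,X)$ is the closure of $C^\infty_c(\Omega)$ under the norm $\|Xu\|_{L^p(\Omega)}$ (with $Xu$ the $L^p$-limit of the $X$-gradients of approximating functions). Known fact (Sobolev inequality): for $1\le p<Q$ there is a constant $\mathcal S_p$ with $\|u\|_{L^{p^*}(\Omega)}\le\mathcal S_p\|Xu\|_{L^p(\Omega)}$ for all $u\in W^{1,p}_0(\Omega,X)$, $p^*=\frac{pQ}{Q-p}$. $A:\Omega\to\mathbb R^{m\times m}$ is measurable with bounded entries (not necessarily symmetric) and there are $0<\alpha<\beta$ with $\alpha|\eta|^2\le A(x)\eta\cdot\eta\le\beta|\eta|^2$ for all $\eta\in\mathbb R^m$. $X^*$ is the formal adjoint: $\langle X^*F,v\rangle=\int_\Omega F\cdot Xv$. Weak solution. For $h\in L^{\frac{2Q}{Q+2}}(\Omega)$, the weak solution of $X^*(AXu)=h$ in $\Omega$, $u=0$ on $\partial\Omega$, is the unique (Lax–Milgram) $u\in W^{1,2}_0(\Omega,X)$ with $\int_\Omega A\,Xu\cdot Xv=\int_\Omega h\,v$ for all $v\in W^{1,2}_0(\Omega,X)$. Since $Q>2$, $\frac Q2>\frac{2Q}{Q+2}$. *)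

theory Defs
  imports "HOL-Analysis.Analysis" "HOL-Probability.Essential_Supremum"
begin

text \<open>
  Points of the ambient space are of type \<^typ>\<open>real^'n\<close>. A family of vector fields
  \<open>X_j = \<Sum>k. c_jk \<partial>_k\<close>, with \<open>j\<close> ranging over the finite type \<^typ>\<open>'m\<close>, is a function
  \<open>X :: 'm \<Rightarrow> real^'n \<Rightarrow> real^'n\<close> with \<open>X j x $ k = c_jk(x)\<close>. Functions on a set \<open>\<Omega>\<close> are total
  functions of which only the values on \<open>\<Omega>\<close> are used, up to null sets.
\<close>

subsection \<open>Differentiable functions\<close>

definition partial_deriv :: "'n::finite \<Rightarrow> (real^'n \<Rightarrow> real) \<Rightarrow> real^'n \<Rightarrow> real" where
  "partial_deriv k u x = frechet_derivative u (at x) (axis k 1)"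

text \<open>\<open>Ck_on k U u\<close>: \<open>u\<close> is \<open>k\<close> times continuously differentiable on \<open>U\<close>, for open \<open>U\<close>.\<close>

primrec Ck_on :: "nat \<Rightarrow> (real^'n::finite) set \<Rightarrow> (real^'n \<Rightarrow> real) \<Rightarrow> bool" where
  "Ck_on 0 U u \<longleftrightarrow> continuous_on U u"
| "Ck_on (Suc k) U u \<longleftrightarrow>
     (\<forall>x\<in>U. u differentiable (at x)) \<and> (\<forall>i. Ck_on k U (partial_deriv i u))"

definition C1_closed :: "(real^'n::finite) set \<Rightarrow> (real^'n \<Rightarrow> real) \<Rightarrow> bool" where
  "C1_closed K u \<longleftrightarrow> (\<exists>U. open U \<and> K \<subseteq> U \<and> Ck_on 1 U u)"

text \<open>Elements of \<open>C\<^sub>c\<^sup>\<infinity>(\<Omega>)\<close> are identified with their extension by zero to the whole space.\<close>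

definition test_functions :: "(real^'n::finite) set \<Rightarrow> (real^'n \<Rightarrow> real) set" where
  "test_functions \<Omega> =
     {\<phi>. (\<forall>k. Ck_on k UNIV \<phi>) \<and> compact (closure {x. \<phi> x \<noteq> 0}) \<and> closure {x. \<phi> x \<noteq> 0} \<subseteq> \<Omega>}"

definition X_grad ::
    "('m::finite \<Rightarrow> real^'n::finite \<Rightarrow> real^'n) \<Rightarrow> (real^'n \<Rightarrow> real) \<Rightarrow> real^'n \<Rightarrow> real^'m" where
  "X_grad X u x = (\<chi> j. \<Sum>k\<in>UNIV. X j x $ k * partial_deriv k u x)"

definition locally_lipschitz_fields :: "('m::finite \<Rightarrow> real^'n::finite \<Rightarrow> real^'n) \<Rightarrow> bool" where
  "locally_lipschitz_fields X \<longleftrightarrow> (\<forall>j x. \<exists>r>0. \<exists>L. L-lipschitz_on (ball x r) (X j))"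


subsection \<open>Subunit paths and the distance they generate\<close>

definition absolutely_continuous_path :: "real \<Rightarrow> real \<Rightarrow> (real \<Rightarrow> 'a::metric_space) \<Rightarrow> bool" where
  "absolutely_continuous_path a b \<gamma> \<longleftrightarrow>
     (\<forall>\<epsilon>>0. \<exists>\<delta>>0. \<forall>n s t.
        (\<forall>i<n. a \<le> s i \<and> s i \<le> t i \<and> t i \<le> b) \<and>
        (\<forall>i<n. \<forall>j<n. i \<noteq> j \<longrightarrow> {s i<..<t i} \<inter> {s j<..<t j} = {}) \<and>
        (\<Sum>i<n. t i - s i) < \<delta>
        \<longrightarrow> (\<Sum>i<(n::nat). dist (\<gamma> (s i)) (\<gamma> (t i))) < \<epsilon>)"

definition subunit_path ::
    "('m::finite \<Rightarrow> real^'n::finite \<Rightarrow> real^'n) \<Rightarrow> real \<Rightarrow> (real \<Rightarrow> real^'n) \<Rightarrow> bool" where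
  "subunit_path X T \<gamma> \<longleftrightarrow>
     absolutely_continuous_path 0 T \<gamma> \<and>
     (\<exists>\<theta> :: real \<Rightarrow> real^'m. AE t in lebesgue_on {0..T}.
        (\<gamma> has_vector_derivative (\<Sum>j\<in>UNIV. \<theta> t $ j *\<^sub>R X j (\<gamma> t))) (at t) \<and>
        (\<Sum>j\<in>UNIV. (\<theta> t $ j)\<^sup>2) \<le> 1)"

definition subunit_connected ::
    "('m::finite \<Rightarrow> real^'n::finite \<Rightarrow> real^'n) \<Rightarrow> (real^'n) set \<Rightarrow> bool" where
  "subunit_connected X \<Omega> \<longleftrightarrow>
     (\<forall>x\<in>\<Omega>. \<forall>y\<in>\<Omega>. \<exists>T>0. \<exists>\<gamma>. subunit_path X T \<gamma> \<and> \<gamma> 0 = x \<and> \<gamma> T = y \<and> \<gamma> ` {0..T} \<subseteq> \<Omega>)"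

text \<open>The value is \<open>\<infinity>\<close> for points that no subunit path joins; paths may leave \<open>\<Omega>\<close>.\<close>

definition d_X ::
    "('m::finite \<Rightarrow> real^'n::finite \<Rightarrow> real^'n) \<Rightarrow> real^'n \<Rightarrow> real^'n \<Rightarrow> ennreal" where
  "d_X X x y = Inf {ennreal T | T. T > 0 \<and> (\<exists>\<gamma>. subunit_path X T \<gamma> \<and> \<gamma> 0 = x \<and> \<gamma> T = y)}"

definition X_ball ::
    "('m::finite \<Rightarrow> real^'n::finite \<Rightarrow> real^'n) \<Rightarrow> real^'n \<Rightarrow> real \<Rightarrow> (real^'n) set" where
  "X_ball X x r = {y. d_X X x y < ennreal r}"


subsection \<open>Standing assumptions\<close>

text \<open>\<open>d_X(x,y) \<rightarrow> 0\<close> as \<open>\<bar>y - x\<bar> \<rightarrow> 0\<close>, for centres \<open>x\<close> in \<open>\<Omega>\<close>.\<close>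

definition d_X_continuous ::
    "('m::finite \<Rightarrow> real^'n::finite \<Rightarrow> real^'n) \<Rightarrow> (real^'n) set \<Rightarrow> bool" where
  "d_X_continuous X \<Omega> \<longleftrightarrow>
     (\<forall>\<epsilon>>0. \<exists>\<delta>>0. \<forall>x\<in>\<Omega>. \<forall>y. norm (y - x) < \<delta> \<longrightarrow> d_X X x y < \<epsilon>)"

text \<open>
  A set that is not Lebesgue measurable has \<^const>\<open>emeasure\<close> zero, so the strict inequality
  includes the measurability of the balls.
\<close>

definition X_doubling ::
    "('m::finite \<Rightarrow> real^'n::finite \<Rightarrow> real^'n) \<Rightarrow> (real^'n) set \<Rightarrow> real \<Rightarrow> bool" where
  "X_doubling X \<Omega> Q \<longleftrightarrow>
     (\<forall>x\<in>\<Omega>. \<forall>r>0.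
        0 < emeasure lebesgue (X_ball X x (2 * r)) \<and>
        emeasure lebesgue (X_ball X x (2 * r))
          \<le> ennreal (2 powr Q) * emeasure lebesgue (X_ball X x r))"

definition mean_value :: "(real^'n::finite) set \<Rightarrow> (real^'n \<Rightarrow> real) \<Rightarrow> real" where
  "mean_value B u = (LINT y:B|lebesgue. u y) / measure lebesgue B"

definition mean_nn :: "(real^'n::finite) set \<Rightarrow> (real^'n \<Rightarrow> real) \<Rightarrow> ennreal" where
  "mean_nn B g = (\<integral>\<^sup>+y\<in>B. ennreal (g y) \<partial>lebesgue) / emeasure lebesgue B"

text \<open>
  The integrability of \<open>u\<close> (automatic when the closure of the larger ball is compact) makes the mean
  value meaningful; otherwise the Bochner integral would silently be zero. The right-hand side
  may be infinite.
\<close>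

definition X_poincare ::
    "('m::finite \<Rightarrow> real^'n::finite \<Rightarrow> real^'n) \<Rightarrow> (real^'n) set \<Rightarrow> bool" where
  "X_poincare X \<Omega> \<longleftrightarrow>
     (\<exists>C\<^sub>P>0. \<exists>\<nu>>0. \<forall>x\<in>\<Omega>. \<forall>r>0. \<forall>u.
        C1_closed (closure (X_ball X x (\<nu> * r))) u \<and>
        set_integrable lebesgue (X_ball X x r) u \<longrightarrow>
        mean_nn (X_ball X x r) (\<lambda>y. \<bar>u y - mean_value (X_ball X x r) u\<bar>)
          \<le> ennreal (C\<^sub>P * r) * mean_nn (X_ball X x (\<nu> * r)) (\<lambda>y. norm (X_grad X u y)))"


subsection \<open>Lebesgue and Sobolev spaces\<close>

definition Lp_fun :: "real \<Rightarrow> (real^'n::finite) set \<Rightarrow> (real^'n \<Rightarrow> 'b::euclidean_space) \<Rightarrow> bool" where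
  "Lp_fun p \<Omega> f \<longleftrightarrow> f \<in> borel_measurable (lebesgue_on \<Omega>) \<and>
     integrable (lebesgue_on \<Omega>) (\<lambda>x. norm (f x) powr p)"

definition Lp_norm :: "real \<Rightarrow> (real^'n::finite) set \<Rightarrow> (real^'n \<Rightarrow> 'b::euclidean_space) \<Rightarrow> real" where
  "Lp_norm p \<Omega> f = (\<integral>x. norm (f x) powr p \<partial>lebesgue_on \<Omega>) powr (1 / p)"

definition Linf_fun :: "(real^'n::finite) set \<Rightarrow> (real^'n \<Rightarrow> real) \<Rightarrow> bool" where
  "Linf_fun \<Omega> u \<longleftrightarrow> u \<in> borel_measurable (lebesgue_on \<Omega>) \<and>
     (\<exists>M. AE x in lebesgue_on \<Omega>. \<bar>u x\<bar> \<le> M)"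

definition Linf_norm :: "(real^'n::finite) set \<Rightarrow> (real^'n \<Rightarrow> real) \<Rightarrow> real" where
  "Linf_norm \<Omega> u = real_of_ereal (esssup (lebesgue_on \<Omega>) (\<lambda>x. ereal \<bar>u x\<bar>))"

text \<open>
  \<open>W0_grad p X \<Omega> u G\<close>: \<open>u\<close> belongs to \<open>W\<^sub>0\<^sup>1\<^sup>,\<^sup>p(\<Omega>,X)\<close> and \<open>Xu = G\<close>. The gradients of the
  approximating test functions converge to \<open>G\<close> in \<open>L\<^sup>p\<close>. By the Sobolev inequality a sequence
  of test functions that is Cauchy for \<open>\<parallel>Xu\<parallel>\<^sub>p\<close> converges in \<open>L\<^sup>p(\<Omega>)\<close> (\<open>\<Omega>\<close> is bounded), and this
  identifies the element of the completion with the function \<open>u\<close>.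
\<close>

definition W0_grad ::
    "real \<Rightarrow> ('m::finite \<Rightarrow> real^'n::finite \<Rightarrow> real^'n) \<Rightarrow> (real^'n) set \<Rightarrow>
     (real^'n \<Rightarrow> real) \<Rightarrow> (real^'n \<Rightarrow> real^'m) \<Rightarrow> bool" where
  "W0_grad p X \<Omega> u G \<longleftrightarrow>
     Lp_fun p \<Omega> u \<and> Lp_fun p \<Omega> G \<and>
     (\<exists>\<phi>. (\<forall>n::nat. \<phi> n \<in> test_functions \<Omega>) \<and>
          (\<lambda>n. Lp_norm p \<Omega> (\<lambda>x. X_grad X (\<phi> n) x - G x)) \<longlonglongrightarrow> 0 \<and>
          (\<lambda>n. Lp_norm p \<Omega> (\<lambda>x. \<phi> n x - u x)) \<longlonglongrightarrow> 0)"


subsection \<open>The Dirichlet problem\<close>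

definition elliptic_matrix ::
    "(real^'n::finite) set \<Rightarrow> real \<Rightarrow> real \<Rightarrow> (real^'n \<Rightarrow> real^'m^'m::finite) \<Rightarrow> bool" where
  "elliptic_matrix \<Omega> \<alpha> \<beta> A \<longleftrightarrow>
     (\<forall>i j. (\<lambda>x. A x $ i $ j) \<in> borel_measurable (lebesgue_on \<Omega>)) \<and>
     (\<exists>M. \<forall>x\<in>\<Omega>. \<forall>i j. \<bar>A x $ i $ j\<bar> \<le> M) \<and>
     (\<forall>x\<in>\<Omega>. \<forall>\<eta>. \<alpha> * (norm \<eta>)\<^sup>2 \<le> (A x *v \<eta>) \<bullet> \<eta> \<and> (A x *v \<eta>) \<bullet> \<eta> \<le> \<beta> * (norm \<eta>)\<^sup>2)"

definition weak_solution ::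
    "('m::finite \<Rightarrow> real^'n::finite \<Rightarrow> real^'n) \<Rightarrow> (real^'n) set \<Rightarrow> (real^'n \<Rightarrow> real^'m^'m) \<Rightarrow>
     (real^'n \<Rightarrow> real) \<Rightarrow> (real^'n \<Rightarrow> real) \<Rightarrow> bool" where
  "weak_solution X \<Omega> A h u \<longleftrightarrow>
     (\<exists>G. W0_grad 2 X \<Omega> u G \<and>
        (\<forall>v H. W0_grad 2 X \<Omega> v H \<longrightarrow>
           (\<integral>x. (A x *v G x) \<bullet> H x \<partial>lebesgue_on \<Omega>) = (\<integral>x. h x * v x \<partial>lebesgue_on \<Omega>)))"

end

theory Submission
  imports Defs
begin

text \<open>
  The bound is Stampacchia's: testing the equation with truncations of \<open>u\<close> and applying a Sobolev
  inequality makes the measure of \<open>{\<bar>u\<bar> > h}\<close> decay so fast in \<open>h\<close> that it vanishes at a finite level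
  proportional to the \<open>L\<^sup>p\<close> norm of \<open>f\<close>.

  The Sobolev inequality has to come from doubling and Poincare. The strict
  inequality \<open>p > Q/2\<close> leaves room below the critical exponent, and this makes a weak-type inequality
  sufficient: for \<open>0 < \<sigma> < 2/Q\<close>,
  \<open>\<bar>{\<bar>u\<bar> \<ge> t}\<bar> \<le> C (\<integral>\<bar>Xu\<bar>\<^sup>2 / t\<^sup>2) powr (1/(1-\<sigma>))\<close> (\<open>weak_Sobolev_test_functions\<close>, \<open>weak_Sobolev\<close>).
  For a test function and a point \<open>x\<close> of the level set, the means of \<open>u\<close> over the balls
  \<open>B(x, R/2^i)\<close> converge to \<open>u x\<close>, and by the Poincare inequality consecutive means differ by at most
  a multiple of \<open>R/2^i\<close> times the quadratic mean of \<open>\<bar>Xu\<bar>\<close> over the dilated ball. The first mean is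
  controlled in the same way, because for large \<open>R\<close> the ball contains a fixed set of positive measure
  outside \<open>\<Omega>\<close>, where \<open>u\<close> vanishes. If all of these differences were below a small multiple of
  \<open>t \<theta>^i\<close>, they could not add up to \<open>t\<close>. So one of the balls carries so much energy that its measure is
  at most \<open>C\<close> times a power larger than one of its share of the energy (\<open>large_energy_ball\<close>). A Vitali
  selection of disjoint balls among these finishes the argument, since \<open>s \<mapsto> s powr q\<close> is superadditive
  for \<open>q \<ge> 1\<close>. What this uses of \<open>d_X\<close> is that it is a symmetric distance whose small balls shrink to
  their centres also in the Euclidean sense; the latter holds because a subunit path moves with
  bounded speed (\<open>absolutely_continuous_path_dist_le\<close>).

  For the truncation at the levels \<open>0 \<le> k < h\<close>, a bounded one is chosen, which vanishes for \<open>\<bar>u\<bar> \<le> k\<close>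
  and has modulus \<open>h - k\<close> for \<open>\<bar>u\<bar> \<ge> h\<close>. Its energy is then at most
  \<open>(h - k) / \<alpha>\<close> times the integral of \<open>\<bar>f\<bar>\<close> over \<open>{\<bar>u\<bar> > k}\<close>, and Hoelder's inequality followed by the weak Sobolev inequality gives
  \<open>level_set_decay\<close>, whose exponent \<open>(1 - 1/p)/(1 - \<sigma>)\<close> exceeds one as soon as \<open>\<sigma> > 1/p\<close>. The space
  \<open>W\<^sub>0\<close> is a closure of smooth functions, so the truncation is realized as a limit of smooth functions
  of \<open>u\<close>, built from \<open>ln (1 + exp s)\<close>; these preserve the space by the chain rule \<open>W0_grad_compose\<close>.
\<close>

section \<open>Absolutely continuous paths\<close>

lemma subunit_path_alt:
  "subunit_path X T \<gamma> \<longleftrightarrow>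
     absolutely_continuous_path 0 T \<gamma> \<and>
     (\<exists>\<theta> N. negligible N \<and> (\<forall>t\<in>{0..T} - N.
        (\<gamma> has_vector_derivative (\<Sum>j\<in>UNIV. \<theta> t $ j *\<^sub>R X j (\<gamma> t))) (at t) \<and>
        (\<Sum>j\<in>UNIV. (\<theta> t $ j)\<^sup>2) \<le> 1))"
proof -
  have "(AE t in lebesgue_on {0..T}. P t) \<longleftrightarrow> (\<exists>N. negligible N \<and> (\<forall>t\<in>{0..T} - N. P t))" for P
  proof -
    have "(AE t in lebesgue_on {0..T}. P t) \<longleftrightarrow> (AE t in lebesgue. t \<in> {0..T} \<longrightarrow> P t)"
      by (rule AE_restrict_space_iff) auto
    also have "\<dots> \<longleftrightarrow> (\<exists>N. negligible N \<and> {t. \<not> (t \<in> {0..T} \<longrightarrow> P t)} \<subseteq> N)"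
      by (rule eventually_ae_filter_negligible)
    also have "\<dots> \<longleftrightarrow> (\<exists>N. negligible N \<and> (\<forall>t\<in>{0..T} - N. P t))"
      by blast
    finally show ?thesis .
  qed
  then show ?thesis
    unfolding subunit_path_def by blast
qed

text \<open>
  The inner part of absolute continuity, split off so that a pair \<open>\<epsilon>, \<delta>\<close> can be passed around as a
  single fact.
\<close>

definition ac_modulus ::
    "real \<Rightarrow> real \<Rightarrow> (real \<Rightarrow> 'a::metric_space) \<Rightarrow> real \<Rightarrow> real \<Rightarrow> bool" where
  "ac_modulus a b \<gamma> \<epsilon> \<delta> \<longleftrightarrow>
     (\<forall>n s t. (\<forall>i<n. a \<le> s i \<and> s i \<le> t i \<and> t i \<le> b) \<and>
        (\<forall>i<n. \<forall>j<n. i \<noteq> j \<longrightarrow> {s i<..<t i} \<inter> {s j<..<t j} = {}) \<and>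
        (\<Sum>i<n. t i - s i) < \<delta>
        \<longrightarrow> (\<Sum>i<(n::nat). dist (\<gamma> (s i)) (\<gamma> (t i))) < \<epsilon>)"

lemma absolutely_continuous_path_iff_modulus:
  "absolutely_continuous_path a b \<gamma> \<longleftrightarrow> (\<forall>\<epsilon>>0. \<exists>\<delta>>0. ac_modulus a b \<gamma> \<epsilon> \<delta>)"
  unfolding absolutely_continuous_path_def ac_modulus_def by (rule refl)

lemma ac_modulus_on_family:
  fixes s t :: "'i \<Rightarrow> real"
  assumes ac: "ac_modulus a b \<gamma> \<epsilon> \<delta>"
    and I: "finite I" "\<And>i. i \<in> I \<Longrightarrow> a \<le> s i \<and> s i \<le> t i \<and> t i \<le> b"
    and disj: "\<And>i j. i \<in> I \<Longrightarrow> j \<in> I \<Longrightarrow> i \<noteq> j \<Longrightarrow> {s i<..<t i} \<inter> {s j<..<t j} = {}"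
    and len: "(\<Sum>i\<in>I. t i - s i) < \<delta>"
  shows "(\<Sum>i\<in>I. dist (\<gamma> (s i)) (\<gamma> (t i))) < \<epsilon>"
proof -
  obtain h where h: "bij_betw h {..<card I} I"
    using I(1) ex_bij_betw_nat_finite lessThan_atLeast0 by metis
  have hI: "h i \<in> I" if "i < card I" for i
    using h that by (auto simp: bij_betw_def)
  have hne: "h i \<noteq> h j" if "i < card I" "j < card I" "i \<noteq> j" for i j
    using h that by (auto simp: bij_betw_def inj_on_def)
  have re: "(\<Sum>i\<in>I. g i) = (\<Sum>i<card I. g (h i))" for g :: "'i \<Rightarrow> real"
    using sum.reindex_bij_betw[OF h, of g] by simp
  have "(\<Sum>i<card I. dist (\<gamma> (s (h i))) (\<gamma> (t (h i)))) < \<epsilon>"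
    using ac[unfolded ac_modulus_def, rule_format, of "card I" "s \<circ> h" "t \<circ> h"] I(2) hI disj hne len
    by (simp add: re)
  then show ?thesis by (simp add: re)
qed

text \<open>
  A mean value inequality for absolutely continuous paths, by the Cousin lemma: in a tagged division
  that is fine enough, an interval whose tag is a point of differentiability contributes at most
  \<open>L + e\<close> times its length, while the intervals tagged in the exceptional null set lie in an open
  set of measure below \<open>\<delta>\<close>, so that absolute continuity bounds their total contribution by \<open>e\<close>.
\<close>

lemma absolutely_continuous_path_dist_le:
  fixes \<gamma> :: "real \<Rightarrow> 'a::euclidean_space"
  assumes ac: "absolutely_continuous_path 0 T \<gamma>"
    and ab: "0 \<le> a" "a \<le> b" "b \<le> T"
    and N: "negligible N" and L: "0 \<le> L"
    and deriv: "\<And>t. t \<in> {a..b} - N \<Longrightarrow> \<exists>v. (\<gamma> has_vector_derivative v) (at t) \<and> norm v \<le> L"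
  shows "dist (\<gamma> a) (\<gamma> b) \<le> L * (b - a)"
proof -
  have main: "dist (\<gamma> a) (\<gamma> b) \<le> L * (b - a) + e * (b - a) + e" if e: "e > 0" for e
  proof -
    obtain \<delta> where \<delta>: "\<delta> > 0" and ac': "ac_modulus 0 T \<gamma> e \<delta>"
      using ac e unfolding absolutely_continuous_path_iff_modulus by blast
    obtain U where U: "open U" "N \<subseteq> U" "(U - N) \<in> lmeasurable" "emeasure lebesgue (U - N) < ennreal \<delta>"
      using sets_lebesgue_outer_open[OF negligible_imp_sets[OF N] \<delta>] .
    have Nnull: "N \<in> null_sets lebesgue" using N by (simp add: negligible_iff_null_sets)
    have "emeasure lebesgue U = emeasure lebesgue (U - N)"
      using Nnull U by (intro emeasure_Diff_null_set[symmetric]) auto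
    then have emU: "emeasure lebesgue U < ennreal \<delta>" using U by simp
    have Um: "U \<in> lmeasurable"
      using emU U(1) by (intro fmeasurableI) (auto simp: less_top[symmetric] intro: order.strict_trans)
    have mU: "measure lebesgue U < \<delta>"
      using emU \<delta> Um by (simp add: emeasure_eq_measure2 ennreal_less_iff)
    have "\<exists>d>0. \<forall>y. \<bar>y - t\<bar> < d \<longrightarrow> norm (\<gamma> y - \<gamma> t) \<le> (L + e) * \<bar>y - t\<bar>"
      if t: "t \<in> {a..b} - N" for t
    proof -
      obtain v where v: "(\<gamma> has_vector_derivative v) (at t)" "norm v \<le> L"
        using deriv[OF t] by blast
      then have "(\<gamma> has_derivative (\<lambda>h. h *\<^sub>R v)) (at t)"
        by (simp add: has_vector_derivative_def)
      then obtain d where d: "d > 0"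
        and dd: "\<And>y. norm (y - t) < d \<Longrightarrow> norm (\<gamma> y - \<gamma> t - (y - t) *\<^sub>R v) \<le> e * norm (y - t)"
        using e unfolding has_derivative_at_alt by blast
      have "norm (\<gamma> y - \<gamma> t) \<le> (L + e) * \<bar>y - t\<bar>" if "\<bar>y - t\<bar> < d" for y
      proof -
        have "norm (\<gamma> y - \<gamma> t) \<le> norm (\<gamma> y - \<gamma> t - (y - t) *\<^sub>R v) + norm ((y - t) *\<^sub>R v)"
          by (metis diff_add_cancel norm_triangle_ineq)
        also have "\<dots> \<le> e * \<bar>y - t\<bar> + \<bar>y - t\<bar> * L"
          using dd[of y] that v(2) by (intro add_mono) (auto simp: mult_left_mono)
        finally show ?thesis by (simp add: algebra_simps)
      qed
      with d show ?thesis by blast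
    qed
    then obtain d where d: "\<And>t. t \<in> {a..b} - N \<Longrightarrow> d t > 0"
      and dd: "\<And>t y. t \<in> {a..b} - N \<Longrightarrow> \<bar>y - t\<bar> < d t \<Longrightarrow> norm (\<gamma> y - \<gamma> t) \<le> (L + e) * \<bar>y - t\<bar>"
      by metis
    \<comment> \<open>Tags in the null set get neighbourhoods inside \<open>U\<close>, the others an interval of differentiability; the value outside \<open>{a..b}\<close> only makes this a gauge.\<close>
    define G where "G = (\<lambda>t. if t \<in> N then U else if t \<in> {a..b} then ball t (d t) else ball t 1)"
    have "gauge G"
      using U(1,2) d by (auto simp: gauge_def G_def)
    then obtain p where p: "p tagged_division_of {a..b}" "G fine p"
      by (rule fine_division_exists_real)
    have fin: "finite p" using p(1) by blast
    have K: "\<exists>c d. K = {c..d} \<and> c \<le> x \<and> x \<le> d \<and> a \<le> c \<and> d \<le> b \<and> Inf K = c \<and> Sup K = d \<and> K \<subseteq> G x"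
      if xK: "(x, K) \<in> p" for x K
    proof -
      obtain c d where cd: "K = {c..d}" using tagged_division_ofD(4)[OF p(1) xK] by auto
      have "x \<in> K" "K \<subseteq> {a..b}" using tagged_division_ofD(2,3)[OF p(1) xK] by auto
      then show ?thesis using cd fineD[OF p(2) xK] by auto
    qed
    have Kle: "Inf (snd i) \<le> Sup (snd i)" if "i \<in> p" for i
      using K[of "fst i" "snd i"] that by auto
    let ?p1 = "{i \<in> p. fst i \<in> N}" and ?p2 = "{i \<in> p. fst i \<notin> N}"
    have split: "(\<Sum>i\<in>p. g i) = (\<Sum>i\<in>?p1. g i) + (\<Sum>i\<in>?p2. g i)" for g :: "real \<times> real set \<Rightarrow> real"
      using fin by (subst sum.union_disjoint[symmetric]) (auto intro: sum.cong)
    let ?D = "\<lambda>(x::real, K). dist (\<gamma> (Inf K)) (\<gamma> (Sup K))"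
    have disjp: "{Inf (snd i)<..<Sup (snd i)} \<inter> {Inf (snd j)<..<Sup (snd j)} = {}"
      if "i \<in> p" "j \<in> p" "i \<noteq> j" for i j
    proof -
      obtain x1 K1 x2 K2 where ij: "i = (x1,K1)" "j = (x2,K2)" by fastforce
      then have "interior K1 \<inter> interior K2 = {}"
        using tagged_division_ofD(5)[OF p(1)] that by blast
      moreover have "interior K1 = {Inf K1<..<Sup K1}" "interior K2 = {Inf K2<..<Sup K2}"
        using K[of x1 K1] K[of x2 K2] that ij interior_atLeastAtMost_real by metis+
      ultimately show ?thesis
        using ij by simp
    qed
    have "(\<Sum>i\<in>?p1. Sup (snd i) - Inf (snd i)) = (\<Sum>i\<in>?p1. measure lebesgue {Inf (snd i)<..<Sup (snd i)})"
      using K by (intro sum.cong) fastforce+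
    also have "\<dots> = measure lebesgue (\<Union>i\<in>?p1. {Inf (snd i)<..<Sup (snd i)})"
      using fin disjp
      by (intro measure_finite_Union[symmetric]) (auto simp: disjoint_family_on_def emeasure_lborel_Ioo[OF Kle])
    also have "\<dots> \<le> measure lebesgue U"
    proof (rule measure_mono_fmeasurable)
      show "(\<Union>i\<in>?p1. {Inf (snd i)<..<Sup (snd i)}) \<subseteq> U"
        using K by (force simp: G_def)
    qed (use Um fin in auto)
    finally have len: "(\<Sum>i\<in>?p1. Sup (snd i) - Inf (snd i)) < \<delta>" using mU by simp
    have "(\<Sum>i\<in>?p1. dist (\<gamma> (Inf (snd i))) (\<gamma> (Sup (snd i)))) < e"
    proof (rule ac_modulus_on_family[OF ac'])
      show "0 \<le> Inf (snd i) \<and> Inf (snd i) \<le> Sup (snd i) \<and> Sup (snd i) \<le> T" if "i \<in> ?p1" for i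
        using K[of "fst i" "snd i"] that ab by auto
    qed (use fin disjp len in auto)
    then have s1: "(\<Sum>i\<in>?p1. ?D i) \<le> e"
      by (simp add: case_prod_beta)
    have "?D i \<le> (L + e) * (Sup (snd i) - Inf (snd i))" if i: "i \<in> ?p2" for i
    proof -
      obtain x K where xK: "i = (x, K)" by fastforce
      then have xp: "(x, K) \<in> p" "x \<notin> N" using i by auto
      from K[OF xp(1)] obtain c f where cf: "K = {c..f}" "c \<le> x" "x \<le> f" "a \<le> c" "f \<le> b"
        "Inf K = c" "Sup K = f" "K \<subseteq> G x" by blast
      have xab: "x \<in> {a..b} - N" using cf xp by auto
      then have "K \<subseteq> ball x (d x)" using cf xp by (simp add: G_def)
      moreover have "c \<in> K" "f \<in> K" using cf by auto
      ultimately have "c \<in> ball x (d x)" "f \<in> ball x (d x)" by blast+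
      then have "norm (\<gamma> c - \<gamma> x) \<le> (L + e) * \<bar>c - x\<bar>" "norm (\<gamma> f - \<gamma> x) \<le> (L + e) * \<bar>f - x\<bar>"
        using dd[OF xab] by (auto simp: dist_real_def abs_minus_commute)
      moreover have "dist (\<gamma> c) (\<gamma> f) \<le> norm (\<gamma> c - \<gamma> x) + norm (\<gamma> f - \<gamma> x)"
        by (metis dist_norm dist_triangle2)
      moreover have "(L + e) * \<bar>c - x\<bar> + (L + e) * \<bar>f - x\<bar> = (L + e) * (f - c)"
        using cf by (simp add: algebra_simps)
      ultimately show ?thesis using cf xK by simp
    qed
    then have "(\<Sum>i\<in>?p2. ?D i) \<le> (\<Sum>i\<in>?p2. (L + e) * (Sup (snd i) - Inf (snd i)))"
      by (rule sum_mono)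
    also have "\<dots> \<le> (\<Sum>i\<in>p. (L + e) * (Sup (snd i) - Inf (snd i)))"
      using fin L e Kle by (intro sum_mono2) (auto intro!: mult_nonneg_nonneg)
    also have "\<dots> = (L + e) * (\<Sum>(x,K)\<in>p. Sup K - Inf K)"
      by (simp add: sum_distrib_left case_prod_beta)
    also have "\<dots> = (L + e) * (b - a)"
      using additive_tagged_division_1[OF ab(2) p(1), of id] by simp
    finally have s2: "(\<Sum>i\<in>?p2. ?D i) \<le> (L + e) * (b - a)" .
    have "dist (\<gamma> a) (\<gamma> b) = norm (\<Sum>(x,K)\<in>p. \<gamma> (Sup K) - \<gamma> (Inf K))"
      using additive_tagged_division_1[OF ab(2) p(1), of \<gamma>] by (simp add: dist_norm norm_minus_commute)
    also have "\<dots> \<le> (\<Sum>i\<in>p. ?D i)"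
      by (rule order_trans[OF norm_sum]) (auto simp: dist_norm norm_minus_commute intro!: sum_mono)
    finally show ?thesis
      using s1 s2 split[of ?D] by (simp add: algebra_simps)
  qed
  show ?thesis
  proof (rule field_le_epsilon)
    fix e :: real assume "e > 0"
    then have "dist (\<gamma> a) (\<gamma> b) \<le> L * (b - a) + e / (b - a + 1) * (b - a) + e / (b - a + 1)"
      using ab by (intro main) auto
    also have "\<dots> = L * (b - a) + e / (b - a + 1) * (b - a + 1)"
      by (simp only: distrib_left mult_1_right add.assoc)
    also have "\<dots> = L * (b - a) + e"
      using ab by simp
    finally show "dist (\<gamma> a) (\<gamma> b) \<le> L * (b - a) + e" .
  qed
qed

section \<open>The subunit distance\<close>

lemma absolutely_continuous_path_reverse:
  assumes "absolutely_continuous_path 0 T \<gamma>"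
  shows "absolutely_continuous_path 0 T (\<lambda>t. \<gamma> (T - t))"
  unfolding absolutely_continuous_path_iff_modulus
proof (intro allI impI)
  fix \<epsilon> :: real assume "\<epsilon> > 0"
  then obtain \<delta> where \<delta>: "\<delta> > 0" "ac_modulus 0 T \<gamma> \<epsilon> \<delta>"
    using assms unfolding absolutely_continuous_path_iff_modulus by blast
  have "ac_modulus 0 T (\<lambda>t. \<gamma> (T - t)) \<epsilon> \<delta>"
    unfolding ac_modulus_def
  proof (intro allI impI, elim conjE)
    fix n and s t :: "nat \<Rightarrow> real"
    assume st: "\<forall>i<n. 0 \<le> s i \<and> s i \<le> t i \<and> t i \<le> T"
      and disj: "\<forall>i<n. \<forall>j<n. i \<noteq> j \<longrightarrow> {s i<..<t i} \<inter> {s j<..<t j} = {}"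
      and len: "(\<Sum>i<n. t i - s i) < \<delta>"
    have "{T - t i<..<T - s i} \<inter> {T - t j<..<T - s j} = {}" if "i < n" "j < n" "i \<noteq> j" for i j
    proof -
      have "x \<notin> {T - t i<..<T - s i} \<inter> {T - t j<..<T - s j}" for x
        using disj[rule_format, OF that] by (auto simp: set_eq_iff dest!: spec[of _ "T - x"])
      then show ?thesis by blast
    qed
    then have "(\<Sum>i<n. dist (\<gamma> (T - t i)) (\<gamma> (T - s i))) < \<epsilon>"
      using st len by (intro ac_modulus_on_family[OF \<delta>(2)]) auto
    then show "(\<Sum>i<n. dist (\<gamma> (T - s i)) (\<gamma> (T - t i))) < \<epsilon>"
      by (simp add: dist_commute)
  qed
  with \<delta> show "\<exists>\<delta>>0. ac_modulus 0 T (\<lambda>t. \<gamma> (T - t)) \<epsilon> \<delta>" by blast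
qed

lemma subunit_path_reverse:
  assumes "subunit_path X T \<gamma>"
  shows "subunit_path X T (\<lambda>t. \<gamma> (T - t))"
proof -
  obtain \<theta> N where N: "negligible N" and *: "\<And>t. t \<in> {0..T} - N \<Longrightarrow>
        (\<gamma> has_vector_derivative (\<Sum>j\<in>UNIV. \<theta> t $ j *\<^sub>R X j (\<gamma> t))) (at t) \<and>
        (\<Sum>j\<in>UNIV. (\<theta> t $ j)\<^sup>2) \<le> 1"
    using assms unfolding subunit_path_alt by blast
  define N' where "N' = (\<lambda>t. T - t) ` N"
  have "negligible N'"
    unfolding N'_def
    by (rule negligible_differentiable_image_negligible[OF _ N]) (auto intro!: derivative_intros)
  moreover have "((\<lambda>t. \<gamma> (T - t)) has_vector_derivative
      (\<Sum>j\<in>UNIV. (- \<theta> (T - t)) $ j *\<^sub>R X j (\<gamma> (T - t)))) (at t) \<and>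
      (\<Sum>j\<in>UNIV. ((- \<theta> (T - t)) $ j)\<^sup>2) \<le> 1" if t: "t \<in> {0..T} - N'" for t
  proof -
    have "T - t \<in> {0..T} - N" using t by (auto simp: N'_def image_iff)
    note D = *[OF this]
    have "((\<lambda>t. T - t) has_vector_derivative (-1)) (at t)"
      by (auto intro!: derivative_eq_intros)
    from vector_diff_chain_at[OF this] D
    have "((\<gamma> \<circ> (\<lambda>t. T - t)) has_vector_derivative
        ((-1) *\<^sub>R (\<Sum>j\<in>UNIV. \<theta> (T - t) $ j *\<^sub>R X j (\<gamma> (T - t))))) (at t)"
      by blast
    with D show ?thesis
      by (simp add: o_def sum_negf)
  qed
  ultimately show ?thesis
    using assms absolutely_continuous_path_reverse unfolding subunit_path_alt
    by (intro conjI exI[of _ "\<lambda>t. - \<theta> (T - t)"] exI[of _ N']) auto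
qed

lemma d_X_commute: "d_X X x y = d_X X y x"
proof -
  have "(\<exists>\<gamma>. subunit_path X T \<gamma> \<and> \<gamma> 0 = y \<and> \<gamma> T = x)"
    if "subunit_path X T \<gamma>" "\<gamma> 0 = x" "\<gamma> T = y" for T \<gamma> x y
    using subunit_path_reverse[OF that(1)] that by (intro exI[of _ "\<lambda>t. \<gamma> (T - t)"]) auto
  then have "(\<exists>\<gamma>. subunit_path X T \<gamma> \<and> \<gamma> 0 = x \<and> \<gamma> T = y) \<longleftrightarrow>
      (\<exists>\<gamma>. subunit_path X T \<gamma> \<and> \<gamma> 0 = y \<and> \<gamma> T = x)" for T
    by blast
  then show ?thesis unfolding d_X_def by simp
qed

text \<open>
  Clamping the time at \<open>T1\<close> turns a family of disjoint intervals into one family for each of the two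
  pieces, and neither clamping increases lengths; an interval that contains \<open>T1\<close> is thereby cut at \<open>T1\<close>.
\<close>

lemma absolutely_continuous_path_join:
  fixes \<gamma>1 \<gamma>2 :: "real \<Rightarrow> 'a::metric_space"
  assumes ac: "absolutely_continuous_path 0 T1 \<gamma>1" "absolutely_continuous_path 0 T2 \<gamma>2"
    and T: "0 \<le> T1" "0 \<le> T2" and eq: "\<gamma>1 T1 = \<gamma>2 0"
  shows "absolutely_continuous_path 0 (T1 + T2) (\<lambda>t. if t \<le> T1 then \<gamma>1 t else \<gamma>2 (t - T1))"
    (is "absolutely_continuous_path _ _ ?\<gamma>")
  unfolding absolutely_continuous_path_iff_modulus
proof (intro allI impI)
  fix \<epsilon> :: real assume "\<epsilon> > 0"
  then have e2: "\<epsilon> / 2 > 0" by simp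
  then obtain \<delta>1 where \<delta>1: "\<delta>1 > 0" "ac_modulus 0 T1 \<gamma>1 (\<epsilon> / 2) \<delta>1"
    using ac(1) unfolding absolutely_continuous_path_iff_modulus by blast
  obtain \<delta>2 where \<delta>2: "\<delta>2 > 0" "ac_modulus 0 T2 \<gamma>2 (\<epsilon> / 2) \<delta>2"
    using ac(2) e2 unfolding absolutely_continuous_path_iff_modulus by blast
  let ?c1 = "\<lambda>t. min t T1" and ?c2 = "\<lambda>t. max t T1 - T1"
  have "ac_modulus 0 (T1 + T2) ?\<gamma> \<epsilon> (min \<delta>1 \<delta>2)"
    unfolding ac_modulus_def
  proof (intro allI impI, elim conjE)
    fix n and s t :: "nat \<Rightarrow> real"
    assume st: "\<forall>i<n. 0 \<le> s i \<and> s i \<le> t i \<and> t i \<le> T1 + T2"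
      and disj: "\<forall>i<n. \<forall>j<n. i \<noteq> j \<longrightarrow> {s i<..<t i} \<inter> {s j<..<t j} = {}"
      and len: "(\<Sum>i<n. t i - s i) < min \<delta>1 \<delta>2"
    have "(\<Sum>i<n. ?c1 (t i) - ?c1 (s i)) \<le> (\<Sum>i<n. t i - s i)"
         "(\<Sum>i<n. ?c2 (t i) - ?c2 (s i)) \<le> (\<Sum>i<n. t i - s i)"
      using st by (auto intro!: sum_mono)
    with len have len': "(\<Sum>i<n. ?c1 (t i) - ?c1 (s i)) < \<delta>1" "(\<Sum>i<n. ?c2 (t i) - ?c2 (s i)) < \<delta>2"
      by auto
    have d1: "{?c1 (s i)<..<?c1 (t i)} \<inter> {?c1 (s j)<..<?c1 (t j)} = {}" if "i < n" "j < n" "i \<noteq> j" for i j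
      using disj[rule_format, OF that] by (auto simp: set_eq_iff min_def split: if_splits)
    have d2: "{?c2 (s i)<..<?c2 (t i)} \<inter> {?c2 (s j)<..<?c2 (t j)} = {}" if "i < n" "j < n" "i \<noteq> j" for i j
    proof -
      have "x \<notin> {?c2 (s i)<..<?c2 (t i)} \<inter> {?c2 (s j)<..<?c2 (t j)}" for x
        using disj[rule_format, OF that]
        by (auto simp: set_eq_iff max_def split: if_splits dest!: spec[of _ "T1 + x"])
      then show ?thesis by blast
    qed
    have "(\<Sum>i<n. dist (\<gamma>1 (?c1 (s i))) (\<gamma>1 (?c1 (t i)))) < \<epsilon> / 2"
      by (rule ac_modulus_on_family[OF \<delta>1(2)]) (use st T len' d1 in auto)
    moreover have "(\<Sum>i<n. dist (\<gamma>2 (?c2 (s i))) (\<gamma>2 (?c2 (t i)))) < \<epsilon> / 2"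
      by (rule ac_modulus_on_family[OF \<delta>2(2)]) (use st T len' d2 in auto)
    moreover have "dist (?\<gamma> (s i)) (?\<gamma> (t i))
        \<le> dist (\<gamma>1 (?c1 (s i))) (\<gamma>1 (?c1 (t i))) + dist (\<gamma>2 (?c2 (s i))) (\<gamma>2 (?c2 (t i)))"
      if "i < n" for i
      using st that eq dist_triangle[of "\<gamma>1 (s i)" "\<gamma>2 (t i - T1)" "\<gamma>1 T1"] by (auto simp: min_def max_def)
    then have "(\<Sum>i<n. dist (?\<gamma> (s i)) (?\<gamma> (t i)))
        \<le> (\<Sum>i<n. dist (\<gamma>1 (?c1 (s i))) (\<gamma>1 (?c1 (t i)))) + (\<Sum>i<n. dist (\<gamma>2 (?c2 (s i))) (\<gamma>2 (?c2 (t i))))"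
      by (subst sum.distrib[symmetric]) (auto intro!: sum_mono)
    ultimately show "(\<Sum>i<n. dist (?\<gamma> (s i)) (?\<gamma> (t i))) < \<epsilon>" by linarith
  qed
  with \<delta>1 \<delta>2 show "\<exists>\<delta>>0. ac_modulus 0 (T1 + T2) ?\<gamma> \<epsilon> \<delta>"
    by (intro exI[of _ "min \<delta>1 \<delta>2"]) auto
qed

lemma subunit_path_join:
  assumes p: "subunit_path X T1 \<gamma>1" "subunit_path X T2 \<gamma>2"
    and T: "0 \<le> T1" "0 \<le> T2" and eq: "\<gamma>1 T1 = \<gamma>2 0"
  shows "subunit_path X (T1 + T2) (\<lambda>t. if t \<le> T1 then \<gamma>1 t else \<gamma>2 (t - T1))"
    (is "subunit_path _ _ ?\<gamma>")
proof -
  obtain \<theta>1 N1 where N1: "negligible N1" and *: "\<And>t. t \<in> {0..T1} - N1 \<Longrightarrow>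
        (\<gamma>1 has_vector_derivative (\<Sum>j\<in>UNIV. \<theta>1 t $ j *\<^sub>R X j (\<gamma>1 t))) (at t) \<and>
        (\<Sum>j\<in>UNIV. (\<theta>1 t $ j)\<^sup>2) \<le> 1"
    using p unfolding subunit_path_alt by blast
  obtain \<theta>2 N2 where N2: "negligible N2" and **: "\<And>t. t \<in> {0..T2} - N2 \<Longrightarrow>
        (\<gamma>2 has_vector_derivative (\<Sum>j\<in>UNIV. \<theta>2 t $ j *\<^sub>R X j (\<gamma>2 t))) (at t) \<and>
        (\<Sum>j\<in>UNIV. (\<theta>2 t $ j)\<^sup>2) \<le> 1"
    using p unfolding subunit_path_alt by blast
  let ?\<theta> = "\<lambda>t. if t \<le> T1 then \<theta>1 t else \<theta>2 (t - T1)"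
  define N where "N = N1 \<union> (+) T1 ` N2 \<union> {T1}"
  have "negligible N"
    unfolding N_def using N1 N2 by (intro negligible_Un negligible_translation) auto
  moreover have "(?\<gamma> has_vector_derivative (\<Sum>j\<in>UNIV. ?\<theta> t $ j *\<^sub>R X j (?\<gamma> t))) (at t) \<and>
      (\<Sum>j\<in>UNIV. (?\<theta> t $ j)\<^sup>2) \<le> 1" if t: "t \<in> {0..T1 + T2} - N" for t
  proof (cases "t < T1")
    case True
    then have D: "t \<in> {0..T1} - N1" using t by (auto simp: N_def)
    have "(?\<gamma> has_vector_derivative (\<Sum>j\<in>UNIV. \<theta>1 t $ j *\<^sub>R X j (\<gamma>1 t))) (at t)"
      by (rule has_vector_derivative_transform_within_open[where S = "{..<T1}" and f = \<gamma>1])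
         (use *[OF D] True in auto)
    then show ?thesis using *[OF D] True by simp
  next
    case False
    then have t1: "t > T1" using t by (auto simp: N_def)
    then have D: "t - T1 \<in> {0..T2} - N2" using t by (force simp: N_def image_iff)
    have "((\<lambda>t. t - T1) has_vector_derivative 1) (at t)"
      by (auto intro!: derivative_eq_intros)
    from vector_diff_chain_at[OF this] **[OF D]
    have "((\<gamma>2 \<circ> (\<lambda>t. t - T1)) has_vector_derivative
        (1 *\<^sub>R (\<Sum>j\<in>UNIV. \<theta>2 (t - T1) $ j *\<^sub>R X j (\<gamma>2 (t - T1))))) (at t)"
      by blast
    then have "(?\<gamma> has_vector_derivative (\<Sum>j\<in>UNIV. \<theta>2 (t - T1) $ j *\<^sub>R X j (\<gamma>2 (t - T1)))) (at t)"
      by (intro has_vector_derivative_transform_within_open[where S = "{T1<..}" and g = ?\<gamma>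
            and f = "\<gamma>2 \<circ> (\<lambda>t. t - T1)"]) (use t1 in auto)
    then show ?thesis using **[OF D] t1 by simp
  qed
  ultimately show ?thesis
    using absolutely_continuous_path_join[of T1 \<gamma>1 T2 \<gamma>2, OF _ _ T eq] p unfolding subunit_path_alt
    by (intro conjI exI[of _ ?\<theta>] exI[of _ N]) auto
qed

lemma d_X_triangle: "d_X X x z \<le> d_X X x y + d_X X y z"
proof -
  define S where "S = (\<lambda>x y. {ennreal T | T. T > 0 \<and> (\<exists>\<gamma>. subunit_path X T \<gamma> \<and> \<gamma> 0 = x \<and> \<gamma> T = y)})"
  have dS: "d_X X x y = Inf (S x y)" for x y by (simp add: d_X_def S_def)
  have sum: "d_X X x z \<le> a + b" if ab: "a \<in> S x y" "b \<in> S y z" for a b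
  proof -
    obtain T1 \<gamma>1 T2 \<gamma>2 where *: "a = ennreal T1" "T1 > 0" "subunit_path X T1 \<gamma>1" "\<gamma>1 0 = x" "\<gamma>1 T1 = y"
      "b = ennreal T2" "T2 > 0" "subunit_path X T2 \<gamma>2" "\<gamma>2 0 = y" "\<gamma>2 T2 = z"
      using ab unfolding S_def by blast
    have "ennreal (T1 + T2) \<in> S x z"
      unfolding S_def using * subunit_path_join[of X T1 \<gamma>1 T2 \<gamma>2]
      by (intro CollectI exI[of _ "T1 + T2"] conjI exI[of _ "\<lambda>t. if t \<le> T1 then \<gamma>1 t else \<gamma>2 (t - T1)"]) auto
    then have "d_X X x z \<le> ennreal (T1 + T2)" unfolding dS by (rule Inf_lower)
    then show ?thesis using * by simp
  qed
  show ?thesis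
  proof (rule ennreal_le_epsilon)
    fix e :: real assume fin: "d_X X x y + d_X X y z < top" and e: "0 < e"
    have "d_X X x y < d_X X x y + ennreal (e/2)" "d_X X y z < d_X X y z + ennreal (e/2)"
      using fin e by (auto simp: ennreal_add_left_cancel_less[where b = 0, simplified])
    then obtain a b where ab: "a \<in> S x y" "a < d_X X x y + ennreal (e/2)"
        "b \<in> S y z" "b < d_X X y z + ennreal (e/2)"
      unfolding dS Inf_less_iff by blast
    have "d_X X x z \<le> a + b" using sum ab by blast
    also have "\<dots> \<le> (d_X X x y + ennreal (e/2)) + (d_X X y z + ennreal (e/2))"
      using ab by (intro add_mono) auto
    also have "\<dots> = d_X X x y + d_X X y z + (ennreal (e/2) + ennreal (e/2))"
      by (simp add: algebra_simps)
    also have "ennreal (e/2) + ennreal (e/2) = ennreal e"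
      using e by (subst ennreal_plus[symmetric]) auto
    finally show "d_X X x z \<le> d_X X x y + d_X X y z + ennreal e" .
  qed
qed

lemma absolutely_continuous_path_continuous_on:
  assumes "absolutely_continuous_path a b \<gamma>"
  shows "continuous_on {a..b} \<gamma>"
  unfolding continuous_on_iff
proof (intro ballI allI impI)
  fix x and e :: real assume x: "x \<in> {a..b}" and "e > 0"
  then obtain \<delta> where \<delta>: "\<delta> > 0" "ac_modulus a b \<gamma> e \<delta>"
    using assms unfolding absolutely_continuous_path_iff_modulus by blast
  have "dist (\<gamma> y) (\<gamma> x) < e" if y: "y \<in> {a..b}" "dist y x < \<delta>" for y
  proof -
    have "(\<Sum>i\<in>{()}. dist (\<gamma> (min x y)) (\<gamma> (max x y))) < e"
      using \<delta> x y by (intro ac_modulus_on_family[where I = "{()}"]) (auto simp: dist_real_def)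
    then show ?thesis by (auto simp: min_def max_def dist_commute split: if_splits)
  qed
  with \<delta> show "\<exists>d>0. \<forall>x'\<in>{a..b}. dist x' x < d \<longrightarrow> dist (\<gamma> x') (\<gamma> x) < e" by blast
qed

lemma locally_lipschitz_fields_continuous_on:
  assumes "locally_lipschitz_fields X"
  shows "continuous_on S (X j)"
proof (rule continuous_at_imp_continuous_on, rule ballI)
  fix x
  obtain r L where "r > 0" "L-lipschitz_on (ball x r) (X j)"
    using assms unfolding locally_lipschitz_fields_def by blast
  then have "continuous_on (ball x r) (X j)" by (auto intro: lipschitz_on_continuous_on)
  then show "isCont (X j) x"
    using \<open>r > 0\<close> by (auto simp: continuous_on_eq_continuous_at)
qed

text \<open>
  On the compact ball of radius \<open>e\<close> the fields are bounded, so a subunit path starting at \<open>x\<close> has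
  bounded speed up to its first exit from this ball and needs at least the time \<open>e / L\<close> to leave it.
\<close>

lemma X_ball_subset_ball:
  fixes X :: "'m::finite \<Rightarrow> real^'n::finite \<Rightarrow> real^'n"
  assumes lip: "locally_lipschitz_fields X" and e: "e > 0"
  obtains r where "r > 0" "X_ball X x r \<subseteq> ball x e"
proof -
  have "\<exists>B>0. \<forall>y\<in>cball x e. norm (X j y) \<le> B" for j
  proof -
    have "bounded (X j ` cball x e)"
      by (intro compact_imp_bounded compact_continuous_image
          locally_lipschitz_fields_continuous_on[OF lip]) auto
    then show ?thesis unfolding bounded_pos by blast
  qed
  then obtain B where B: "\<And>j. B j > 0" "\<And>j y. y \<in> cball x e \<Longrightarrow> norm (X j y) \<le> B j"
    by metis
  define L where "L = (\<Sum>j\<in>UNIV. B j)"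
  have L: "L > 0" unfolding L_def using B by (intro sum_pos) auto
  have "X_ball X x (e / L) \<subseteq> ball x e"
  proof
    fix y assume "y \<in> X_ball X x (e / L)"
    then obtain T \<gamma> where T: "T > 0" "T < e / L" and p: "subunit_path X T \<gamma>" "\<gamma> 0 = x" "\<gamma> T = y"
      unfolding X_ball_def d_X_def Inf_less_iff by (auto simp: ennreal_less_iff)
    obtain \<theta> N where ac: "absolutely_continuous_path 0 T \<gamma>" and N: "negligible N"
      and d: "\<And>t. t \<in> {0..T} - N \<Longrightarrow>
        (\<gamma> has_vector_derivative (\<Sum>j\<in>UNIV. \<theta> t $ j *\<^sub>R X j (\<gamma> t))) (at t) \<and>
        (\<Sum>j\<in>UNIV. (\<theta> t $ j)\<^sup>2) \<le> 1"
      using p(1) unfolding subunit_path_alt by blast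
    show "y \<in> ball x e"
    proof (rule ccontr)
      assume y: "y \<notin> ball x e"
      \<comment> \<open>\<open>Inf S\<close> is the first exit time from the ball.\<close>
      define S where "S = {t \<in> {0..T}. e \<le> dist x (\<gamma> t)}"
      have "closed S"
        unfolding S_def
        by (intro continuous_closed_preimage_constant continuous_on_closed_Collect_le
            continuous_intros absolutely_continuous_path_continuous_on ac)
      moreover have S: "S \<noteq> {}" "bdd_below S"
        using y T p by (auto simp: S_def intro!: exI[of _ T] bdd_belowI[of _ 0])
      ultimately have "Inf S \<in> S" by (intro closed_contains_Inf)
      then have I: "0 \<le> Inf S" "Inf S \<le> T" "e \<le> dist x (\<gamma> (Inf S))" by (auto simp: S_def)
      have before: "dist x (\<gamma> t) < e" if "0 \<le> t" "t < Inf S" for t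
        using cInf_lower[of t S] S that I by (force simp: S_def not_le[symmetric])
      have "dist (\<gamma> 0) (\<gamma> (Inf S)) \<le> L * (Inf S - 0)"
      proof (rule absolutely_continuous_path_dist_le[OF ac])
        show "negligible (N \<union> {Inf S})" using N by (intro negligible_Un) auto
        fix t assume t: "t \<in> {0..Inf S} - (N \<union> {Inf S})"
        then have in_ball: "\<gamma> t \<in> cball x e" using before[of t] by auto
        have D: "(\<gamma> has_vector_derivative (\<Sum>j\<in>UNIV. \<theta> t $ j *\<^sub>R X j (\<gamma> t))) (at t)"
          and le1: "(\<Sum>j\<in>UNIV. (\<theta> t $ j)\<^sup>2) \<le> 1"
          using d[of t] t I by auto
        have "\<bar>\<theta> t $ j\<bar> \<le> 1" for j
        proof -
          have "(\<theta> t $ j)\<^sup>2 \<le> (\<Sum>j\<in>UNIV. (\<theta> t $ j)\<^sup>2)" by (rule member_le_sum) auto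
          with le1 have "(\<theta> t $ j)\<^sup>2 \<le> 1" by linarith
          then show ?thesis by (simp add: abs_square_le_1)
        qed
        then have "norm (\<Sum>j\<in>UNIV. \<theta> t $ j *\<^sub>R X j (\<gamma> t)) \<le> L"
          unfolding L_def using B(2)[OF in_ball] B(1)
          by (intro sum_norm_le) (metis abs_ge_zero mult_mono mult_1 norm_ge_zero norm_scaleR zero_le_one)
        with D show "\<exists>v. (\<gamma> has_vector_derivative v) (at t) \<and> norm v \<le> L" by blast
      qed (use L I in auto)
      also have "\<dots> \<le> L * T" using L I by simp
      also have "\<dots> < e" using T L by (simp add: field_simps)
      finally show False using I p by simp
    qed
  qed
  with e L that show ?thesis by (metis divide_pos_pos)
qed

section \<open>Balls, doubling, and the size of the domain\<close>

lemma X_ball_mono: "r \<le> s \<Longrightarrow> X_ball X x r \<subseteq> X_ball X x s"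
  unfolding X_ball_def by (auto intro: less_le_trans ennreal_leI)

lemma X_ball_subset_X_ball:
  assumes "d_X X x y < ennreal D" "0 \<le> r" "0 \<le> D"
  shows "X_ball X y r \<subseteq> X_ball X x (D + r)"
proof
  fix z assume "z \<in> X_ball X y r"
  then have "d_X X x y + d_X X y z < ennreal D + ennreal r"
    using assms(1) by (intro add_strict_mono) (auto simp: X_ball_def)
  then show "z \<in> X_ball X x (D + r)"
    using d_X_triangle[of X x z y] assms by (simp add: X_ball_def)
qed

text \<open>
  The metric part of the standing assumptions. Emptiness is excluded because the lemmas below pick a
  point of \<open>\<Omega>\<close>.
\<close>

locale doubling_domain =
  fixes X :: "'m::finite \<Rightarrow> real^'n::finite \<Rightarrow> real^'n" and \<Omega> :: "(real^'n) set" and Q :: real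
  assumes open_domain: "open \<Omega>" and bounded_domain: "bounded \<Omega>" and domain_nonempty: "\<Omega> \<noteq> {}"
    and lipschitz: "locally_lipschitz_fields X"
    and connected: "subunit_connected X \<Omega>"
    and d_continuous: "d_X_continuous X \<Omega>"
    and doubling: "X_doubling X \<Omega> Q"
begin

lemma emeasure_X_ball_pos:
  assumes "x \<in> \<Omega>" "r > 0"
  shows "0 < emeasure lebesgue (X_ball X x r)"
  using doubling assms unfolding X_doubling_def by (metis field_sum_of_halves half_gt_zero mult_2)

lemma X_ball_sets: "x \<in> \<Omega> \<Longrightarrow> r > 0 \<Longrightarrow> X_ball X x r \<in> sets lebesgue"
  using emeasure_X_ball_pos emeasure_notin_sets by force

text \<open>
  Balls of small radius are contained in Euclidean balls and therefore have finite measure; doubling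
  carries this over to all radii.
\<close>

lemma X_ball_lmeasurable [intro]:
  assumes x: "x \<in> \<Omega>" and r: "r > 0"
  shows "X_ball X x r \<in> lmeasurable"
proof -
  obtain r0 where r0: "r0 > 0" "X_ball X x r0 \<subseteq> ball x 1"
    using X_ball_subset_ball[OF lipschitz zero_less_one] .
  have "emeasure lebesgue (X_ball X x (2 ^ n * r0)) < \<infinity>" for n
  proof (induction n)
    case 0
    have "emeasure lebesgue (X_ball X x r0) \<le> emeasure lebesgue (ball x 1)"
      using r0 by (intro emeasure_mono) auto
    also have "\<dots> < \<infinity>" using lmeasurable_ball[of x 1] by (auto simp: fmeasurable_def)
    finally show ?case by simp
  next
    case (Suc n)
    have "emeasure lebesgue (X_ball X x (2 * (2 ^ n * r0)))
        \<le> ennreal (2 powr Q) * emeasure lebesgue (X_ball X x (2 ^ n * r0))"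
      using doubling x r0 unfolding X_doubling_def by (metis mult_pos_pos zero_less_numeral zero_less_power)
    also have "\<dots> < \<infinity>" using Suc by (simp add: ennreal_mult_less_top)
    finally show ?case by (simp add: mult.assoc)
  qed
  moreover obtain n where "r / r0 < 2 ^ n"
    using real_arch_pow[of 2 "r / r0"] by auto
  then have "r \<le> 2 ^ n * r0" using r0 by (simp add: field_simps)
  then have "emeasure lebesgue (X_ball X x r) \<le> emeasure lebesgue (X_ball X x (2 ^ n * r0))"
    using x r0 by (intro emeasure_mono X_ball_mono X_ball_sets) auto
  ultimately show ?thesis
    using X_ball_sets[OF x r] by (intro fmeasurableI) (auto intro: le_less_trans)
qed

lemma measure_X_ball_pos:
  assumes "x \<in> \<Omega>" "r > 0"
  shows "0 < measure lebesgue (X_ball X x r)"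
  using emeasure_X_ball_pos[OF assms] emeasure_eq_measure2[OF X_ball_lmeasurable[OF assms]] by simp

lemma measure_X_ball_double:
  assumes "x \<in> \<Omega>" "r > 0"
  shows "measure lebesgue (X_ball X x (2 * r)) \<le> 2 powr Q * measure lebesgue (X_ball X x r)"
proof -
  have "emeasure lebesgue (X_ball X x (2 * r)) \<le> ennreal (2 powr Q) * emeasure lebesgue (X_ball X x r)"
    using doubling assms unfolding X_doubling_def by blast
  moreover have "X_ball X x (2 * r) \<in> lmeasurable" using assms by auto
  ultimately show ?thesis
    using X_ball_lmeasurable[OF assms]
    by (simp add: emeasure_eq_measure2 ennreal_mult[symmetric])
qed

lemma measure_X_ball_halve:
  assumes "x \<in> \<Omega>" "r > 0"
  shows "measure lebesgue (X_ball X x r) \<le> (2 powr Q) ^ n * measure lebesgue (X_ball X x (r / 2 ^ n))"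
proof (induction n)
  case (Suc n)
  have "measure lebesgue (X_ball X x (r / 2 ^ n)) = measure lebesgue (X_ball X x (2 * (r / 2 ^ Suc n)))"
    by simp
  also have "\<dots> \<le> 2 powr Q * measure lebesgue (X_ball X x (r / 2 ^ Suc n))"
    using assms by (intro measure_X_ball_double) auto
  finally show ?case
    using Suc by (auto intro: order_trans mult_left_mono simp: mult.assoc)
qed auto

lemma uniform_euclidean_ball:
  assumes "r > 0"
  obtains \<delta> where "\<delta> > 0" "\<And>x. x \<in> \<Omega> \<Longrightarrow> ball x \<delta> \<subseteq> X_ball X x r"
proof -
  have "\<exists>\<delta>>0. \<forall>x\<in>\<Omega>. \<forall>y. norm (y - x) < \<delta> \<longrightarrow> d_X X x y < ennreal r"
    using d_continuous assms unfolding d_X_continuous_def by simp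
  then show ?thesis
    using that unfolding X_ball_def by (metis dist_commute dist_norm mem_Collect_eq mem_ball subsetI)
qed

lemma d_X_finite:
  assumes "x \<in> \<Omega>" "y \<in> \<Omega>"
  shows "d_X X x y < \<infinity>"
proof -
  obtain T where "T > 0" "\<exists>\<gamma>. subunit_path X T \<gamma> \<and> \<gamma> 0 = x \<and> \<gamma> T = y"
    using connected assms unfolding subunit_connected_def by blast
  then have "d_X X x y \<le> ennreal T"
    unfolding d_X_def by (intro Inf_lower) blast
  then show ?thesis by (simp add: le_less_trans)
qed

text \<open>
  \<open>\<Omega>\<close> is covered by finitely many Euclidean balls on which the distance to the centre is below one,
  and the finitely many centres have finite distances from each other.
\<close>

lemma d_X_diameter_finite:
  obtains D where "D > 0" "\<And>x y. x \<in> \<Omega> \<Longrightarrow> y \<in> \<Omega> \<Longrightarrow> d_X X x y < ennreal D"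
proof -
  obtain \<delta> where \<delta>: "\<delta> > 0" "\<And>x. x \<in> \<Omega> \<Longrightarrow> ball x \<delta> \<subseteq> X_ball X x 1"
    using uniform_euclidean_ball[of 1] by auto
  have "closure \<Omega> \<subseteq> (\<Union>x\<in>\<Omega>. ball x \<delta>)"
  proof
    fix z assume "z \<in> closure \<Omega>"
    then obtain x where "x \<in> \<Omega>" "dist x z < \<delta>" using \<delta>(1) closure_approachable by blast
    then show "z \<in> (\<Union>x\<in>\<Omega>. ball x \<delta>)" by auto
  qed
  then obtain C where C: "C \<subseteq> \<Omega>" "finite C" "closure \<Omega> \<subseteq> (\<Union>x\<in>C. ball x \<delta>)"
    using bounded_domain by (auto intro: compactE_image[of "closure \<Omega>" \<Omega> "\<lambda>x. ball x \<delta>"])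
  define m where "m = (\<Sum>a\<in>C. \<Sum>b\<in>C. enn2real (d_X X a b))"
  have m: "m \<ge> 0" unfolding m_def by (intro sum_nonneg) auto
  have "d_X X x y < ennreal (1 + m + 1)" if xy: "x \<in> \<Omega>" "y \<in> \<Omega>" for x y
  proof -
    have "\<exists>a\<in>C. d_X X a z < ennreal 1" if "z \<in> \<Omega>" for z
      using C(3) closure_subset[of \<Omega>] that \<delta>(2) C(1) unfolding X_ball_def by blast
    then obtain a b where ab: "a \<in> C" "b \<in> C" "d_X X a x < ennreal 1" "d_X X b y < ennreal 1"
      using xy by meson
    have "enn2real (d_X X a b) \<le> (\<Sum>b\<in>C. enn2real (d_X X a b))"
      using ab C by (intro member_le_sum) auto
    also have "\<dots> \<le> m"
      unfolding m_def using ab C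
      by (intro member_le_sum[of a C "\<lambda>a. \<Sum>b\<in>C. enn2real (d_X X a b)"]) (auto intro: sum_nonneg)
    finally have abM: "d_X X a b \<le> ennreal m"
      using d_X_finite[of a b] ab C by (metis ennreal_enn2real ennreal_leI infinity_ennreal_def subsetD)
    have "d_X X x y \<le> d_X X x a + d_X X a y" by (rule d_X_triangle)
    also have "\<dots> \<le> d_X X a x + (d_X X a b + d_X X b y)"
      by (intro add_mono d_X_triangle) (simp add: d_X_commute)
    also have "\<dots> \<le> d_X X a x + (ennreal m + ennreal 1)"
      using abM ab by (intro add_mono) auto
    also have "\<dots> < ennreal 1 + (ennreal m + ennreal 1)"
      using ab(3) by (simp add: ennreal_add_left_cancel_less add.commute ennreal_plus[symmetric] del: ennreal_plus)
    also have "\<dots> = ennreal (1 + m + 1)" 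
      by (simp only: ennreal_plus[OF zero_le_one add_nonneg_nonneg[OF m zero_le_one]]
          ennreal_plus[OF m zero_le_one] add.assoc)
    finally show ?thesis .
  qed
  with m show ?thesis by (intro that[of "1 + m + 1"]) auto
qed

text \<open>
  The set \<open>Z\<close> is what replaces the boundary condition: test functions vanish on it, and it fills a fixed
  amount of every ball of radius \<open>D\<close>. It is a small Euclidean ball placed just beyond a point of the
  closure with the largest \<open>i\<close>-th coordinate, within the range in which Euclidean nearness to \<open>\<Omega>\<close>
  forces a small subunit distance.
\<close>

lemma collar_in_large_balls:
  obtains D Z where "D > 0" "Z \<in> lmeasurable" "measure lebesgue Z > 0" "Z \<inter> \<Omega> = {}"
    "\<And>x. x \<in> \<Omega> \<Longrightarrow> \<Omega> \<union> Z \<subseteq> X_ball X x D"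
proof -
  obtain D where D: "D > 0" "\<And>x y. x \<in> \<Omega> \<Longrightarrow> y \<in> \<Omega> \<Longrightarrow> d_X X x y < ennreal D"
    using d_X_diameter_finite by blast
  obtain \<delta> where \<delta>: "\<delta> > 0" "\<And>x. x \<in> \<Omega> \<Longrightarrow> ball x \<delta> \<subseteq> X_ball X x 1"
    using uniform_euclidean_ball[of 1] by auto
  fix i :: 'n
  have "compact (closure \<Omega>)" "closure \<Omega> \<noteq> {}" using bounded_domain domain_nonempty by auto
  moreover have "continuous_on (closure \<Omega>) (\<lambda>y. y $ i)" by (intro continuous_intros)
  ultimately have "\<exists>z\<in>closure \<Omega>. \<forall>y\<in>closure \<Omega>. y $ i \<le> z $ i"
    by (rule continuous_attains_sup)
  then obtain z where z: "z \<in> closure \<Omega>" "\<And>y. y \<in> closure \<Omega> \<Longrightarrow> y $ i \<le> z $ i"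
    by blast
  obtain x where x: "x \<in> \<Omega>" "dist x z < \<delta> / 4"
    using z(1) \<delta>(1) closure_approachable[of z \<Omega>] by (meson divide_pos_pos zero_less_numeral)
  \<comment> \<open>Since \<open>x\<close> is within \<open>\<delta> / 4\<close> of the extremal point \<open>z\<close>, the ball of radius \<open>\<delta> / 4\<close> about \<open>w\<close> lies beyond \<open>z\<close>.\<close>
  define w where "w = x + (\<delta> / 2) *\<^sub>R axis i 1"
  define Z where "Z = ball w (\<delta> / 4)"
  have "\<bar>(x - z) $ i\<bar> \<le> norm (x - z)" by (rule component_le_norm_cart)
  then have xz: "x $ i > z $ i - \<delta> / 4" using x by (simp add: dist_norm)
  have "y \<notin> \<Omega>" if "y \<in> Z" for y
  proof
    assume "y \<in> \<Omega>"
    then have "y $ i \<le> z $ i" using z(2) closure_subset by blast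
    moreover have "\<bar>y $ i - w $ i\<bar> < \<delta> / 4"
      using component_le_norm_cart[of "y - w" i] that
      by (simp add: Z_def dist_norm norm_minus_commute)
    moreover have "w $ i = x $ i + \<delta> / 2" by (simp add: w_def axis_def)
    ultimately show False using xz by linarith
  qed
  moreover have "Z \<subseteq> ball x \<delta>"
  proof
    fix y assume "y \<in> Z"
    moreover have "dist x w = \<delta> / 2" using \<delta>(1) by (simp add: w_def dist_norm norm_axis_1)
    ultimately show "y \<in> ball x \<delta>"
      using dist_triangle[of x y w] \<delta>(1) by (simp add: Z_def)
  qed
  then have Z1: "Z \<subseteq> X_ball X x 1" using \<delta>(2) x by blast
  have "\<Omega> \<union> Z \<subseteq> X_ball X y (D + 1)" if y: "y \<in> \<Omega>" for y
  proof -
    have "\<Omega> \<subseteq> X_ball X y D" using D(2)[OF y] by (auto simp: X_ball_def)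
    then show ?thesis
      using X_ball_subset_X_ball[OF D(2)[OF y x(1)], of 1] Z1 X_ball_mono[of D "D + 1" X y] D(1) by auto
  qed
  moreover have "Z \<in> lmeasurable" "measure lebesgue Z > 0"
    using \<delta>(1) by (auto simp: Z_def content_ball_pos)
  ultimately show ?thesis using D(1) by (intro that[of "D + 1" Z]) auto
qed

end

section \<open>Elementary inequalities\<close>

text \<open>
  Hoelder's inequality against an indicator function, up to the factor 2. It follows from the elementary
  \<open>y \<le> l powr (p - 1) * y powr p + 1 / l\<close> (one of the two terms already dominates, according to
  whether \<open>l * y\<close> exceeds one), integrated over \<open>A\<close> and optimized in \<open>l\<close>.
\<close>

lemma Holder_on_set:
  fixes g :: "'a \<Rightarrow> real"
  assumes g: "g \<in> borel_measurable M" "\<And>x. 0 \<le> g x" "integrable M (\<lambda>x. g x powr p)" and p: "1 < p"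
    and A: "A \<in> sets M" "emeasure M A < \<infinity>"
  shows "set_integrable M A g"
    and "(LINT x:A|M. g x) \<le> 2 * (\<integral>x. g x powr p \<partial>M) powr (1 / p) * measure M A powr (1 - 1 / p)"
proof -
  have young: "y \<le> l powr (p - 1) * y powr p + 1 / l" if "l > 0" "y \<ge> 0" for l y :: real
  proof (cases "l * y \<le> 1")
    case True
    then have "y \<le> 1 / l" using that by (simp add: field_simps)
    moreover have "0 \<le> l powr (p - 1) * y powr p" using that by simp
    ultimately show ?thesis by linarith
  next
    case False
    then have y: "y > 0" using that by (cases "y = 0") auto
    have "y * 1 \<le> y * (l * y) powr (p - 1)"
      using False p y by (intro mult_left_mono ge_one_powr_ge_zero) auto
    also have "\<dots> = l powr (p - 1) * y powr p"
      using y that by (simp add: powr_mult powr_mult_base powr_diff)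
    finally show ?thesis using that by (simp add: add_increasing2)
  qed
  have int: "integrable M (indicat_real A)"
    using A by (intro integrable_real_indicator) auto
  show si: "set_integrable M A g"
    unfolding set_integrable_def
  proof (rule Bochner_Integration.integrable_bound[OF Bochner_Integration.integrable_add[OF g(3) int]])
    show "(\<lambda>x. indicat_real A x *\<^sub>R g x) \<in> borel_measurable M" using g A by simp
    show "AE x in M. norm (indicat_real A x *\<^sub>R g x) \<le> norm (g x powr p + indicat_real A x)"
      using young[of 1] g(2) by (intro AE_I2) (auto simp: indicator_def abs_of_nonneg)
  qed
  let ?I = "\<integral>x. g x powr p \<partial>M" and ?m = "measure M A" and ?J = "LINT x:A|M. g x"
  have I0: "?I \<ge> 0" by (intro integral_nonneg_AE) auto
  have bound: "?J \<le> l powr (p - 1) * ?I + ?m / l" if l: "l > 0" for l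
  proof -
    have "?J \<le> (\<integral>x. l powr (p - 1) * g x powr p + (1 / l) * indicat_real A x \<partial>M)"
      unfolding set_lebesgue_integral_def
    proof (rule integral_mono)
      show "integrable M (\<lambda>x. indicat_real A x *\<^sub>R g x)" using si by (simp add: set_integrable_def)
      show "integrable M (\<lambda>x. l powr (p - 1) * g x powr p + (1 / l) * indicat_real A x)"
        using g(3) int by (intro Bochner_Integration.integrable_add integrable_mult_right) auto
      show "indicat_real A x *\<^sub>R g x \<le> l powr (p - 1) * g x powr p + (1 / l) * indicat_real A x" for x
        using young[OF l g(2)[of x]] l by (auto simp: indicator_def)
    qed
    also have "\<dots> = l powr (p - 1) * ?I + (1 / l) * ?m"
      using g(3) int A by (subst Bochner_Integration.integral_add) auto
    finally show ?thesis by simp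
  qed
  show "?J \<le> 2 * ?I powr (1 / p) * ?m powr (1 - 1 / p)"
  proof (cases "?I = 0 \<or> ?m = 0")
    case True
    have "AE x in M. indicat_real A x *\<^sub>R g x = 0"
    proof (cases "?m = 0")
      case True
      then have "A \<in> null_sets M"
        using A by (intro null_setsI) (auto simp: measure_eq_emeasure_eq_ennreal emeasure_eq_ennreal_measure)
      then have "AE x in M. x \<notin> A" by (rule AE_not_in)
      then show ?thesis by (auto elim: eventually_mono)
    next
      case False
      then have "AE x in M. g x powr p = 0"
        using True integral_nonneg_eq_0_iff_AE[OF g(3)] by simp
      then show ?thesis using p by (auto elim!: eventually_mono)
    qed
    then have "?J = 0" unfolding set_lebesgue_integral_def by (rule integral_eq_zero_AE)
    then show ?thesis by simp
  next
    case False
    then have pos: "?I > 0" "?m > 0" using I0 by (auto simp: less_le)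
    \<comment> \<open>For this \<open>l\<close> the two terms of the bound coincide.\<close>
    define l where "l = (?m / ?I) powr (1 / p)"
    have l: "l > 0" using pos by (simp add: l_def)
    have lnl: "ln l = (ln ?m - ln ?I) / p" using pos by (simp add: l_def ln_powr ln_div)
    have "l powr (p - 1) * ?I = exp ((p - 1) * ln l + ln ?I)"
      using l pos by (simp add: powr_def exp_add)
    also have "(p - 1) * ln l + ln ?I = (1 / p) * ln ?I + (1 - 1 / p) * ln ?m"
      using p by (simp add: lnl field_simps)
    also have "exp \<dots> = ?I powr (1 / p) * ?m powr (1 - 1 / p)"
      using pos by (simp add: powr_def exp_add)
    finally have 1: "l powr (p - 1) * ?I = ?I powr (1 / p) * ?m powr (1 - 1 / p)" .
    have "?m / l = exp (ln ?m - ln l)"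
      using l pos by (simp add: exp_diff)
    also have "ln ?m - ln l = (1 / p) * ln ?I + (1 - 1 / p) * ln ?m"
      using p by (simp add: lnl field_simps)
    also have "exp \<dots> = ?I powr (1 / p) * ?m powr (1 - 1 / p)"
      using pos by (simp add: powr_def exp_add)
    finally show ?thesis using bound[OF l] 1 by (simp add: mult_ac)
  qed
qed

lemma sum_powr_le_powr_sum:
  fixes a :: "'i \<Rightarrow> real"
  assumes "finite I" "\<And>i. i \<in> I \<Longrightarrow> 0 \<le> a i" "1 \<le> q"
  shows "(\<Sum>i\<in>I. a i powr q) \<le> (\<Sum>i\<in>I. a i) powr q"
proof (cases "(\<Sum>i\<in>I. a i) = 0")
  case True
  then show ?thesis using assms by (simp add: sum_nonneg_eq_0_iff)
next
  case False
  let ?S = "\<Sum>i\<in>I. a i"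
  have S: "?S > 0" using False sum_nonneg[of I a] assms by force
  have "a i powr q \<le> a i * ?S powr (q - 1)" if i: "i \<in> I" for i
  proof (cases "a i = 0")
    case nz: False
    have "a i \<le> ?S" using assms i by (intro member_le_sum) auto
    then have "a i * a i powr (q - 1) \<le> a i * ?S powr (q - 1)"
      using assms i by (intro mult_left_mono powr_mono2) auto
    then show ?thesis using nz assms(2)[OF i] by (simp add: powr_mult_base)
  qed auto
  then have "(\<Sum>i\<in>I. a i powr q) \<le> (\<Sum>i\<in>I. a i * ?S powr (q - 1))" by (rule sum_mono)
  also have "\<dots> = ?S * ?S powr (q - 1)" by (simp add: sum_distrib_right)
  also have "\<dots> = ?S powr q" using S by (simp add: powr_mult_base)
  finally show ?thesis .
qed

text \<open>
  The pigeonhole step: if every \<open>e i\<close> were at most a small multiple of \<open>t * \<theta> ^ i\<close>, the geometric series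
  would keep the limit below \<open>t / 2\<close>.
\<close>

lemma telescoping_exceeds_geometric:
  fixes a e :: "nat \<Rightarrow> real"
  assumes lim: "a \<longlonglongrightarrow> l" and K: "0 < K" and \<theta>: "0 < \<theta>" "\<theta> < 1"
    and a0: "\<bar>a 0\<bar> \<le> K * e 0" and step: "\<And>i. \<bar>a (Suc i) - a i\<bar> \<le> K * e i"
    and t: "0 < t" "t \<le> \<bar>l\<bar>"
  obtains i where "t * (1 - \<theta>) / (4 * K) * \<theta> ^ i < e i"
proof -
  define c where "c = t * (1 - \<theta>) / (4 * K)"
  have c: "c > 0" using assms by (simp add: c_def)
  have "\<exists>i. c * \<theta> ^ i < e i"
  proof (rule ccontr)
    assume "\<nexists>i. c * \<theta> ^ i < e i"
    then have e: "e i \<le> c * \<theta> ^ i" for i by (meson not_le)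
    have bound: "\<bar>a n\<bar> \<le> K * c * (1 + (\<Sum>i<n. \<theta> ^ i))" for n
    proof (induction n)
      case 0
      have "K * e 0 \<le> K * c" using e[of 0] K by simp
      then show ?case using a0 by simp
    next
      case (Suc n)
      have "\<bar>a (Suc n)\<bar> \<le> \<bar>a (Suc n) - a n\<bar> + \<bar>a n\<bar>" by linarith
      also have "\<dots> \<le> K * (c * \<theta> ^ n) + K * c * (1 + (\<Sum>i<n. \<theta> ^ i))"
        using step[of n] e[of n] K Suc by (intro add_mono) (auto intro: order_trans mult_left_mono)
      finally show ?case by (simp add: algebra_simps)
    qed
    have "\<bar>a n\<bar> \<le> t / 2" for n
    proof -
      have "(\<Sum>i<n. \<theta> ^ i) \<le> (\<Sum>i. \<theta> ^ i)"
        using \<theta> by (intro sum_le_suminf summable_geometric) auto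
      also have "\<dots> = 1 / (1 - \<theta>)" using \<theta> by (intro suminf_geometric) auto
      finally have "1 + (\<Sum>i<n. \<theta> ^ i) \<le> 1 + 1 / (1 - \<theta>)" by simp
      also have "\<dots> \<le> 2 / (1 - \<theta>)" using \<theta> by (simp add: field_simps)
      finally have "K * c * (1 + (\<Sum>i<n. \<theta> ^ i)) \<le> K * c * (2 / (1 - \<theta>))"
        using K c by (intro mult_left_mono) auto
      also have "\<dots> = t / 2" using K \<theta> by (simp add: c_def field_simps)
      finally show ?thesis using bound[of n] by linarith
    qed
    then have "\<bar>l\<bar> \<le> t / 2"
      using tendsto_rabs[OF lim] by (intro Lim_bounded[of "\<lambda>n. \<bar>a n\<bar>"]) auto
    with t show False by linarith
  qed
  then show ?thesis using that by (auto simp: c_def)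
qed

text \<open>
  Used with \<open>c\<close> the mean over \<open>B\<close>, to compare means over nested sets, and with \<open>c\<close> the value of \<open>u\<close> at a
  point.
\<close>

lemma abs_mean_value_diff_le:
  fixes u :: "real^'n::finite \<Rightarrow> real"
  assumes u: "set_integrable lebesgue B u" and B: "B \<in> lmeasurable" "B' \<in> lmeasurable" "B' \<subseteq> B"
    and pos: "measure lebesgue B' > 0"
  shows "\<bar>mean_value B' u - c\<bar> \<le> (LINT y:B|lebesgue. \<bar>u y - c\<bar>) / measure lebesgue B'"
proof -
  have c: "set_integrable lebesgue A (\<lambda>y. c)" if "A \<in> lmeasurable" for A
    unfolding set_integrable_def using that by (intro integrable_scaleR_left integrable_real_indicator) (auto simp: fmeasurable_def)
  have u': "set_integrable lebesgue B' u"
    using u B by (rule_tac set_integrable_subset) auto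
  have "mean_value B' u - c = (LINT y:B'|lebesgue. u y - c) / measure lebesgue B'"
  proof -
    have "(LINT y:B'|lebesgue. u y - c) = (LINT y:B'|lebesgue. u y) - (LINT y:B'|lebesgue. c)"
      using u' c[OF B(2)] by (rule set_integral_diff)
    also have "(LINT y:B'|lebesgue. c) = measure lebesgue B' * c"
      using B(2) by (simp add: set_lebesgue_integral_def fmeasurable_def)
    finally show ?thesis using pos by (simp add: mean_value_def field_simps)
  qed
  moreover have "\<bar>LINT y:B'|lebesgue. u y - c\<bar> \<le> (LINT y:B|lebesgue. \<bar>u y - c\<bar>)"
  proof -
    have d: "set_integrable lebesgue B (\<lambda>y. u y - c)" using u c[OF B(1)] by (rule set_integral_diff)
    have d': "set_integrable lebesgue B' (\<lambda>y. u y - c)" using u' c[OF B(2)] by (rule set_integral_diff)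
    have "\<bar>LINT y:B'|lebesgue. u y - c\<bar> \<le> (LINT y:B'|lebesgue. \<bar>u y - c\<bar>)"
      using set_integral_norm_bound[OF d'] by simp
    also have "\<dots> \<le> (LINT y:B|lebesgue. \<bar>u y - c\<bar>)"
      using set_integrable_abs[OF d] set_integrable_abs[OF d'] B(3)
      unfolding set_lebesgue_integral_def set_integrable_def
      by (intro integral_mono) (auto simp: indicator_def)
    finally show ?thesis .
  qed
  ultimately show ?thesis using pos by (simp add: divide_right_mono)
qed


section \<open>A finite covering lemma\<close>

text \<open>
  The dilation factor is a power of two so that doubling applies to the larger ball directly.
\<close>

lemma X_ball_meets_imp_subset:
  assumes "X_ball X x r \<inter> X_ball X y s \<noteq> {}" "0 \<le> r" "r \<le> s"
  shows "X_ball X x r \<subseteq> X_ball X y (4 * s)"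
proof -
  obtain z where z: "d_X X x z < ennreal r" "d_X X y z < ennreal s"
    using assms(1) by (auto simp: X_ball_def)
  have "d_X X y x \<le> d_X X y z + d_X X x z"
    using d_X_triangle[of X y x z] by (simp add: d_X_commute)
  also have "\<dots> < ennreal s + ennreal r" using z by (intro add_strict_mono)
  finally have "d_X X y x < ennreal (s + r)" using assms by simp
  then have "X_ball X x r \<subseteq> X_ball X y (s + r + r)"
    using assms by (intro X_ball_subset_X_ball) auto
  also have "\<dots> \<subseteq> X_ball X y (4 * s)" using assms by (intro X_ball_mono) auto
  finally show ?thesis .
qed

text \<open>
  Greedy selection: keep a ball of largest radius, drop all balls that meet it, and continue with the
  rest.
\<close>

lemma finite_Vitali_X_balls:
  fixes c :: "'i \<Rightarrow> real^'n::finite" and r :: "'i \<Rightarrow> real"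
  assumes "finite F" "\<And>i. i \<in> F \<Longrightarrow> 0 < r i"
  shows "\<exists>G\<subseteq>F. (\<forall>i\<in>G. \<forall>j\<in>G. i \<noteq> j \<longrightarrow> X_ball X (c i) (r i) \<inter> X_ball X (c j) (r j) = {}) \<and>
    (\<forall>i\<in>F. \<exists>j\<in>G. X_ball X (c i) (r i) \<subseteq> X_ball X (c j) (4 * r j))"
  using assms
proof (induction "card F" arbitrary: F rule: less_induct)
  case less
  show ?case
  proof (cases "F = {}")
    case True then show ?thesis by simp
  next
    case False
    then have "Max (r ` F) \<in> r ` F" using less.prems(1) by (intro Max_in) auto
    then obtain k where "k \<in> F" "r k = Max (r ` F)" by auto
    then have k: "k \<in> F" "\<And>i. i \<in> F \<Longrightarrow> r i \<le> r k"
      using less.prems(1) by (auto intro: Max_ge)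
    define F' where "F' = {i \<in> F - {k}. X_ball X (c i) (r i) \<inter> X_ball X (c k) (r k) = {}}"
    have "card F' < card F"
      using k(1) less.prems(1) by (intro psubset_card_mono) (auto simp: F'_def)
    moreover have "finite F'" "\<And>i. i \<in> F' \<Longrightarrow> 0 < r i" using less.prems by (auto simp: F'_def)
    ultimately have "\<exists>G\<subseteq>F'. (\<forall>i\<in>G. \<forall>j\<in>G. i \<noteq> j \<longrightarrow> X_ball X (c i) (r i) \<inter> X_ball X (c j) (r j) = {}) \<and>
        (\<forall>i\<in>F'. \<exists>j\<in>G. X_ball X (c i) (r i) \<subseteq> X_ball X (c j) (4 * r j))"
      by (rule less.hyps)
    then obtain G where G: "G \<subseteq> F'"
      "\<forall>i\<in>G. \<forall>j\<in>G. i \<noteq> j \<longrightarrow> X_ball X (c i) (r i) \<inter> X_ball X (c j) (r j) = {}"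
      "\<forall>i\<in>F'. \<exists>j\<in>G. X_ball X (c i) (r i) \<subseteq> X_ball X (c j) (4 * r j)"
      by (elim exE conjE)
    have "\<exists>j\<in>insert k G. X_ball X (c i) (r i) \<subseteq> X_ball X (c j) (4 * r j)" if i: "i \<in> F" for i
    proof (cases "i \<in> F'")
      case True then show ?thesis using G(3) by blast
    next
      case False
      then have "i = k \<or> X_ball X (c i) (r i) \<inter> X_ball X (c k) (r k) \<noteq> {}" using i by (auto simp: F'_def)
      then have "X_ball X (c i) (r i) \<subseteq> X_ball X (c k) (4 * r k)"
      proof
        assume "i = k"
        then show ?thesis using less.prems(2)[OF k(1)] by (simp add: X_ball_mono)
      next
        assume "X_ball X (c i) (r i) \<inter> X_ball X (c k) (r k) \<noteq> {}"
        then show ?thesis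
          by (rule X_ball_meets_imp_subset) (use k(2)[OF i] less.prems(2)[OF i] in auto)
      qed
      then show ?thesis by blast
    qed
    moreover have "insert k G \<subseteq> F" using G(1) k(1) by (auto simp: F'_def)
    moreover have "X_ball X (c i) (r i) \<inter> X_ball X (c j) (r j) = {}"
      if "i \<in> insert k G" "j \<in> insert k G" "i \<noteq> j" for i j
    proof (cases "i = k \<or> j = k")
      case True
      then show ?thesis using that G(1) by (auto simp: F'_def)
    next
      case False
      then show ?thesis using that G(2) by simp
    qed
    ultimately show ?thesis
      by (intro exI[of _ "insert k G"] conjI ballI impI)
  qed
qed

section \<open>Calculus of test functions\<close>

lemma partial_deriv_eq:
  "(u has_derivative u') (at x) \<Longrightarrow> partial_deriv i u x = u' (axis i 1)"
  unfolding partial_deriv_def by (metis frechet_derivative_at)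

lemma Ck_on_Suc_imp: "Ck_on (Suc k) UNIV u \<Longrightarrow> Ck_on k UNIV u"
  by (induction k arbitrary: u) (auto intro!: continuous_at_imp_continuous_on differentiable_imp_continuous_within)

lemma Ck_on_add:
  assumes "Ck_on k UNIV u" "Ck_on k UNIV v"
  shows "Ck_on k UNIV (\<lambda>x. u x + v x)"
  using assms
proof (induction k arbitrary: u v)
  case (Suc k)
  have d: "u differentiable (at x)" "v differentiable (at x)" for x using Suc.prems by auto
  have "partial_deriv i (\<lambda>x. u x + v x) = (\<lambda>x. partial_deriv i u x + partial_deriv i v x)" for i
    using partial_deriv_eq[OF has_derivative_add[OF d[unfolded frechet_derivative_works]]]
    by (intro ext) (simp add: partial_deriv_def)
  with Suc d show ?case by auto
qed (auto intro: continuous_intros)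

lemma Ck_on_mult:
  assumes "Ck_on k UNIV u" "Ck_on k UNIV v"
  shows "Ck_on k UNIV (\<lambda>x. u x * v x)"
  using assms
proof (induction k arbitrary: u v)
  case (Suc k)
  have d: "u differentiable (at x)" "v differentiable (at x)" for x using Suc.prems by auto
  have "partial_deriv i (\<lambda>x. u x * v x) = (\<lambda>x. u x * partial_deriv i v x + partial_deriv i u x * v x)" for i
    using partial_deriv_eq[OF has_derivative_mult[OF d[unfolded frechet_derivative_works]]]
    by (intro ext) (simp add: partial_deriv_def)
  moreover have "Ck_on k UNIV (\<lambda>x. u x * partial_deriv i v x + partial_deriv i u x * v x)" for i
    using Suc.prems by (intro Ck_on_add Suc.IH Ck_on_Suc_imp[of k u] Ck_on_Suc_imp[of k v]) auto
  ultimately show ?case using d by auto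
qed (auto intro: continuous_intros)

text \<open>
  Smoothness as the existence of the whole sequence of derivatives, which makes \<open>Ck_on_compose\<close> an
  induction over \<open>k\<close> for all members of the sequence at once.
\<close>

definition smooth_real :: "(real \<Rightarrow> real) \<Rightarrow> bool" where
  "smooth_real f \<longleftrightarrow> (\<exists>D. D 0 = f \<and> (\<forall>n s. (D n has_real_derivative D (Suc n) s) (at s)))"

lemma partial_deriv_compose:
  assumes "u differentiable (at x)" "(f has_real_derivative f') (at (u x))"
  shows "partial_deriv i (\<lambda>x. f (u x)) x = f' * partial_deriv i u x"
proof -
  have "((\<lambda>x. f (u x)) has_derivative (\<lambda>h. f' * frechet_derivative u (at x) h)) (at x)"
    using has_derivative_compose[of u "frechet_derivative u (at x)" x UNIV f "(*) f'"] assms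
    by (simp add: frechet_derivative_works has_field_derivative_def)
  from partial_deriv_eq[OF this] show ?thesis by (simp add: partial_deriv_def)
qed

text \<open>
  The partial derivatives of \<open>D n \<circ> u\<close> are products of \<open>D (Suc n) \<circ> u\<close> with partial derivatives of \<open>u\<close>,
  so the induction on \<open>k\<close> has to treat all \<open>n\<close> simultaneously.
\<close>

lemma Ck_on_compose:
  assumes f: "smooth_real f" and u: "\<And>k. Ck_on k UNIV u"
  shows "Ck_on k UNIV (\<lambda>x. f (u x))"
proof -
  obtain D where D: "D 0 = f" "\<And>n s. (D n has_real_derivative D (Suc n) s) (at s)"
    using f unfolding smooth_real_def by blast
  have du: "u differentiable (at x)" for x using u[of 1] by simp
  have "Ck_on k UNIV (\<lambda>x. D n (u x))" for n
  proof (induction k arbitrary: n)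
    case 0
    have "continuous_on UNIV (D n)"
      using D(2) DERIV_isCont by (blast intro: continuous_at_imp_continuous_on)
    then show ?case using u[of 0] by (auto intro: continuous_on_compose2)
  next
    case (Suc k)
    have "partial_deriv i (\<lambda>x. D n (u x)) = (\<lambda>x. D (Suc n) (u x) * partial_deriv i u x)" for i
      using partial_deriv_compose[OF du D(2)] by (intro ext)
    moreover have "(\<lambda>x. D n (u x)) differentiable (at x)" for x
      using differentiable_chain_at[OF du, of "D n" x] D(2)
      by (auto simp: o_def real_differentiable_def)
    ultimately show ?case using Suc u[of "Suc k"] by (auto intro: Ck_on_mult)
  qed
  from this[of 0] show ?thesis using D(1) by simp
qed

lemma test_functionD:
  assumes "u \<in> test_functions \<Omega>"
  shows "Ck_on k UNIV u" "continuous_on S u" "u differentiable (at x)" "continuous_on S (partial_deriv i u)"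
    "compact (closure {x. u x \<noteq> 0})" "closure {x. u x \<noteq> 0} \<subseteq> \<Omega>"
proof -
  have C: "Ck_on k UNIV u" for k using assms by (simp add: test_functions_def)
  show "Ck_on k UNIV u" by (rule C)
  show "continuous_on S u" using C[of 0] by (auto intro: continuous_on_subset)
  show "u differentiable (at x)" using C[of 1] by simp
  show "continuous_on S (partial_deriv i u)" using C[of 1] by (auto intro: continuous_on_subset)
qed (use assms in \<open>auto simp: test_functions_def\<close>)

lemma test_function_zero_outside: "u \<in> test_functions \<Omega> \<Longrightarrow> x \<notin> \<Omega> \<Longrightarrow> u x = 0"
  using test_functionD(6)[of u \<Omega>] closure_subset[of "{x. u x \<noteq> 0}"] by blast

lemma X_grad_zero_outside_support:
  assumes "x \<notin> closure {x. u x \<noteq> 0}"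
  shows "X_grad X u x = 0"
proof -
  have "(u has_derivative (\<lambda>h. 0)) (at x)"
    by (rule has_derivative_transform_within_open[where f = "\<lambda>x. 0" and s = "- closure {x. u x \<noteq> 0}"])
       (use assms closure_subset[of "{x. u x \<noteq> 0}"] in auto)
  then have "partial_deriv k u x = 0" for k by (simp add: partial_deriv_eq)
  then show ?thesis by (simp add: X_grad_def vec_eq_iff)
qed

lemma X_grad_zero_outside: "u \<in> test_functions \<Omega> \<Longrightarrow> x \<notin> \<Omega> \<Longrightarrow> X_grad X u x = 0"
  using X_grad_zero_outside_support[of x u X] test_functionD(6)[of u \<Omega>] by blast

lemma X_grad_continuous_on:
  assumes "locally_lipschitz_fields X" "u \<in> test_functions \<Omega>"
  shows "continuous_on S (X_grad X u)"
  unfolding X_grad_def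
  using locally_lipschitz_fields_continuous_on[OF assms(1)] test_functionD(4)[OF assms(2)]
  by (intro continuous_intros) auto

lemma compactly_supported_integrable:
  fixes g :: "'a::euclidean_space \<Rightarrow> 'b::euclidean_space"
  assumes "continuous_on UNIV g" "compact K" "\<And>x. x \<notin> K \<Longrightarrow> g x = 0"
  shows "integrable lebesgue g"
proof -
  have "integrable lborel (\<lambda>x. indicat_real K x *\<^sub>R g x)"
    using assms by (intro borel_integrable_compact continuous_on_subset[OF assms(1)]) auto
  moreover have "(\<lambda>x. indicat_real K x *\<^sub>R g x) = g"
    using assms(3) by (auto simp: indicator_def)
  ultimately have "integrable lborel g" by simp
  then show ?thesis by (subst integrable_completion) auto
qed

lemma test_function_compose:
  assumes f: "smooth_real f" "f 0 = 0" and u: "u \<in> test_functions \<Omega>"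
  shows "(\<lambda>x. f (u x)) \<in> test_functions \<Omega>"
proof -
  have "closure {x. f (u x) \<noteq> 0} \<subseteq> closure {x. u x \<noteq> 0}"
    using f(2) by (intro closure_mono) auto
  moreover from this have "compact (closure {x. f (u x) \<noteq> 0})"
    using test_functionD(5)[OF u] by (meson bounded_subset closed_closure compact_eq_bounded_closed)
  ultimately show ?thesis
    using Ck_on_compose[OF f(1) test_functionD(1)[OF u]] test_functionD(6)[OF u]
    unfolding test_functions_def by auto
qed

lemma X_grad_compose:
  assumes "(f has_real_derivative f') (at (u x))" "u \<in> test_functions \<Omega>"
  shows "X_grad X (\<lambda>x. f (u x)) x = f' *\<^sub>R X_grad X u x"
  using partial_deriv_compose[OF test_functionD(3)[OF assms(2)] assms(1)]
  by (simp add: X_grad_def vec_eq_iff sum_distrib_left algebra_simps)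

section \<open>Smooth truncations\<close>

lemma smooth_real_add:
  assumes "smooth_real f" "smooth_real g" shows "smooth_real (\<lambda>s. f s + g s)"
proof -
  obtain D E where "D 0 = f" "\<And>n s. (D n has_real_derivative D (Suc n) s) (at s)"
    "E 0 = g" "\<And>n s. (E n has_real_derivative E (Suc n) s) (at s)"
    using assms unfolding smooth_real_def by blast
  then show ?thesis unfolding smooth_real_def
    by (intro exI[of _ "\<lambda>n s. D n s + E n s"]) (auto intro!: DERIV_add)
qed

lemma smooth_real_affine:
  assumes "smooth_real f" shows "smooth_real (\<lambda>s. c * f (a * s + b))"
proof -
  obtain D where D: "D 0 = f" "\<And>n s. (D n has_real_derivative D (Suc n) s) (at s)"
    using assms unfolding smooth_real_def by blast
  have "((\<lambda>s. c * a ^ n * D n (a * s + b)) has_real_derivative c * a ^ Suc n * D (Suc n) (a * s + b)) (at s)" for n s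
  proof -
    have "((\<lambda>s. D n (a * s + b)) has_real_derivative D (Suc n) (a * s + b) * a) (at s)"
      by (rule DERIV_chain2[OF D(2)]) (auto intro!: derivative_eq_intros)
    from DERIV_cmult[OF this, of "c * a ^ n"] show ?thesis by (simp add: mult_ac)
  qed
  with D(1) show ?thesis unfolding smooth_real_def
    by (intro exI[of _ "\<lambda>n s. c * a ^ n * D n (a * s + b)"]) auto
qed

definition softplus :: "real \<Rightarrow> real" where "softplus s = ln (1 + exp s)"

definition sigmoid :: "real \<Rightarrow> real" where "sigmoid s = exp s / (1 + exp s)"

lemma one_plus_exp_nz: "1 + exp (s::real) \<noteq> 0"
  by (metis add_pos_pos exp_gt_zero less_irrefl zero_less_one)

lemma sigmoid_bounds: "0 < sigmoid s" "sigmoid s < 1"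
  by (auto simp: sigmoid_def add_pos_pos field_simps)

lemma sigmoid_minus: "sigmoid (- s) = 1 - sigmoid s"
  using one_plus_exp_nz[of s] by (simp add: sigmoid_def exp_minus field_simps)

lemma sigmoid_mono: "s \<le> t \<Longrightarrow> sigmoid s \<le> sigmoid t"
  using add_pos_pos[OF zero_less_one exp_gt_zero[of s]] add_pos_pos[OF zero_less_one exp_gt_zero[of t]]
  by (simp add: sigmoid_def divide_le_eq le_divide_eq) (simp add: field_simps)

lemma DERIV_softplus: "(softplus has_real_derivative sigmoid s) (at s)"
  unfolding softplus_def[abs_def] sigmoid_def
  by (auto intro!: derivative_eq_intros simp: add_pos_pos field_simps)

lemma DERIV_sigmoid: "(sigmoid has_real_derivative sigmoid s * (1 - sigmoid s)) (at s)"
  unfolding sigmoid_def[abs_def] using one_plus_exp_nz[of s]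
  by (auto intro!: derivative_eq_intros simp: field_simps)

text \<open>
  The derivative of \<open>sigmoid\<close> is \<open>sigmoid * (1 - sigmoid)\<close>, hence all derivatives of \<open>softplus\<close> are
  polynomials in \<open>sigmoid\<close>.
\<close>

lemma smooth_real_softplus: "smooth_real softplus"
proof -
  define P where "P = rec_nat [:0, 1:] (\<lambda>_ q. pderiv q * [:0, 1, -1 :: real:])"
  have P: "P 0 = [:0, 1:]" "P (Suc n) = pderiv (P n) * [:0, 1, -1:]" for n by (simp_all add: P_def)
  define D where "D = case_nat softplus (\<lambda>n s. poly (P n) (sigmoid s))"
  have "(D n has_real_derivative D (Suc n) s) (at s)" for n s
  proof (cases n)
    case 0
    then show ?thesis using DERIV_softplus by (simp add: D_def P(1))
  next
    case (Suc m)
    have "((\<lambda>s. poly (P m) (sigmoid s)) has_real_derivative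
        poly (pderiv (P m)) (sigmoid s) * (sigmoid s * (1 - sigmoid s))) (at s)"
      by (rule DERIV_chain2[OF poly_DERIV DERIV_sigmoid])
    then show ?thesis using Suc by (simp add: D_def P(2) algebra_simps)
  qed
  then show ?thesis unfolding smooth_real_def by (intro exI[of _ D]) (simp add: D_def)
qed

lemma softplus_approx:
  assumes "e > 0" shows "\<bar>e * softplus (x / e) - max x 0\<bar> \<le> e"
proof -
  have "\<bar>softplus s - max s 0\<bar> \<le> 1" for s
  proof (cases "s \<le> 0")
    case True
    have "0 \<le> softplus s" unfolding softplus_def by (intro ln_ge_zero) simp
    moreover have "softplus s \<le> exp s" unfolding softplus_def by (intro ln_add_one_self_le_self) simp
    moreover have "exp s \<le> 1" using True by simp
    ultimately have "\<bar>softplus s\<bar> \<le> 1" by linarith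
    then show ?thesis using True by (simp add: max_absorb2)
  next
    case False
    have "softplus s = ln (exp s * (1 + exp (- s)))"
      by (simp add: softplus_def algebra_simps exp_minus)
    also have "\<dots> = s + ln (1 + exp (- s))" using one_plus_exp_nz[of "- s"] by (subst ln_mult) auto
    finally have "softplus s = s + ln (1 + exp (- s))" .
    moreover have "0 \<le> ln (1 + exp (- s))" by (intro ln_ge_zero) simp
    moreover have "ln (1 + exp (- s)) \<le> exp (- s)" by (intro ln_add_one_self_le_self) simp
    moreover have "exp (- s) \<le> 1" using False by simp
    ultimately have "\<bar>softplus s - s\<bar> \<le> 1" by linarith
    then show ?thesis using False by (simp add: max_absorb1)
  qed
  then have "e * \<bar>softplus (x / e) - max (x / e) 0\<bar> \<le> e * 1"
    using assms by (intro mult_left_mono) auto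
  moreover have "e * max (x / e) 0 = max x 0" using assms by (auto simp: max_def field_simps)
  ultimately show ?thesis using assms
    by (metis abs_mult abs_of_pos mult.right_neutral right_diff_distrib)
qed

text \<open>
  The odd function \<open>sgn s * min (max (\<bar>s\<bar> - k) 0) (h - k)\<close>, written as a combination of positive parts because
  each of these has the smooth approximation \<open>e * softplus (x / e)\<close>.
\<close>

definition trunc :: "real \<Rightarrow> real \<Rightarrow> real \<Rightarrow> real" where
  "trunc k h s = max (s - k) 0 - max (s - h) 0 - max (- s - k) 0 + max (- s - h) 0"

lemma trunc_facts:
  assumes "0 \<le> k" "k < h"
  shows "\<bar>trunc k h s\<bar> \<le> h - k" "\<bar>s\<bar> \<le> k \<Longrightarrow> trunc k h s = 0" "h \<le> \<bar>s\<bar> \<Longrightarrow> \<bar>trunc k h s\<bar> = h - k"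
  using assms by (auto simp: trunc_def max_def)

definition smooth_trunc :: "real \<Rightarrow> real \<Rightarrow> real \<Rightarrow> real \<Rightarrow> real" where
  "smooth_trunc e k h s = e * softplus ((s - k) / e) - e * softplus ((s - h) / e)
     - e * softplus ((- s - k) / e) + e * softplus ((- s - h) / e)"

definition smooth_trunc' :: "real \<Rightarrow> real \<Rightarrow> real \<Rightarrow> real \<Rightarrow> real" where
  "smooth_trunc' e k h s = sigmoid ((s - k) / e) - sigmoid ((s - h) / e)
     + sigmoid ((- s - k) / e) - sigmoid ((- s - h) / e)"

lemma smooth_trunc_approx:
  assumes "e > 0" shows "\<bar>smooth_trunc e k h s - trunc k h s\<bar> \<le> 4 * e"
proof -
  have combine: "\<bar>(a1 - a2 - a3 + a4) - (b1 - b2 - b3 + b4)\<bar> \<le> 4 * e"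
    if "\<bar>a1 - b1\<bar> \<le> e" "\<bar>a2 - b2\<bar> \<le> e" "\<bar>a3 - b3\<bar> \<le> e" "\<bar>a4 - b4\<bar> \<le> e" for a1 a2 a3 a4 b1 b2 b3 b4
    using that unfolding abs_le_iff by linarith
  show ?thesis
    unfolding smooth_trunc_def trunc_def by (rule combine) (rule softplus_approx[OF assms])+
qed

lemma smooth_trunc_0: "smooth_trunc e k h 0 = 0"
  by (simp add: smooth_trunc_def)

lemma smooth_real_smooth_trunc: "e > 0 \<Longrightarrow> smooth_real (smooth_trunc e k h)"
proof -
  assume e: "e > 0"
  have "smooth_real (\<lambda>s. (e * softplus (1 / e * s + (- k / e)) + (- e) * softplus (1 / e * s + (- h / e)))
     + ((- e) * softplus ((- 1 / e) * s + (- k / e)) + e * softplus ((- 1 / e) * s + (- h / e))))"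
    by (intro smooth_real_add smooth_real_affine smooth_real_softplus)
  moreover have "(\<lambda>s. (e * softplus (1 / e * s + (- k / e)) + (- e) * softplus (1 / e * s + (- h / e)))
     + ((- e) * softplus ((- 1 / e) * s + (- k / e)) + e * softplus ((- 1 / e) * s + (- h / e))))
     = smooth_trunc e k h"
    by (rule ext) (simp add: smooth_trunc_def diff_divide_distrib)
  ultimately show ?thesis by simp
qed

lemma DERIV_smooth_trunc:
  assumes "e > 0" shows "(smooth_trunc e k h has_real_derivative smooth_trunc' e k h s) (at s)"
proof -
  have 1: "((\<lambda>s. e * softplus ((s - a) / e)) has_real_derivative sigmoid ((s - a) / e)) (at s)" for a
  proof -
    have "((\<lambda>s. softplus ((s - a) / e)) has_real_derivative sigmoid ((s - a) / e) * (1 / e)) (at s)"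
      by (rule DERIV_chain2[OF DERIV_softplus]) (use assms in \<open>auto intro!: derivative_eq_intros\<close>)
    from DERIV_cmult[OF this, of e] show ?thesis using assms by simp
  qed
  have 2: "((\<lambda>s. e * softplus ((- s - a) / e)) has_real_derivative - sigmoid ((- s - a) / e)) (at s)" for a
  proof -
    have "((\<lambda>s. softplus ((- s - a) / e)) has_real_derivative sigmoid ((- s - a) / e) * (- 1 / e)) (at s)"
      by (rule DERIV_chain2[OF DERIV_softplus]) (use assms in \<open>auto intro!: derivative_eq_intros\<close>)
    from DERIV_cmult[OF this, of e] show ?thesis using assms by simp
  qed
  show ?thesis
    unfolding smooth_trunc_def[abs_def] smooth_trunc'_def
    by (rule DERIV_cong[OF DERIV_add[OF DERIV_diff[OF DERIV_diff[OF 1 1] 2] 2]]) simp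
qed

text \<open>
  The two differences are nonnegative since \<open>sigmoid\<close> increases. For the upper bound, \<open>k \<ge> 0\<close> gives
  \<open>(- s - k) / e \<le> - (s - k) / e\<close>, and \<open>sigmoid (- y) = 1 - sigmoid y\<close>.
\<close>

lemma smooth_trunc'_bounds:
  assumes e: "e > 0" and kh: "0 \<le> k" "k < h"
  shows "0 \<le> smooth_trunc' e k h s" "smooth_trunc' e k h s \<le> 1"
proof -
  have "sigmoid ((s - h) / e) \<le> sigmoid ((s - k) / e)" "sigmoid ((- s - h) / e) \<le> sigmoid ((- s - k) / e)"
    using e kh by (auto intro!: sigmoid_mono divide_right_mono)
  then show "0 \<le> smooth_trunc' e k h s" by (simp add: smooth_trunc'_def)
  have "sigmoid ((- s - k) / e) \<le> sigmoid (- ((s - k) / e))"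
    using e kh by (intro sigmoid_mono) (simp add: field_simps)
  then show "smooth_trunc' e k h s \<le> 1"
    using sigmoid_minus[of "(s - k) / e"] sigmoid_bounds[of "(s - h) / e"] sigmoid_bounds[of "(- s - h) / e"]
    unfolding smooth_trunc'_def by linarith
qed

lemma isCont_smooth_trunc':
  assumes "e > 0" shows "isCont (smooth_trunc' e k h) s"
proof -
  have "isCont sigmoid x" for x by (rule DERIV_isCont[OF DERIV_sigmoid])
  then have 1: "isCont (\<lambda>s. sigmoid (g s)) s" if "isCont g s" for g
    using that by (rule isCont_o2[rotated])
  show ?thesis
    unfolding smooth_trunc'_def[abs_def] using assms
    by (intro isCont_add isCont_diff 1 isCont_divide isCont_minus continuous_ident continuous_const) auto
qed

section \<open>The Poincare inequality in terms of the energy\<close>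

definition X_energy ::
    "('m::finite \<Rightarrow> real^'n::finite \<Rightarrow> real^'n) \<Rightarrow> (real^'n \<Rightarrow> real) \<Rightarrow> (real^'n) set \<Rightarrow> real" where
  "X_energy X u B = (LINT y:B|lebesgue. (norm (X_grad X u y))\<^sup>2)"

lemma mean_nn_eq:
  assumes "set_integrable lebesgue B g" "\<And>y. 0 \<le> g y" "B \<in> lmeasurable" "0 < measure lebesgue B"
  shows "mean_nn B g = ennreal ((LINT y:B|lebesgue. g y) / measure lebesgue B)"
proof -
  have "(\<integral>\<^sup>+y\<in>B. ennreal (g y) \<partial>lebesgue) = (\<integral>\<^sup>+y. ennreal (indicat_real B y *\<^sub>R g y) \<partial>lebesgue)"
    by (intro nn_integral_cong) (auto simp: indicator_def)
  also have "\<dots> = ennreal (LINT y:B|lebesgue. g y)"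
    unfolding set_lebesgue_integral_def using assms(1,2)
    by (intro nn_integral_eq_integral) (auto simp: set_integrable_def indicator_def)
  finally show ?thesis
    using assms by (simp add: mean_nn_def emeasure_eq_measure2 divide_ennreal set_lebesgue_integral_def
        integral_nonneg_AE)
qed

lemma set_integrable_subset_lebesgue:
  fixes g :: "'a::euclidean_space \<Rightarrow> real"
  assumes "integrable lebesgue g" "B \<in> sets lebesgue"
  shows "set_integrable lebesgue B g"
  unfolding set_integrable_def using integrable_mult_indicator[OF assms(2,1)] .

locale poincare_domain = doubling_domain X \<Omega> Q for X :: "'m::finite \<Rightarrow> real^'n::finite \<Rightarrow> real^'n" and \<Omega> Q +
  assumes Q_pos: "Q > 0" and poincare: "X_poincare X \<Omega>"
begin

lemma test_function_integrable:
  assumes "u \<in> test_functions \<Omega>"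
  shows "integrable lebesgue u" "integrable lebesgue (\<lambda>y. norm (X_grad X u y))"
    "integrable lebesgue (\<lambda>y. (norm (X_grad X u y))\<^sup>2)"
proof -
  note c = X_grad_continuous_on[OF lipschitz assms] and K = test_functionD(5)[OF assms]
  show "integrable lebesgue u"
    using closure_subset[of "{x. u x \<noteq> 0}"]
    by (intro compactly_supported_integrable[OF _ K] test_functionD(2)[OF assms]) auto
  show "integrable lebesgue (\<lambda>y. norm (X_grad X u y))"
    by (intro compactly_supported_integrable[OF _ K] continuous_intros c)
       (simp add: X_grad_zero_outside_support)
  show "integrable lebesgue (\<lambda>y. (norm (X_grad X u y))\<^sup>2)"
    by (intro compactly_supported_integrable[OF _ K] continuous_intros c)
       (simp add: X_grad_zero_outside_support)
qed

lemma X_energy_nonneg: "0 \<le> X_energy X u B"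
  unfolding X_energy_def set_lebesgue_integral_def by (intro integral_nonneg_AE) auto

lemma X_energy_Cauchy_Schwarz:
  assumes u: "u \<in> test_functions \<Omega>" and B: "B \<in> lmeasurable"
  shows "(LINT y:B|lebesgue. norm (X_grad X u y)) \<le> 2 * sqrt (X_energy X u B * measure lebesgue B)"
proof -
  let ?g = "\<lambda>y. indicat_real B y * norm (X_grad X u y)"
  have sq: "?g y powr 2 = indicat_real B y * (norm (X_grad X u y))\<^sup>2" for y
    by (simp add: indicator_def)
  have Bs: "B \<in> sets lebesgue" "emeasure lebesgue B < \<infinity>" using B by (auto simp: fmeasurable_def)
  have "(LINT y:B|lebesgue. ?g y) \<le> 2 * (\<integral>y. ?g y powr 2 \<partial>lebesgue) powr (1 / 2) * measure lebesgue B powr (1 - 1 / 2)"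
  proof (rule Holder_on_set(2))
    show "?g \<in> borel_measurable lebesgue"
      using test_function_integrable(2)[OF u] Bs by measurable
    show "integrable lebesgue (\<lambda>y. ?g y powr 2)"
      unfolding sq using integrable_mult_indicator[OF Bs(1) test_function_integrable(3)[OF u]] by simp
  qed (use Bs in auto)
  also have "(LINT y:B|lebesgue. ?g y) = (LINT y:B|lebesgue. norm (X_grad X u y))"
    unfolding set_lebesgue_integral_def by (intro Bochner_Integration.integral_cong) (auto simp: indicator_def)
  also have "(\<integral>y. ?g y powr 2 \<partial>lebesgue) = X_energy X u B"
    unfolding sq by (simp add: X_energy_def set_lebesgue_integral_def)
  finally show ?thesis
    using X_energy_nonneg[of u B] by (simp add: powr_half_sqrt real_sqrt_mult)
qed

text \<open>
  The Poincare inequality in the form in which it is used: the mean of \<open>\<bar>Xu\<bar>\<close> is replaced by the quadratic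
  mean, because the energy is what the equation controls.
\<close>

lemma poincare_energy:
  obtains C \<nu> where "C > 0" "\<nu> > 0"
    "\<And>x r u. x \<in> \<Omega> \<Longrightarrow> r > 0 \<Longrightarrow> u \<in> test_functions \<Omega> \<Longrightarrow>
      (LINT y:X_ball X x r|lebesgue. \<bar>u y - mean_value (X_ball X x r) u\<bar>)
        \<le> measure lebesgue (X_ball X x r) *
          (C * r * sqrt (X_energy X u (X_ball X x (\<nu> * r)) / measure lebesgue (X_ball X x (\<nu> * r))))"
proof -
  obtain C \<nu> where C: "C > 0" "\<nu> > 0" and P: "\<And>x r u. x \<in> \<Omega> \<Longrightarrow> r > 0 \<Longrightarrow>
        C1_closed (closure (X_ball X x (\<nu> * r))) u \<Longrightarrow> set_integrable lebesgue (X_ball X x r) u \<Longrightarrow>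
        mean_nn (X_ball X x r) (\<lambda>y. \<bar>u y - mean_value (X_ball X x r) u\<bar>)
          \<le> ennreal (C * r) * mean_nn (X_ball X x (\<nu> * r)) (\<lambda>y. norm (X_grad X u y))"
    using poincare unfolding X_poincare_def by blast
  have "(LINT y:X_ball X x r|lebesgue. \<bar>u y - mean_value (X_ball X x r) u\<bar>)
        \<le> measure lebesgue (X_ball X x r) *
          (2 * C * r * sqrt (X_energy X u (X_ball X x (\<nu> * r)) / measure lebesgue (X_ball X x (\<nu> * r))))"
    if x: "x \<in> \<Omega>" and r: "r > 0" and u: "u \<in> test_functions \<Omega>" for x r u
  proof -
    let ?B = "X_ball X x r" and ?B' = "X_ball X x (\<nu> * r)"
    have B: "?B \<in> lmeasurable" "?B' \<in> lmeasurable" "0 < measure lebesgue ?B" "0 < measure lebesgue ?B'"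
      using x r C measure_X_ball_pos by auto
    have iu: "set_integrable lebesgue ?B u"
      using test_function_integrable(1)[OF u] X_ball_sets[OF x r] by (rule set_integrable_subset_lebesgue)
    have iX: "set_integrable lebesgue ?B' (\<lambda>y. norm (X_grad X u y))"
      using test_function_integrable(2)[OF u] X_ball_sets[OF x, of "\<nu> * r"] r C
      by (intro set_integrable_subset_lebesgue) auto
    have ic: "set_integrable lebesgue ?B (\<lambda>y. c)" for c :: real
      unfolding set_integrable_def using B(1)
      by (intro integrable_scaleR_left integrable_real_indicator) (auto simp: fmeasurable_def)
    have iab: "set_integrable lebesgue ?B (\<lambda>y. \<bar>u y - mean_value ?B u\<bar>)"
      by (intro set_integrable_abs set_integral_diff iu ic)
    have "C1_closed (closure ?B') u"
      unfolding C1_closed_def using test_functionD(1)[OF u] by (intro exI[of _ UNIV]) auto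
    from P[OF x r this iu]
    have "ennreal ((LINT y:?B|lebesgue. \<bar>u y - mean_value ?B u\<bar>) / measure lebesgue ?B)
        \<le> ennreal (C * r) * ennreal ((LINT y:?B'|lebesgue. norm (X_grad X u y)) / measure lebesgue ?B')"
      using B iab iX by (simp add: mean_nn_eq)
    then have "(LINT y:?B|lebesgue. \<bar>u y - mean_value ?B u\<bar>) / measure lebesgue ?B
        \<le> C * r * ((LINT y:?B'|lebesgue. norm (X_grad X u y)) / measure lebesgue ?B')"
    proof -
      have "0 \<le> (LINT y:?B'|lebesgue. norm (X_grad X u y)) / measure lebesgue ?B'"
        unfolding set_lebesgue_integral_def by (intro divide_nonneg_nonneg integral_nonneg_AE) auto
      moreover assume "ennreal ((LINT y:?B|lebesgue. \<bar>u y - mean_value ?B u\<bar>) / measure lebesgue ?B)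
        \<le> ennreal (C * r) * ennreal ((LINT y:?B'|lebesgue. norm (X_grad X u y)) / measure lebesgue ?B')"
      ultimately show ?thesis
        using C r by (metis ennreal_le_iff ennreal_mult less_imp_le mult_nonneg_nonneg)
    qed
    also have "\<dots> \<le> C * r * ((2 * sqrt (X_energy X u ?B' * measure lebesgue ?B')) / measure lebesgue ?B')"
      using C r X_energy_Cauchy_Schwarz[OF u B(2)] by (intro mult_left_mono divide_right_mono) auto
    also have "(2 * sqrt (X_energy X u ?B' * measure lebesgue ?B')) / measure lebesgue ?B'
        = 2 * sqrt (X_energy X u ?B' / measure lebesgue ?B')"
      using B(4) by (simp add: real_sqrt_mult real_sqrt_divide field_simps)
    finally show ?thesis using B(3) by (simp add: field_simps)
  qed
  then show ?thesis using C by (intro that[of "2 * C" \<nu>]) auto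
qed

text \<open>
  A test function is continuous and the balls shrink to \<open>x\<close> in the Euclidean sense.
\<close>

lemma mean_value_X_ball_tendsto:
  assumes x: "x \<in> \<Omega>" and R: "R > 0" and u: "u \<in> test_functions \<Omega>"
  shows "(\<lambda>i. mean_value (X_ball X x (R / 2 ^ i)) u) \<longlonglongrightarrow> u x"
proof (rule LIMSEQ_I)
  fix e :: real assume e: "0 < e"
  have "isCont u x" using test_functionD(2)[OF u, of UNIV] by (simp add: continuous_on_eq_continuous_at)
  then obtain d where d: "d > 0" "\<And>y. dist y x < d \<Longrightarrow> \<bar>u y - u x\<bar> < e / 2"
    using e unfolding continuous_at_eps_delta dist_real_def by (meson half_gt_zero)
  obtain r where r: "r > 0" "X_ball X x r \<subseteq> ball x d" using X_ball_subset_ball[OF lipschitz d(1)] .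
  obtain n where n: "R / r < 2 ^ n" using real_arch_pow[of 2 "R / r"] by auto
  have "\<bar>mean_value (X_ball X x (R / 2 ^ i)) u - u x\<bar> < e" if i: "i \<ge> n" for i
  proof -
    let ?B = "X_ball X x (R / 2 ^ i)"
    have "R / r < 2 ^ i" using n i by (meson less_le_trans one_le_numeral power_increasing)
    then have "R / 2 ^ i \<le> r" using r by (simp add: field_simps)
    then have sub: "?B \<subseteq> ball x d" using r X_ball_mono by blast
    have B: "?B \<in> lmeasurable" "0 < measure lebesgue ?B" using x R measure_X_ball_pos by auto
    have iu: "set_integrable lebesgue ?B u"
      using test_function_integrable(1)[OF u] B by (intro set_integrable_subset_lebesgue) auto
    have ic: "set_integrable lebesgue ?B (\<lambda>y. c)" for c :: real
      unfolding set_integrable_def using B(1)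
      by (intro integrable_scaleR_left integrable_real_indicator) (auto simp: fmeasurable_def)
    have "\<bar>mean_value ?B u - u x\<bar> \<le> (LINT y:?B|lebesgue. \<bar>u y - u x\<bar>) / measure lebesgue ?B"
      using iu B by (intro abs_mean_value_diff_le) auto
    also have "(LINT y:?B|lebesgue. \<bar>u y - u x\<bar>) \<le> (LINT y:?B|lebesgue. e / 2)"
    proof (rule set_integral_mono)
      show "set_integrable lebesgue ?B (\<lambda>y. \<bar>u y - u x\<bar>)"
        by (intro set_integrable_abs set_integral_diff iu ic)
      show "\<bar>u y - u x\<bar> \<le> e / 2" if "y \<in> ?B" for y
        using sub that d(2)[of y] by (auto simp: dist_commute intro: less_imp_le)
    qed (rule ic)
    also have "(LINT y:?B|lebesgue. e / 2) = measure lebesgue ?B * (e / 2)"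
      using B(1) by (simp add: set_lebesgue_integral_def fmeasurable_def)
    finally show ?thesis using B(2) e by (simp add: divide_right_mono)
  qed
  then show "\<exists>n. \<forall>i\<ge>n. norm (mean_value (X_ball X x (R / 2 ^ i)) u - u x) < e" by auto
qed

end

section \<open>A weak-type Sobolev inequality\<close>

context poincare_domain
begin

text \<open>
  The heart of the Sobolev inequality: near every point where \<open>\<bar>u\<bar> \<ge> t\<close> some ball satisfies the
  inequality on its own, with its local energy in place of the full one. Writing \<open>\<theta>\<close> for
  \<open>2 powr (\<sigma> * Q / 2 - 1)\<close>, a ball found by \<open>telescoping_exceeds_geometric\<close> at the scale \<open>i\<close> has an energy
  density above a multiple of \<open>t\<^sup>2 (4 \<theta>\<^sup>2)^i = t\<^sup>2 (2 powr Q)^(i \<sigma>)\<close>, and by doubling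
  \<open>(2 powr Q)^i\<close> is at least a constant over the measure of the ball.
\<close>

lemma large_energy_ball:
  assumes \<sigma>: "0 < \<sigma>" "\<sigma> < 2 / Q"
  obtains C where "C > 0"
    "\<And>u x t. u \<in> test_functions \<Omega> \<Longrightarrow> x \<in> \<Omega> \<Longrightarrow> 0 < t \<Longrightarrow> t \<le> \<bar>u x\<bar> \<Longrightarrow>
      \<exists>\<rho>>0. measure lebesgue (X_ball X x \<rho>) powr (1 - \<sigma>) \<le> C * (X_energy X u (X_ball X x \<rho>) / t\<^sup>2)"
proof -
  obtain P \<nu> where P: "P > 0" "\<nu> > 0"
    and poinc: "\<And>x r u. x \<in> \<Omega> \<Longrightarrow> r > 0 \<Longrightarrow> u \<in> test_functions \<Omega> \<Longrightarrow>
      (LINT y:X_ball X x r|lebesgue. \<bar>u y - mean_value (X_ball X x r) u\<bar>)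
        \<le> measure lebesgue (X_ball X x r) *
          (P * r * sqrt (X_energy X u (X_ball X x (\<nu> * r)) / measure lebesgue (X_ball X x (\<nu> * r))))"
    using poincare_energy by blast
  obtain D Z where D: "D > 0" and Z: "Z \<in> lmeasurable" "measure lebesgue Z > 0" "Z \<inter> \<Omega> = {}"
    "\<And>x. x \<in> \<Omega> \<Longrightarrow> \<Omega> \<union> Z \<subseteq> X_ball X x D"
    using collar_in_large_balls by blast
  \<comment> \<open>Both \<open>B(x, R)\<close> and the dilated ball \<open>B(x, \<nu> R)\<close> have to contain \<open>Z\<close>: the first for the initial mean, the second for the lower volume bound.\<close>
  define R where "R = max D (D / \<nu>)"
  have R: "R > 0" "D \<le> R" "D \<le> \<nu> * R"
    using D P by (auto simp: R_def max_def field_simps)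
  obtain x0 where x0: "x0 \<in> \<Omega>" using domain_nonempty by blast
  define V where "V = measure lebesgue (X_ball X x0 (D + R))"
  have V: "measure lebesgue (X_ball X x R) \<le> V" if x: "x \<in> \<Omega>" for x
  proof -
    have "d_X X x0 x < ennreal D" using Z(4)[OF x0] x by (auto simp: X_ball_def)
    then have "X_ball X x R \<subseteq> X_ball X x0 (D + R)"
      using D R by (intro X_ball_subset_X_ball) auto
    then show ?thesis
      unfolding V_def using x x0 D R X_ball_sets[OF x R(1)] by (intro measure_mono_fmeasurable) auto
  qed
  have V0: "V \<ge> 0" by (simp add: V_def)
  let ?m = "measure lebesgue Z"
  \<comment> \<open>The first summand serves the steps between consecutive means, the second the initial mean.\<close>
  define K where "K = 2 powr Q + V / ?m"
  have K: "K > 0" "2 powr Q \<le> K" "V / ?m \<le> K" using V0 Z(2) by (auto simp: K_def add_pos_nonneg)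
  define \<theta> where "\<theta> = 2 powr (\<sigma> * Q / 2 - 1)"
  have "\<sigma> * Q / 2 < 1" using \<sigma> Q_pos by (simp add: field_simps)
  then have \<theta>: "0 < \<theta>" "\<theta> < 1" unfolding \<theta>_def by (auto simp: powr_less_one)
  have \<theta>2: "4 * \<theta>\<^sup>2 = 2 powr (\<sigma> * Q)"
  proof -
    have "\<theta>\<^sup>2 = 2 powr (\<sigma> * Q / 2 - 1) * 2 powr (\<sigma> * Q / 2 - 1)" by (simp add: \<theta>_def power2_eq_square)
    also have "\<dots> = 2 powr (\<sigma> * Q - 2)" by (simp add: mult.commute flip: powr_add)
    finally show ?thesis by (simp add: powr_diff)
  qed
  define c where "c = (1 - \<theta>) / (4 * K * P * R)"
  have c: "c > 0" using \<theta> K P R by (simp add: c_def)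
  define C where "C = 1 / (c\<^sup>2 * ?m powr \<sigma>)"
  have C: "C > 0" using c Z(2) by (simp add: C_def)
  have "\<exists>\<rho>>0. measure lebesgue (X_ball X x \<rho>) powr (1 - \<sigma>) \<le> C * (X_energy X u (X_ball X x \<rho>) / t\<^sup>2)"
    if u: "u \<in> test_functions \<Omega>" and x: "x \<in> \<Omega>" and t: "0 < t" "t \<le> \<bar>u x\<bar>" for u x t
  proof -
    define r where "r = (\<lambda>i::nat. R / 2 ^ i)"
    define B where "B = (\<lambda>i. X_ball X x (r i))"
    define B' where "B' = (\<lambda>i. X_ball X x (\<nu> * r i))"
    define a where "a = (\<lambda>i. mean_value (B i) u)"
    define e where "e = (\<lambda>i. P * r i * sqrt (X_energy X u (B' i) / measure lebesgue (B' i)))"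
    have r: "r i > 0" for i using R by (simp add: r_def)
    have Bm: "B i \<in> lmeasurable" "0 < measure lebesgue (B i)" for i
      using x r measure_X_ball_pos by (auto simp: B_def)
    have B'm: "0 < measure lebesgue (B' i)" for i
      using x r P measure_X_ball_pos by (auto simp: B'_def)
    have iu: "set_integrable lebesgue (B i) u" for i
      using test_function_integrable(1)[OF u] Bm(1)[of i] by (intro set_integrable_subset_lebesgue) auto
    have pe: "(LINT y:B i|lebesgue. \<bar>u y - a i\<bar>) \<le> measure lebesgue (B i) * e i" for i
      using poinc[OF x r u] by (simp add: B_def B'_def a_def e_def)
    have e0: "e i \<ge> 0" for i
      using P r[of i] X_energy_nonneg by (auto simp: e_def intro!: mult_nonneg_nonneg divide_nonneg_nonneg)
    have lim: "a \<longlonglongrightarrow> u x"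
      using mean_value_X_ball_tendsto[OF x R(1) u] by (simp add: a_def B_def r_def)
    have a0: "\<bar>a 0\<bar> \<le> K * e 0"
    proof -
      have "Z \<subseteq> X_ball X x D" using Z(4)[OF x] by simp
      then have "Z \<subseteq> B 0" using X_ball_mono[OF R(2), of X x] by (auto simp: B_def r_def)
      then have "\<bar>mean_value Z u - a 0\<bar> \<le> (LINT y:B 0|lebesgue. \<bar>u y - a 0\<bar>) / ?m"
        using iu Bm Z by (intro abs_mean_value_diff_le) auto
      also have "\<dots> \<le> measure lebesgue (B 0) * e 0 / ?m"
        using pe[of 0] Z(2) by (intro divide_right_mono) auto
      also have "\<dots> \<le> V * e 0 / ?m"
        using V[OF x] e0 Z(2) by (intro divide_right_mono mult_right_mono) (auto simp: B_def r_def)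
      also have "\<dots> = V / ?m * e 0" by simp
      also have "\<dots> \<le> K * e 0" using K e0 by (intro mult_right_mono) auto
      finally have "\<bar>mean_value Z u - a 0\<bar> \<le> K * e 0" .
      moreover have "mean_value Z u = 0"
      proof -
        have "(\<lambda>y. indicat_real Z y *\<^sub>R u y) = (\<lambda>y. 0)"
          using Z(3) test_function_zero_outside[OF u] by (intro ext) (auto simp: indicator_def)
        then show ?thesis unfolding mean_value_def set_lebesgue_integral_def by simp
      qed
      ultimately show ?thesis by simp
    qed
    have step: "\<bar>a (Suc i) - a i\<bar> \<le> K * e i" for i
    proof -
      have dbl: "measure lebesgue (B i) \<le> 2 powr Q * measure lebesgue (B (Suc i))"
        using measure_X_ball_double[OF x r[of "Suc i"]] by (simp add: B_def r_def)
      have "B (Suc i) \<subseteq> B i" unfolding B_def using R by (intro X_ball_mono) (simp add: r_def field_simps)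
      then have "\<bar>a (Suc i) - a i\<bar> \<le> (LINT y:B i|lebesgue. \<bar>u y - a i\<bar>) / measure lebesgue (B (Suc i))"
        unfolding a_def using iu Bm by (intro abs_mean_value_diff_le) auto
      also have "\<dots> \<le> (2 powr Q * measure lebesgue (B (Suc i))) * e i / measure lebesgue (B (Suc i))"
        using order_trans[OF pe[of i] mult_right_mono[OF dbl e0]] Bm(2)[of "Suc i"]
        by (intro divide_right_mono) auto
      also have "\<dots> = 2 powr Q * e i" using Bm(2)[of "Suc i"] by simp
      also have "\<dots> \<le> K * e i" using K e0 by (intro mult_right_mono) auto
      finally show ?thesis .
    qed
    obtain i where i: "t * (1 - \<theta>) / (4 * K) * \<theta> ^ i < e i"
      using telescoping_exceeds_geometric[OF lim K(1) \<theta> a0 step t] .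
    let ?E = "X_energy X u (B' i)" and ?M = "measure lebesgue (B' i)"
    have "t * c * \<theta> ^ i * (P * R) = t * (1 - \<theta>) / (4 * K) * \<theta> ^ i"
      using P R by (simp add: c_def)
    also have "\<dots> < P * (R / 2 ^ i) * sqrt (?E / ?M)" using i by (simp add: e_def r_def)
    also have "\<dots> = sqrt (?E / ?M) / 2 ^ i * (P * R)" by simp
    finally have "t * c * \<theta> ^ i < sqrt (?E / ?M) / 2 ^ i"
      using P R by (simp only: mult_less_cancel_right_pos mult_pos_pos)
    then have "t * c * (2 * \<theta>) ^ i < sqrt (?E / ?M)"
      by (simp add: power_mult_distrib field_simps)
    then have "(t * c * (2 * \<theta>) ^ i)\<^sup>2 < (sqrt (?E / ?M))\<^sup>2"
      using t c \<theta> by (intro power_strict_mono) auto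
    also have "(sqrt (?E / ?M))\<^sup>2 = ?E / ?M"
      using X_energy_nonneg B'm[of i] by (intro real_sqrt_pow2) simp
    also have "(t * c * (2 * \<theta>) ^ i)\<^sup>2 = t\<^sup>2 * c\<^sup>2 * (2 powr (\<sigma> * Q)) ^ i"
    proof -
      have "((2 * \<theta>) ^ i)\<^sup>2 = ((2 * \<theta>)\<^sup>2) ^ i" by (simp only: power_mult[symmetric] mult.commute)
      also have "(2 * \<theta>)\<^sup>2 = 2 powr (\<sigma> * Q)" by (simp add: power_mult_distrib \<theta>2)
      finally show ?thesis by (simp add: power_mult_distrib[of "t * c"] power_mult_distrib[of t])
    qed
    finally have big: "t\<^sup>2 * c\<^sup>2 * (2 powr (\<sigma> * Q)) ^ i < ?E / ?M" .
    \<comment> \<open>Halving the radius \<open>i\<close> times from \<open>\<nu> R\<close> gives the lower bound for the measure of the ball.\<close>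
    have "Z \<subseteq> X_ball X x D" using Z(4)[OF x] by simp
    then have "Z \<subseteq> X_ball X x (\<nu> * R)" using X_ball_mono[OF R(3), of X x] by auto
    then have "?m \<le> measure lebesgue (X_ball X x (\<nu> * R))"
      using Z(1) x P R by (intro measure_mono_fmeasurable) auto
    also have "\<dots> \<le> (2 powr Q) ^ i * ?M"
      using measure_X_ball_halve[OF x, of "\<nu> * R" i] P R by (simp add: B'_def r_def)
    finally have "?m powr \<sigma> \<le> ((2 powr Q) ^ i * ?M) powr \<sigma>"
      using \<sigma> by (intro powr_mono2) auto
    also have "\<dots> = (2 powr (\<sigma> * Q)) ^ i * ?M powr \<sigma>"
      by (simp add: powr_mult powr_powr powr_power mult_ac)
    finally have "t\<^sup>2 * c\<^sup>2 * ?m powr \<sigma> \<le> t\<^sup>2 * c\<^sup>2 * ((2 powr (\<sigma> * Q)) ^ i * ?M powr \<sigma>)"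
      using t c by (intro mult_left_mono) auto
    also have "\<dots> = (t\<^sup>2 * c\<^sup>2 * (2 powr (\<sigma> * Q)) ^ i) * ?M powr \<sigma>" by simp
    also have "\<dots> \<le> ?E / ?M * ?M powr \<sigma>" using big by (intro mult_right_mono) auto
    finally have "t\<^sup>2 * c\<^sup>2 * ?m powr \<sigma> \<le> ?E / ?M powr (1 - \<sigma>)"
      using B'm[of i] by (simp add: powr_diff field_simps)
    then have "?M powr (1 - \<sigma>) * (t\<^sup>2 * c\<^sup>2 * ?m powr \<sigma>) \<le> ?E"
      using B'm[of i] by (simp add: field_simps)
    then have "?M powr (1 - \<sigma>) \<le> C * (?E / t\<^sup>2)"
      using t c Z(2) by (simp add: C_def field_simps)
    then show ?thesis
      using P r[of i] by (intro exI[of _ "\<nu> * r i"]) (simp add: B'_def)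
  qed
  then show ?thesis using C by (intro that) auto
qed

lemma sum_X_energy_disjoint_le:
  assumes u: "u \<in> test_functions \<Omega>" and F: "finite F" "\<And>i. i \<in> F \<Longrightarrow> B i \<in> sets lebesgue"
    and disj: "\<And>i j. i \<in> F \<Longrightarrow> j \<in> F \<Longrightarrow> i \<noteq> j \<Longrightarrow> B i \<inter> B j = {}"
  shows "(\<Sum>i\<in>F. X_energy X u (B i)) \<le> X_energy X u UNIV"
proof -
  let ?g = "\<lambda>y. (norm (X_grad X u y))\<^sup>2"
  have int: "integrable lebesgue (\<lambda>y. indicat_real (B i) y * ?g y)" if "i \<in> F" for i
    using integrable_mult_indicator[OF F(2)[OF that] test_function_integrable(3)[OF u]] by simp
  have "(\<Sum>i\<in>F. X_energy X u (B i)) = (\<integral>y. (\<Sum>i\<in>F. indicat_real (B i) y * ?g y) \<partial>lebesgue)"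
    using int by (simp add: X_energy_def set_lebesgue_integral_def Bochner_Integration.integral_sum)
  also have "\<dots> \<le> (\<integral>y. ?g y \<partial>lebesgue)"
  proof (rule integral_mono)
    show "integrable lebesgue (\<lambda>y. \<Sum>i\<in>F. indicat_real (B i) y * ?g y)"
      using int by (rule Bochner_Integration.integrable_sum)
    show "integrable lebesgue ?g" by (rule test_function_integrable(3)[OF u])
    have disjF: "disjoint_family_on B F" using disj by (auto simp: disjoint_family_on_def)
    fix y
    have "(\<Sum>i\<in>F. indicat_real (B i) y * ?g y) = indicat_real (\<Union>i\<in>F. B i) y * ?g y"
      by (simp add: indicator_UN_disjoint[OF F(1) disjF] sum_distrib_right)
    also have "\<dots> \<le> ?g y" by (simp add: indicator_def)
    finally show "(\<Sum>i\<in>F. indicat_real (B i) y * ?g y) \<le> ?g y" .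
  qed
  finally show ?thesis by (simp add: X_energy_def set_lebesgue_integral_def)
qed

text \<open>
  The balls of \<open>large_energy_ball\<close> cover the compact set \<open>{\<bar>u\<bar> \<ge> t}\<close>. For the disjoint balls selected among
  them the energies add up to at most the full energy, and the power \<open>1 / (1 - \<sigma>) \<ge> 1\<close> of a sum of
  energies dominates the sum of the powers.
\<close>

lemma weak_Sobolev_test_functions:
  assumes \<sigma>: "0 < \<sigma>" "\<sigma> < 2 / Q" "\<sigma> < 1"
  obtains C where "C > 0"
    "\<And>u t. u \<in> test_functions \<Omega> \<Longrightarrow> 0 < t \<Longrightarrow>
      measure lebesgue {x. t \<le> \<bar>u x\<bar>} \<le> C * (X_energy X u UNIV / t\<^sup>2) powr (1 / (1 - \<sigma>))"
proof -
  obtain C0 where C0: "C0 > 0" and ball: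
    "\<And>u x t. u \<in> test_functions \<Omega> \<Longrightarrow> x \<in> \<Omega> \<Longrightarrow> 0 < t \<Longrightarrow> t \<le> \<bar>u x\<bar> \<Longrightarrow>
      \<exists>\<rho>>0. measure lebesgue (X_ball X x \<rho>) powr (1 - \<sigma>) \<le> C0 * (X_energy X u (X_ball X x \<rho>) / t\<^sup>2)"
    using large_energy_ball[OF \<sigma>(1,2)] by blast
  let ?q = "1 / (1 - \<sigma>)"
  have q: "?q \<ge> 1" using \<sigma> by (simp add: field_simps)
  define C where "C = (2 powr Q)\<^sup>2 * C0 powr ?q"
  have C: "C > 0" using C0 by (simp add: C_def)
  have "measure lebesgue {x. t \<le> \<bar>u x\<bar>} \<le> C * (X_energy X u UNIV / t\<^sup>2) powr ?q"
    if u: "u \<in> test_functions \<Omega>" and t: "0 < t" for u t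
  proof -
    define L where "L = {x. t \<le> \<bar>u x\<bar>}"
    have "L \<subseteq> {x. u x \<noteq> 0}" using t by (auto simp: L_def)
    also have "\<dots> \<subseteq> closure {x. u x \<noteq> 0}" by (rule closure_subset)
    finally have Lsub: "L \<subseteq> closure {x. u x \<noteq> 0}" .
    have "closed L"
      unfolding L_def by (intro closed_Collect_le continuous_intros test_functionD(2)[OF u])
    then have L: "compact L"
      using Lsub test_functionD(5)[OF u] by (meson bounded_subset compact_eq_bounded_closed)
    have L\<Omega>: "L \<subseteq> \<Omega>" using Lsub test_functionD(6)[OF u] by blast
    have "\<forall>x\<in>L. \<exists>\<rho>>0. measure lebesgue (X_ball X x \<rho>) powr (1 - \<sigma>) \<le> C0 * (X_energy X u (X_ball X x \<rho>) / t\<^sup>2)"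
      using ball[OF u _ t] L\<Omega> by (auto simp: L_def)
    then obtain \<rho> where \<rho>: "\<And>x. x \<in> L \<Longrightarrow> \<rho> x > 0"
      "\<And>x. x \<in> L \<Longrightarrow> measure lebesgue (X_ball X x (\<rho> x)) powr (1 - \<sigma>) \<le> C0 * (X_energy X u (X_ball X x (\<rho> x)) / t\<^sup>2)"
      by metis
    have "\<exists>\<delta>>0. ball x \<delta> \<subseteq> X_ball X x (\<rho> x)" if "x \<in> L" for x
      using uniform_euclidean_ball[OF \<rho>(1)[OF that]] that L\<Omega> by (metis subsetD)
    then obtain \<delta> where \<delta>: "\<And>x. x \<in> L \<Longrightarrow> \<delta> x > 0" "\<And>x. x \<in> L \<Longrightarrow> ball x (\<delta> x) \<subseteq> X_ball X x (\<rho> x)"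
      by metis
    obtain F where F: "F \<subseteq> L" "finite F" "L \<subseteq> (\<Union>x\<in>F. ball x (\<delta> x))"
    proof (rule compactE_image[OF L])
      show "open (ball x (\<delta> x))" for x by simp
      show "L \<subseteq> (\<Union>x\<in>L. ball x (\<delta> x))" using \<delta>(1) by force
    qed blast
    have "\<exists>G\<subseteq>F. (\<forall>i\<in>G. \<forall>j\<in>G. i \<noteq> j \<longrightarrow> X_ball X i (\<rho> i) \<inter> X_ball X j (\<rho> j) = {}) \<and>
        (\<forall>i\<in>F. \<exists>j\<in>G. X_ball X i (\<rho> i) \<subseteq> X_ball X j (4 * \<rho> j))"
      by (rule finite_Vitali_X_balls[OF F(2), where c = "\<lambda>x. x" and r = \<rho>]) (use \<rho>(1) F(1) in auto)
    then obtain G where G: "G \<subseteq> F" "\<forall>i\<in>G. \<forall>j\<in>G. i \<noteq> j \<longrightarrow> X_ball X i (\<rho> i) \<inter> X_ball X j (\<rho> j) = {}"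
        "\<forall>i\<in>F. \<exists>j\<in>G. X_ball X i (\<rho> i) \<subseteq> X_ball X j (4 * \<rho> j)"
      by (elim exE conjE)
    have GL: "x \<in> \<Omega>" "\<rho> x > 0" "x \<in> L" if "x \<in> G" for x using that G(1) F(1) L\<Omega> \<rho>(1) by auto
    have finG: "finite G" using G(1) F(2) by (rule finite_subset)
    have m4: "X_ball X x (4 * \<rho> x) \<in> lmeasurable" if "x \<in> G" for x using GL[OF that] by auto
    have cover: "L \<subseteq> (\<Union>x\<in>G. X_ball X x (4 * \<rho> x))"
    proof
      fix y assume "y \<in> L"
      then obtain x where x: "x \<in> F" "y \<in> ball x (\<delta> x)" using F(3) by blast
      then have "y \<in> X_ball X x (\<rho> x)" using \<delta>(2)[of x] F(1) by blast
      then show "y \<in> (\<Union>x\<in>G. X_ball X x (4 * \<rho> x))" using G(3) x(1) by blast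
    qed
    have "measure lebesgue L \<le> measure lebesgue (\<Union>x\<in>G. X_ball X x (4 * \<rho> x))"
      using cover finG m4 lmeasurable_compact[OF L] by (intro measure_mono_fmeasurable fmeasurable.finite_UN) auto
    also have "\<dots> \<le> (\<Sum>x\<in>G. measure lebesgue (X_ball X x (4 * \<rho> x)))"
      using finG m4 by (intro measure_UNION_le) auto
    also have "\<dots> \<le> (\<Sum>x\<in>G. C * (X_energy X u (X_ball X x (\<rho> x)) / t\<^sup>2) powr ?q)"
    proof (rule sum_mono)
      fix x assume x: "x \<in> G"
      let ?M = "measure lebesgue (X_ball X x (\<rho> x))" and ?E = "X_energy X u (X_ball X x (\<rho> x)) / t\<^sup>2"
      have "measure lebesgue (X_ball X x (4 * \<rho> x)) \<le> (2 powr Q)\<^sup>2 * ?M"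
        using measure_X_ball_halve[OF GL(1)[OF x], of "4 * \<rho> x" 2] GL(2)[OF x] by simp
      also have "?M = (?M powr (1 - \<sigma>)) powr ?q" using \<sigma> by (simp add: powr_powr)
      also have "\<dots> \<le> (C0 * ?E) powr ?q"
        using \<rho>(2)[OF GL(3)[OF x]] \<sigma> by (intro powr_mono2) auto
      also have "\<dots> = C0 powr ?q * ?E powr ?q"
        using C0 X_energy_nonneg by (intro powr_mult)
      finally show "measure lebesgue (X_ball X x (4 * \<rho> x)) \<le> C * ?E powr ?q"
        by (simp add: C_def mult.assoc mult_left_mono)
    qed
    also have "\<dots> = C * (\<Sum>x\<in>G. (X_energy X u (X_ball X x (\<rho> x)) / t\<^sup>2) powr ?q)"
      by (simp add: sum_distrib_left)
    also have "\<dots> \<le> C * (\<Sum>x\<in>G. X_energy X u (X_ball X x (\<rho> x)) / t\<^sup>2) powr ?q"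
      using C q finG X_energy_nonneg by (intro mult_left_mono sum_powr_le_powr_sum) auto
    also have "\<dots> \<le> C * (X_energy X u UNIV / t\<^sup>2) powr ?q"
    proof -
      have "(\<Sum>x\<in>G. X_energy X u (X_ball X x (\<rho> x))) \<le> X_energy X u UNIV"
        using G(2) GL finG X_ball_sets by (intro sum_X_energy_disjoint_le[OF u]) auto
      then have "(\<Sum>x\<in>G. X_energy X u (X_ball X x (\<rho> x)) / t\<^sup>2) \<le> X_energy X u UNIV / t\<^sup>2"
        by (simp add: sum_divide_distrib[symmetric] divide_right_mono)
      then show ?thesis
        using C \<sigma> X_energy_nonneg by (intro mult_left_mono powr_mono2 sum_nonneg) auto
    qed
    finally show ?thesis by (simp add: L_def)
  qed
  then show ?thesis using C by (intro that) auto
qed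

end

section \<open>Functions with zero trace\<close>

lemma test_function_measurable:
  assumes "u \<in> test_functions \<Omega>" "\<Omega> \<in> sets lebesgue"
  shows "u \<in> borel_measurable (lebesgue_on \<Omega>)"
  using test_functionD(2)[OF assms(1)] assms(2) by (rule continuous_imp_measurable_on_sets_lebesgue)

lemma X_grad_measurable:
  assumes "locally_lipschitz_fields X" "u \<in> test_functions \<Omega>" "\<Omega> \<in> sets lebesgue"
  shows "X_grad X u \<in> borel_measurable (lebesgue_on \<Omega>)"
  using X_grad_continuous_on[OF assms(1,2)] assms(3) by (rule continuous_imp_measurable_on_sets_lebesgue)

lemma norm_powr_2: "norm x powr 2 = (norm x)\<^sup>2"
  by simp

lemma Lp_norm_2: "Lp_norm 2 \<Omega> g = sqrt (\<integral>x. (norm (g x))\<^sup>2 \<partial>lebesgue_on \<Omega>)"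
  unfolding Lp_norm_def norm_powr_2 by (rule powr_half_sqrt) (auto intro: integral_nonneg_AE)

lemma Lp_norm_2_tendsto_0_iff:
  "(\<lambda>n. Lp_norm 2 \<Omega> (g n)) \<longlonglongrightarrow> 0 \<longleftrightarrow> (\<lambda>n. \<integral>x. (norm (g n x))\<^sup>2 \<partial>lebesgue_on \<Omega>) \<longlonglongrightarrow> 0"
proof -
  have nn: "0 \<le> (\<integral>x. (norm (g n x))\<^sup>2 \<partial>lebesgue_on \<Omega>)" for n by (auto intro: integral_nonneg_AE)
  show ?thesis
  proof
    assume "(\<lambda>n. Lp_norm 2 \<Omega> (g n)) \<longlonglongrightarrow> 0"
    from tendsto_power[OF this, of 2] show "(\<lambda>n. \<integral>x. (norm (g n x))\<^sup>2 \<partial>lebesgue_on \<Omega>) \<longlonglongrightarrow> 0"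
      using nn by (simp add: Lp_norm_2)
  next
    assume "(\<lambda>n. \<integral>x. (norm (g n x))\<^sup>2 \<partial>lebesgue_on \<Omega>) \<longlonglongrightarrow> 0"
    from tendsto_real_sqrt[OF this] show "(\<lambda>n. Lp_norm 2 \<Omega> (g n)) \<longlonglongrightarrow> 0"
      by (simp add: Lp_norm_2)
  qed
qed

lemma Lp_fun_2_iff:
  "Lp_fun 2 \<Omega> g \<longleftrightarrow> g \<in> borel_measurable (lebesgue_on \<Omega>) \<and> integrable (lebesgue_on \<Omega>) (\<lambda>x. (norm (g x))\<^sup>2)"
  unfolding Lp_fun_def norm_powr_2 ..

lemma norm_add_square_le: "(norm (a + b))\<^sup>2 \<le> 2 * (norm a)\<^sup>2 + 2 * (norm (b :: 'a::real_normed_vector))\<^sup>2"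
proof -
  have "(norm (a + b))\<^sup>2 \<le> (norm a + norm b)\<^sup>2" by (intro power_mono norm_triangle_ineq) auto
  also have "\<dots> \<le> 2 * (norm a)\<^sup>2 + 2 * (norm b)\<^sup>2"
    using sum_squares_bound[of "norm a" "norm b"] by (simp add: power2_sum)
  finally show ?thesis .
qed

lemma integrable_norm_diff_square:
  fixes g h :: "'a \<Rightarrow> 'b::euclidean_space"
  assumes "g \<in> borel_measurable M" "h \<in> borel_measurable M"
    "integrable M (\<lambda>x. (norm (g x))\<^sup>2)" "integrable M (\<lambda>x. (norm (h x))\<^sup>2)"
  shows "integrable M (\<lambda>x. (norm (g x - h x))\<^sup>2)"
proof (rule Bochner_Integration.integrable_bound)
  show "integrable M (\<lambda>x. 2 * (norm (g x))\<^sup>2 + 2 * (norm (h x))\<^sup>2)"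
    using assms by auto
  show "AE x in M. norm ((norm (g x - h x))\<^sup>2) \<le> norm (2 * (norm (g x))\<^sup>2 + 2 * (norm (h x))\<^sup>2)"
  proof (rule AE_I2)
    fix x
    show "norm ((norm (g x - h x))\<^sup>2) \<le> norm (2 * (norm (g x))\<^sup>2 + 2 * (norm (h x))\<^sup>2)"
      using norm_add_square_le[of "g x" "- h x"] by simp
  qed
qed (use assms in measurable)

lemma W0_grad_2E:
  fixes X :: "'m::finite \<Rightarrow> real^'n::finite \<Rightarrow> real^'n"
  assumes "W0_grad 2 X \<Omega> u G" "\<Omega> \<in> lmeasurable" "locally_lipschitz_fields X"
  obtains \<phi> where "u \<in> borel_measurable (lebesgue_on \<Omega>)" "G \<in> borel_measurable (lebesgue_on \<Omega>)"
    "integrable (lebesgue_on \<Omega>) (\<lambda>x. (u x)\<^sup>2)" "integrable (lebesgue_on \<Omega>) (\<lambda>x. (norm (G x))\<^sup>2)"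
    "\<And>n::nat. \<phi> n \<in> test_functions \<Omega>"
    "\<And>n. integrable (lebesgue_on \<Omega>) (\<lambda>x. (norm (X_grad X (\<phi> n) x))\<^sup>2)"
    "\<And>n. integrable (lebesgue_on \<Omega>) (\<lambda>x. (norm (X_grad X (\<phi> n) x - G x))\<^sup>2)"
    "\<And>n. integrable (lebesgue_on \<Omega>) (\<lambda>x. (\<phi> n x - u x)\<^sup>2)"
    "(\<lambda>n. \<integral>x. (norm (X_grad X (\<phi> n) x - G x))\<^sup>2 \<partial>lebesgue_on \<Omega>) \<longlonglongrightarrow> 0"
    "(\<lambda>n. \<integral>x. (\<phi> n x - u x)\<^sup>2 \<partial>lebesgue_on \<Omega>) \<longlonglongrightarrow> 0"
proof -
  obtain \<phi> where \<phi>: "\<And>n. \<phi> n \<in> test_functions \<Omega>"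
    and lim: "(\<lambda>n. Lp_norm 2 \<Omega> (\<lambda>x. X_grad X (\<phi> n) x - G x)) \<longlonglongrightarrow> 0"
      "(\<lambda>n. Lp_norm 2 \<Omega> (\<lambda>x. \<phi> n x - u x)) \<longlonglongrightarrow> 0"
    using assms(1) unfolding W0_grad_def by blast
  have uG: "u \<in> borel_measurable (lebesgue_on \<Omega>)" "G \<in> borel_measurable (lebesgue_on \<Omega>)"
    "integrable (lebesgue_on \<Omega>) (\<lambda>x. (norm (u x))\<^sup>2)" "integrable (lebesgue_on \<Omega>) (\<lambda>x. (norm (G x))\<^sup>2)"
    using assms(1) unfolding W0_grad_def Lp_fun_2_iff by auto
  have \<Omega>: "\<Omega> \<in> sets lebesgue" using assms(2) by auto
  note K = test_functionD(5)[OF \<phi>]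
  have i1: "integrable (lebesgue_on \<Omega>) (\<lambda>x. (norm (X_grad X (\<phi> n) x))\<^sup>2)" for n
  proof -
    have "integrable lebesgue (\<lambda>x. (norm (X_grad X (\<phi> n) x))\<^sup>2)"
      by (intro compactly_supported_integrable[OF _ K[of n]] continuous_intros X_grad_continuous_on[OF assms(3) \<phi>])
         (simp add: X_grad_zero_outside_support)
    from integrable_mult_indicator[OF \<Omega> this] show ?thesis
      using \<Omega> by (subst integrable_restrict_space) auto
  qed
  have i2: "integrable (lebesgue_on \<Omega>) (\<lambda>x. (norm (\<phi> n x))\<^sup>2)" for n
  proof -
    have "integrable lebesgue (\<lambda>x. (norm (\<phi> n x))\<^sup>2)"
      using closure_subset[of "{x. \<phi> n x \<noteq> 0}"]
      by (intro compactly_supported_integrable[OF _ K[of n]] continuous_intros test_functionD(2)[OF \<phi>]) auto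
    from integrable_mult_indicator[OF \<Omega> this] show ?thesis
      using \<Omega> by (subst integrable_restrict_space) auto
  qed
  show ?thesis
  proof (rule that[of \<phi>])
    show "integrable (lebesgue_on \<Omega>) (\<lambda>x. (norm (X_grad X (\<phi> n) x - G x))\<^sup>2)" for n
      by (intro integrable_norm_diff_square i1 uG X_grad_measurable[OF assms(3) \<phi> \<Omega>])
    show "integrable (lebesgue_on \<Omega>) (\<lambda>x. (\<phi> n x - u x)\<^sup>2)" for n
      using integrable_norm_diff_square[OF test_function_measurable[OF \<phi> \<Omega>] uG(1) i2 uG(3)] by simp
    show "integrable (lebesgue_on \<Omega>) (\<lambda>x. (u x)\<^sup>2)" using uG(3) by simp
    show "(\<lambda>n. \<integral>x. (\<phi> n x - u x)\<^sup>2 \<partial>lebesgue_on \<Omega>) \<longlonglongrightarrow> 0"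
      using lim(2) unfolding Lp_norm_2_tendsto_0_iff by simp
    show "(\<lambda>n. \<integral>x. (norm (X_grad X (\<phi> n) x - G x))\<^sup>2 \<partial>lebesgue_on \<Omega>) \<longlonglongrightarrow> 0"
      using lim(1) unfolding Lp_norm_2_tendsto_0_iff .
  qed (use uG \<phi> i1 in auto)
qed

text \<open>
  Along a subsequence the approximating test functions converge almost everywhere, which turns
  \<open>f' (\<phi> n) - f' u\<close> into a bounded factor tending to zero; dominated convergence with the majorant
  \<open>\<bar>G\<bar>\<^sup>2\<close> then handles the only term that is not controlled by the norms.
\<close>

lemma W0_grad_compose:
  fixes X :: "'m::finite \<Rightarrow> real^'n::finite \<Rightarrow> real^'n"
  assumes W: "W0_grad 2 X \<Omega> u G" and \<Omega>: "\<Omega> \<in> lmeasurable" and lip: "locally_lipschitz_fields X"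
    and f: "smooth_real f" "f 0 = 0" "\<And>s. (f has_real_derivative f' s) (at s)"
      "\<And>s. 0 \<le> f' s" "\<And>s. f' s \<le> 1" "\<And>s. isCont f' s"
  shows "W0_grad 2 X \<Omega> (\<lambda>x. f (u x)) (\<lambda>x. f' (u x) *\<^sub>R G x)"
proof -
  let ?M = "lebesgue_on \<Omega>"
  have \<Omega>s: "\<Omega> \<in> sets lebesgue" using \<Omega> by auto
  obtain \<phi> where [measurable]: "u \<in> borel_measurable ?M" "G \<in> borel_measurable ?M"
    and u2: "integrable ?M (\<lambda>x. (u x)\<^sup>2)" and G2: "integrable ?M (\<lambda>x. (norm (G x))\<^sup>2)"
    and \<phi>: "\<And>n::nat. \<phi> n \<in> test_functions \<Omega>"
    and X2: "\<And>n. integrable ?M (\<lambda>x. (norm (X_grad X (\<phi> n) x))\<^sup>2)"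
    and XG: "\<And>n. integrable ?M (\<lambda>x. (norm (X_grad X (\<phi> n) x - G x))\<^sup>2)"
    and \<phi>u: "\<And>n. integrable ?M (\<lambda>x. (\<phi> n x - u x)\<^sup>2)"
    and lim: "(\<lambda>n. \<integral>x. (norm (X_grad X (\<phi> n) x - G x))\<^sup>2 \<partial>?M) \<longlonglongrightarrow> 0"
      "(\<lambda>n. \<integral>x. (\<phi> n x - u x)\<^sup>2 \<partial>?M) \<longlonglongrightarrow> 0"
    using W0_grad_2E[OF W \<Omega> lip] by blast
  have [measurable]: "\<phi> n \<in> borel_measurable ?M" for n by (rule test_function_measurable[OF \<phi> \<Omega>s])
  have [measurable]: "X_grad X (\<phi> n) \<in> borel_measurable ?M" for n by (rule X_grad_measurable[OF lip \<phi> \<Omega>s])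
  have [measurable]: "f \<in> borel_measurable borel" "f' \<in> borel_measurable borel"
    using f(3,6) DERIV_isCont by (blast intro: borel_measurable_continuous_onI continuous_at_imp_continuous_on)+
  have flip: "\<bar>f a - f b\<bar> \<le> \<bar>a - b\<bar>" for a b
    using field_differentiable_bound[of UNIV f f' 1 a b] f by (auto intro: DERIV_subset)
  have flip2: "(f a - f b)\<^sup>2 \<le> (a - b)\<^sup>2" for a b using flip[of a b] by (simp add: abs_le_square_iff)
  have fsq: "(f a)\<^sup>2 \<le> a\<^sup>2" for a using flip2[of a 0] f(2) by simp
  have f'sq: "(f' a)\<^sup>2 \<le> 1" for a using f(4,5)[of a] by (simp add: abs_square_le_1)
  have f'd: "(f' a - f' b)\<^sup>2 \<le> 1" for a b
  proof -
    have "\<bar>f' a - f' b\<bar> \<le> 1" using f(4,5)[of a] f(4,5)[of b] by linarith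
    then show ?thesis by (simp add: abs_square_le_1)
  qed
  have "\<exists>r. strict_mono r \<and> (AE x in ?M. (\<lambda>n. (\<phi> (r n) x - u x)\<^sup>2) \<longlonglongrightarrow> 0)"
    by (rule tendsto_L1_AE_subseq) (use \<phi>u lim(2) in auto)
  then obtain r :: "nat \<Rightarrow> nat" where r: "strict_mono r"
    and AE: "AE x in ?M. (\<lambda>n. (\<phi> (r n) x - u x)\<^sup>2) \<longlonglongrightarrow> 0" by blast
  define \<psi> where "\<psi> = (\<lambda>n x. f (\<phi> (r n) x))"
  have \<psi>: "\<psi> n \<in> test_functions \<Omega>" for n
    unfolding \<psi>_def by (rule test_function_compose[OF f(1,2) \<phi>])
  have X\<psi>: "X_grad X (\<psi> n) x = f' (\<phi> (r n) x) *\<^sub>R X_grad X (\<phi> (r n)) x" for n x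
    unfolding \<psi>_def by (rule X_grad_compose[OF f(3) \<phi>])
  have [measurable]: "\<psi> n \<in> borel_measurable ?M" for n by (rule test_function_measurable[OF \<psi> \<Omega>s])
  have [measurable]: "X_grad X (\<psi> n) \<in> borel_measurable ?M" for n by (rule X_grad_measurable[OF lip \<psi> \<Omega>s])
  have L1: "Lp_fun 2 \<Omega> (\<lambda>x. f (u x))"
    unfolding Lp_fun_2_iff
  proof
    show "integrable ?M (\<lambda>x. (norm (f (u x)))\<^sup>2)"
      by (rule Bochner_Integration.integrable_bound[OF u2]) (use fsq in auto)
  qed measurable
  have L2: "Lp_fun 2 \<Omega> (\<lambda>x. f' (u x) *\<^sub>R G x)"
    unfolding Lp_fun_2_iff
  proof
    show "integrable ?M (\<lambda>x. (norm (f' (u x) *\<^sub>R G x))\<^sup>2)"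
      by (rule Bochner_Integration.integrable_bound[OF G2])
         (use f'sq in \<open>auto simp: power_mult_distrib intro!: mult_left_le_one_le\<close>)
  qed measurable
  have C1: "(\<lambda>n. \<integral>x. (norm (\<psi> n x - f (u x)))\<^sup>2 \<partial>?M) \<longlonglongrightarrow> 0"
  proof (rule tendsto_sandwich[where f = "\<lambda>_. 0" and h = "\<lambda>n. \<integral>x. (\<phi> (r n) x - u x)\<^sup>2 \<partial>?M"])
    show "(\<lambda>n. \<integral>x. (\<phi> (r n) x - u x)\<^sup>2 \<partial>?M) \<longlonglongrightarrow> 0"
      using LIMSEQ_subseq_LIMSEQ[OF lim(2) r] by (simp add: o_def)
    show "\<forall>\<^sub>F n in sequentially. (\<integral>x. (norm (\<psi> n x - f (u x)))\<^sup>2 \<partial>?M) \<le> (\<integral>x. (\<phi> (r n) x - u x)\<^sup>2 \<partial>?M)"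
      using \<phi>u flip2 by (intro always_eventually allI integral_mono_AE' AE_I2) (auto simp: \<psi>_def)
  qed (auto intro!: always_eventually integral_nonneg_AE)
  have D: "(\<lambda>n. \<integral>x. (f' (\<phi> (r n) x) - f' (u x))\<^sup>2 * (norm (G x))\<^sup>2 \<partial>?M) \<longlonglongrightarrow> (\<integral>x. 0 \<partial>?M)"
  proof (rule integral_dominated_convergence[OF _ _ G2])
    show "AE x in ?M. (\<lambda>n. (f' (\<phi> (r n) x) - f' (u x))\<^sup>2 * (norm (G x))\<^sup>2) \<longlonglongrightarrow> 0"
      using AE
    proof eventually_elim
      case (elim x)
      then have "(\<lambda>n. \<phi> (r n) x - u x) \<longlonglongrightarrow> 0"
        using tendsto_real_sqrt[OF elim] by (simp add: tendsto_rabs_zero_iff)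
      then have "(\<lambda>n. \<phi> (r n) x) \<longlonglongrightarrow> u x" by (simp add: LIM_zero_iff)
      then have "(\<lambda>n. f' (\<phi> (r n) x)) \<longlonglongrightarrow> f' (u x)" by (rule isCont_tendsto_compose[OF f(6)])
      then have "(\<lambda>n. (f' (\<phi> (r n) x) - f' (u x))\<^sup>2 * (norm (G x))\<^sup>2) \<longlonglongrightarrow> (f' (u x) - f' (u x))\<^sup>2 * (norm (G x))\<^sup>2"
        by (intro tendsto_intros)
      then show ?case by simp
    qed
    show "AE x in ?M. norm ((f' (\<phi> (r n) x) - f' (u x))\<^sup>2 * (norm (G x))\<^sup>2) \<le> (norm (G x))\<^sup>2" for n
      using f'd by (auto intro!: AE_I2 mult_left_le_one_le)
  qed measurable
  have C2: "(\<lambda>n. \<integral>x. (norm (X_grad X (\<psi> n) x - f' (u x) *\<^sub>R G x))\<^sup>2 \<partial>?M) \<longlonglongrightarrow> 0"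
  proof -
    let ?b = "\<lambda>n x. 2 * (norm (X_grad X (\<phi> (r n)) x - G x))\<^sup>2 + 2 * ((f' (\<phi> (r n) x) - f' (u x))\<^sup>2 * (norm (G x))\<^sup>2)"
    have iD: "integrable ?M (\<lambda>x. (f' (\<phi> (r n) x) - f' (u x))\<^sup>2 * (norm (G x))\<^sup>2)" for n
      by (rule Bochner_Integration.integrable_bound[OF G2]) (use f'd in \<open>auto intro!: mult_left_le_one_le\<close>)
    have ib: "integrable ?M (?b n)" for n using iD XG by auto
    have "(\<lambda>n. 2 * (\<integral>x. (norm (X_grad X (\<phi> (r n)) x - G x))\<^sup>2 \<partial>?M)
        + 2 * (\<integral>x. (f' (\<phi> (r n) x) - f' (u x))\<^sup>2 * (norm (G x))\<^sup>2 \<partial>?M)) \<longlonglongrightarrow> 2 * 0 + 2 * (\<integral>x. 0 \<partial>?M)"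
      using LIMSEQ_subseq_LIMSEQ[OF lim(1) r] D by (intro tendsto_intros) (simp_all add: o_def)
    moreover have "(\<integral>x. ?b n x \<partial>?M) = 2 * (\<integral>x. (norm (X_grad X (\<phi> (r n)) x - G x))\<^sup>2 \<partial>?M)
        + 2 * (\<integral>x. (f' (\<phi> (r n) x) - f' (u x))\<^sup>2 * (norm (G x))\<^sup>2 \<partial>?M)" for n
      using iD XG by (subst Bochner_Integration.integral_add) auto
    ultimately have b0: "(\<lambda>n. \<integral>x. ?b n x \<partial>?M) \<longlonglongrightarrow> 0" by simp
    have "(norm (X_grad X (\<psi> n) x - f' (u x) *\<^sub>R G x))\<^sup>2 \<le> ?b n x" for n x
    proof -
      have "X_grad X (\<psi> n) x - f' (u x) *\<^sub>R G x
          = f' (\<phi> (r n) x) *\<^sub>R (X_grad X (\<phi> (r n)) x - G x) + (f' (\<phi> (r n) x) - f' (u x)) *\<^sub>R G x"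
        by (simp add: X\<psi> algebra_simps)
      then have "(norm (X_grad X (\<psi> n) x - f' (u x) *\<^sub>R G x))\<^sup>2
          \<le> 2 * ((f' (\<phi> (r n) x))\<^sup>2 * (norm (X_grad X (\<phi> (r n)) x - G x))\<^sup>2)
            + 2 * ((f' (\<phi> (r n) x) - f' (u x))\<^sup>2 * (norm (G x))\<^sup>2)"
        using norm_add_square_le[of "f' (\<phi> (r n) x) *\<^sub>R (X_grad X (\<phi> (r n)) x - G x)"
            "(f' (\<phi> (r n) x) - f' (u x)) *\<^sub>R G x"] by (simp add: power_mult_distrib)
      moreover have "(f' (\<phi> (r n) x))\<^sup>2 * (norm (X_grad X (\<phi> (r n)) x - G x))\<^sup>2 \<le> (norm (X_grad X (\<phi> (r n)) x - G x))\<^sup>2"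
        using f'sq by (intro mult_left_le_one_le) auto
      ultimately show ?thesis by linarith
    qed
    then have "\<forall>\<^sub>F n in sequentially. (\<integral>x. (norm (X_grad X (\<psi> n) x - f' (u x) *\<^sub>R G x))\<^sup>2 \<partial>?M) \<le> (\<integral>x. ?b n x \<partial>?M)"
      using ib by (intro always_eventually allI integral_mono_AE' AE_I2) auto
    then show ?thesis
      by (rule tendsto_sandwich[OF _ _ tendsto_const b0, rotated])
         (auto intro!: always_eventually integral_nonneg_AE)
  qed
  show ?thesis
    unfolding W0_grad_def Lp_norm_2_tendsto_0_iff using L1 L2 \<psi> C1 C2 by blast
qed

text \<open>
  If \<open>\<bar>u\<bar> > t\<close>, then an approximating function exceeds \<open>t / 2\<close> or differs from \<open>u\<close> by at least \<open>t / 2\<close>. The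
  first set is controlled by \<open>weak_Sobolev_test_functions\<close>, the second by the Markov inequality and
  vanishes in the limit.
\<close>

lemma (in poincare_domain) weak_Sobolev:
  assumes \<sigma>: "0 < \<sigma>" "\<sigma> < 2 / Q" "\<sigma> < 1"
  obtains C where "C > 0"
    "\<And>u G t. W0_grad 2 X \<Omega> u G \<Longrightarrow> 0 < t \<Longrightarrow>
      measure (lebesgue_on \<Omega>) {x \<in> \<Omega>. t < \<bar>u x\<bar>}
        \<le> C * ((\<integral>x. (norm (G x))\<^sup>2 \<partial>lebesgue_on \<Omega>) / t\<^sup>2) powr (1 / (1 - \<sigma>))"
proof -
  let ?M = "lebesgue_on \<Omega>"
  have \<Omega>: "\<Omega> \<in> lmeasurable" using open_domain bounded_domain by (simp add: lmeasurable_open)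
  then have \<Omega>s: "\<Omega> \<in> sets lebesgue" by auto
  interpret M: finite_measure ?M using \<Omega> by (rule finite_measure_lebesgue_on)
  obtain C where C: "C > 0" and test: "\<And>u t. u \<in> test_functions \<Omega> \<Longrightarrow> 0 < t \<Longrightarrow>
      measure lebesgue {x. t \<le> \<bar>u x\<bar>} \<le> C * (X_energy X u UNIV / t\<^sup>2) powr (1 / (1 - \<sigma>))"
    using weak_Sobolev_test_functions[OF \<sigma>] by blast
  let ?q = "1 / (1 - \<sigma>)"
  have q: "?q > 0" using \<sigma> by simp
  have "measure ?M {x \<in> \<Omega>. t < \<bar>u x\<bar>}
      \<le> C * 8 powr ?q * ((\<integral>x. (norm (G x))\<^sup>2 \<partial>?M) / t\<^sup>2) powr ?q"
    if W: "W0_grad 2 X \<Omega> u G" and t: "0 < t" for u G t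
  proof -
    obtain \<phi> where um[measurable]: "u \<in> borel_measurable ?M" and Gm: "G \<in> borel_measurable ?M"
      and u2: "integrable ?M (\<lambda>x. (u x)\<^sup>2)" and G2: "integrable ?M (\<lambda>x. (norm (G x))\<^sup>2)"
      and \<phi>: "\<And>n::nat. \<phi> n \<in> test_functions \<Omega>"
      and X2: "\<And>n. integrable ?M (\<lambda>x. (norm (X_grad X (\<phi> n) x))\<^sup>2)"
      and XG: "\<And>n. integrable ?M (\<lambda>x. (norm (X_grad X (\<phi> n) x - G x))\<^sup>2)"
      and \<phi>u: "\<And>n. integrable ?M (\<lambda>x. (\<phi> n x - u x)\<^sup>2)"
      and lim: "(\<lambda>n. \<integral>x. (norm (X_grad X (\<phi> n) x - G x))\<^sup>2 \<partial>?M) \<longlonglongrightarrow> 0"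
        "(\<lambda>n. \<integral>x. (\<phi> n x - u x)\<^sup>2 \<partial>?M) \<longlonglongrightarrow> 0"
      by (rule W0_grad_2E[OF W \<Omega> lipschitz]) (rule that)
    have [measurable]: "\<phi> n \<in> borel_measurable ?M" for n by (rule test_function_measurable[OF \<phi> \<Omega>s])
    let ?e = "\<integral>x. (norm (G x))\<^sup>2 \<partial>?M"
    let ?\<gamma> = "\<lambda>n. \<integral>x. (norm (X_grad X (\<phi> n) x - G x))\<^sup>2 \<partial>?M"
    let ?\<delta> = "\<lambda>n. \<integral>x. (\<phi> n x - u x)\<^sup>2 \<partial>?M"
    have e0: "?e \<ge> 0" by (auto intro: integral_nonneg_AE)
    have \<gamma>0: "?\<gamma> n \<ge> 0" for n by (auto intro: integral_nonneg_AE)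
    have energy: "X_energy X (\<phi> n) UNIV \<le> 2 * ?e + 2 * ?\<gamma> n" for n
    proof -
      have "X_energy X (\<phi> n) UNIV = (\<integral>x. (norm (X_grad X (\<phi> n) x))\<^sup>2 \<partial>?M)"
        unfolding X_energy_def set_lebesgue_integral_def using \<Omega>s X_grad_zero_outside[OF \<phi>]
        by (subst integral_restrict_space) (auto intro!: Bochner_Integration.integral_cong simp: indicator_def)
      also have "\<dots> \<le> (\<integral>x. 2 * (norm (G x))\<^sup>2 + 2 * (norm (X_grad X (\<phi> n) x - G x))\<^sup>2 \<partial>?M)"
      proof (rule integral_mono[OF X2])
        show "integrable ?M (\<lambda>x. 2 * (norm (G x))\<^sup>2 + 2 * (norm (X_grad X (\<phi> n) x - G x))\<^sup>2)"
          using G2 XG by auto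
        show "(norm (X_grad X (\<phi> n) x))\<^sup>2 \<le> 2 * (norm (G x))\<^sup>2 + 2 * (norm (X_grad X (\<phi> n) x - G x))\<^sup>2" for x
          using norm_add_square_le[of "G x" "X_grad X (\<phi> n) x - G x"] by simp
      qed
      also have "\<dots> = 2 * ?e + 2 * ?\<gamma> n"
        using G2 XG by (subst Bochner_Integration.integral_add) auto
      finally show ?thesis .
    qed
    have bound: "measure ?M {x \<in> \<Omega>. t < \<bar>u x\<bar>}
        \<le> C * ((2 * ?e + 2 * ?\<gamma> n) / (t / 2)\<^sup>2) powr ?q + ?\<delta> n / (t / 2)\<^sup>2" for n
    proof -
      let ?S1 = "{x \<in> space ?M. t / 2 \<le> \<bar>\<phi> n x\<bar>}" and ?S2 = "{x \<in> space ?M. (t / 2)\<^sup>2 \<le> (\<phi> n x - u x)\<^sup>2}"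
      have "{x \<in> \<Omega>. t < \<bar>u x\<bar>} \<subseteq> ?S1 \<union> ?S2"
      proof
        fix x assume x: "x \<in> {x \<in> \<Omega>. t < \<bar>u x\<bar>}"
        show "x \<in> ?S1 \<union> ?S2"
        proof (cases "t / 2 \<le> \<bar>\<phi> n x\<bar>")
          case False
          moreover have "t < \<bar>u x\<bar>" using x by simp
          ultimately have "\<bar>t / 2\<bar> \<le> \<bar>\<phi> n x - u x\<bar>" using t by linarith
          then have "(t / 2)\<^sup>2 \<le> (\<phi> n x - u x)\<^sup>2" by (simp only: abs_le_square_iff)
          then show ?thesis using x by simp
        qed (use x in simp)
      qed
      then have "measure ?M {x \<in> \<Omega>. t < \<bar>u x\<bar>} \<le> measure ?M (?S1 \<union> ?S2)"
        by (intro M.finite_measure_mono) measurable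
      also have "\<dots> \<le> measure ?M ?S1 + measure ?M ?S2" by (intro measure_Un_le) measurable
      also have "measure ?M ?S1 = measure lebesgue {x. t / 2 \<le> \<bar>\<phi> n x\<bar>}"
      proof -
        have "?S1 = {x. t / 2 \<le> \<bar>\<phi> n x\<bar>}" using test_function_zero_outside[OF \<phi>] t by force
        then show ?thesis using \<Omega>s by (subst measure_restrict_space[symmetric, of \<Omega>]) auto
      qed
      also have "\<dots> \<le> C * (X_energy X (\<phi> n) UNIV / (t / 2)\<^sup>2) powr ?q" using \<phi> t by (intro test) auto
      also have "\<dots> \<le> C * ((2 * ?e + 2 * ?\<gamma> n) / (t / 2)\<^sup>2) powr ?q"
        using energy[of n] C q X_energy_nonneg by (intro mult_left_mono powr_mono2 divide_right_mono) auto
      also have "measure ?M ?S2 \<le> ?\<delta> n / (t / 2)\<^sup>2"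
        using \<phi>u t by (intro integral_Markov_inequality_measure[where A = "{}"]) auto
      finally show ?thesis by simp
    qed
    have "(\<lambda>n. C * ((2 * ?e + 2 * ?\<gamma> n) / (t / 2)\<^sup>2) powr ?q + ?\<delta> n / (t / 2)\<^sup>2)
        \<longlonglongrightarrow> C * ((2 * ?e + 2 * 0) / (t / 2)\<^sup>2) powr ?q + 0 / (t / 2)\<^sup>2"
      using t q e0 \<gamma>0 lim by (intro tendsto_intros tendsto_powr' always_eventually) auto
    then have "measure ?M {x \<in> \<Omega>. t < \<bar>u x\<bar>} \<le> C * ((2 * ?e + 2 * 0) / (t / 2)\<^sup>2) powr ?q + 0 / (t / 2)\<^sup>2"
      by (rule LIMSEQ_le_const) (use bound in auto)
    \<comment> \<open>A factor 2 stems from splitting the energy, a factor 4 from the level \<open>t / 2\<close>.\<close>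
    also have "\<dots> = C * (8 * (?e / t\<^sup>2)) powr ?q" by (simp add: power_divide)
    also have "\<dots> = C * 8 powr ?q * (?e / t\<^sup>2) powr ?q" using e0 by (subst powr_mult) auto
    finally show ?thesis .
  qed
  then show ?thesis using C by (intro that[of "C * 8 powr ?q"]) auto
qed

section \<open>Boundedness of the solution\<close>

text \<open>
  The test function is \<open>f u\<close>. Since \<open>0 \<le> f' \<le> 1\<close>, the square of \<open>f'\<close> is at most \<open>f'\<close>, so that ellipticity bounds the
  energy of \<open>f u\<close> itself.
\<close>

lemma weak_solution_energy:
  fixes X :: "'m::finite \<Rightarrow> real^'n::finite \<Rightarrow> real^'n" and A :: "real^'n \<Rightarrow> real^'m^'m"
  assumes W: "W0_grad 2 X \<Omega> u G" and \<Omega>: "\<Omega> \<in> lmeasurable" and lip: "locally_lipschitz_fields X"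
    and eq: "\<And>v H. W0_grad 2 X \<Omega> v H \<Longrightarrow>
      (\<integral>x. (A x *v G x) \<bullet> H x \<partial>lebesgue_on \<Omega>) = (\<integral>x. h x * v x \<partial>lebesgue_on \<Omega>)"
    and ell: "elliptic_matrix \<Omega> \<alpha> \<beta> A" and \<alpha>: "0 < \<alpha>" and h: "integrable (lebesgue_on \<Omega>) h"
    and f: "smooth_real f" "f 0 = 0" "\<And>s. (f has_real_derivative f' s) (at s)"
      "\<And>s. 0 \<le> f' s" "\<And>s. f' s \<le> 1" "\<And>s. isCont f' s" "\<And>s. \<bar>f s\<bar> \<le> B"
  shows "integrable (lebesgue_on \<Omega>) (\<lambda>x. \<bar>h x\<bar> * \<bar>f (u x)\<bar>)"
    "\<alpha> * (\<integral>x. (norm (f' (u x) *\<^sub>R G x))\<^sup>2 \<partial>lebesgue_on \<Omega>) \<le> (\<integral>x. \<bar>h x\<bar> * \<bar>f (u x)\<bar> \<partial>lebesgue_on \<Omega>)"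
proof -
  let ?M = "lebesgue_on \<Omega>"
  have [measurable]: "u \<in> borel_measurable ?M" "G \<in> borel_measurable ?M"
    and G2: "integrable ?M (\<lambda>x. (norm (G x))\<^sup>2)"
    using W unfolding W0_grad_def Lp_fun_2_iff by auto
  have [measurable]: "h \<in> borel_measurable ?M" using h by auto
  have [measurable]: "f \<in> borel_measurable borel" "f' \<in> borel_measurable borel"
    using f(3,6) DERIV_isCont by (blast intro: borel_measurable_continuous_onI continuous_at_imp_continuous_on)+
  have [measurable]: "(\<lambda>x. A x $ i $ j) \<in> borel_measurable ?M" for i j
    using ell unfolding elliptic_matrix_def by blast
  have [measurable]: "(\<lambda>x. G x $ j) \<in> borel_measurable ?M" for j
    unfolding cart_eq_inner_axis by measurable
  have AG: "\<alpha> * (norm \<eta>)\<^sup>2 \<le> (A x *v \<eta>) \<bullet> \<eta>" "(A x *v \<eta>) \<bullet> \<eta> \<le> \<beta> * (norm \<eta>)\<^sup>2" if "x \<in> \<Omega>" for x \<eta>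
    using ell that unfolding elliptic_matrix_def by auto
  have AGm[measurable]: "(\<lambda>x. (A x *v G x) \<bullet> G x) \<in> borel_measurable ?M"
    unfolding inner_vec_def matrix_vector_mult_def by simp
  have hf: "integrable ?M (\<lambda>x. h x * f (u x))"
  proof (rule Bochner_Integration.integrable_bound)
    show "integrable ?M (\<lambda>x. B * h x)" using h by simp
    have "0 \<le> B" using f(7)[of 0] by linarith
    moreover have "\<bar>f (u x)\<bar> * \<bar>h x\<bar> \<le> B * \<bar>h x\<bar>" for x by (rule mult_right_mono[OF f(7)]) simp
    ultimately show "AE x in ?M. norm (h x * f (u x)) \<le> norm (B * h x)"
      by (intro AE_I2) (simp add: abs_mult mult.commute)
  qed measurable
  then show int: "integrable ?M (\<lambda>x. \<bar>h x\<bar> * \<bar>f (u x)\<bar>)"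
    using integrable_abs by (fastforce simp: abs_mult)
  have f'sq: "(f' s)\<^sup>2 \<le> f' s" for s
    using f(4,5)[of s] by (simp add: power2_eq_square mult_left_le)
  have "\<alpha> * (\<integral>x. (norm (f' (u x) *\<^sub>R G x))\<^sup>2 \<partial>?M) = (\<integral>x. \<alpha> * (norm (f' (u x) *\<^sub>R G x))\<^sup>2 \<partial>?M)"
    by simp
  also have "\<dots> \<le> (\<integral>x. (A x *v G x) \<bullet> (f' (u x) *\<^sub>R G x) \<partial>?M)"
  proof (rule integral_mono_AE)
    show "integrable ?M (\<lambda>x. \<alpha> * (norm (f' (u x) *\<^sub>R G x))\<^sup>2)"
    proof (rule integrable_mult_right, rule Bochner_Integration.integrable_bound[OF G2])
      show "AE x in ?M. norm ((norm (f' (u x) *\<^sub>R G x))\<^sup>2) \<le> norm ((norm (G x))\<^sup>2)"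
        using f(4,5) by (intro AE_I2) (auto simp: power_mult_distrib abs_square_le_1 intro!: mult_left_le_one_le)
    qed measurable
    show "integrable ?M (\<lambda>x. (A x *v G x) \<bullet> (f' (u x) *\<^sub>R G x))"
    proof (rule Bochner_Integration.integrable_bound)
      show "integrable ?M (\<lambda>x. \<beta> * (norm (G x))\<^sup>2)" using G2 by simp
      show "AE x in ?M. norm ((A x *v G x) \<bullet> (f' (u x) *\<^sub>R G x)) \<le> norm (\<beta> * (norm (G x))\<^sup>2)"
      proof (rule AE_I2)
        fix x assume "x \<in> space ?M"
        then have x: "x \<in> \<Omega>" by simp
        have "0 \<le> \<alpha> * (norm (G x))\<^sup>2" using \<alpha> by simp
        then have nn: "0 \<le> (A x *v G x) \<bullet> G x" using AG(1)[OF x, of "G x"] by linarith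
        then have "f' (u x) * ((A x *v G x) \<bullet> G x) \<le> 1 * ((A x *v G x) \<bullet> G x)"
          using f(5) by (intro mult_right_mono)
        then have "f' (u x) * ((A x *v G x) \<bullet> G x) \<le> \<beta> * (norm (G x))\<^sup>2"
          using AG(2)[OF x, of "G x"] by linarith
        moreover from this have "0 \<le> \<beta> * (norm (G x))\<^sup>2"
          using mult_nonneg_nonneg[OF f(4) nn, of "u x"] by linarith
        moreover have "norm ((A x *v G x) \<bullet> (f' (u x) *\<^sub>R G x)) = f' (u x) * ((A x *v G x) \<bullet> G x)"
          using nn f(4)[of "u x"] by (simp add: abs_mult)
        ultimately show "norm ((A x *v G x) \<bullet> (f' (u x) *\<^sub>R G x)) \<le> norm (\<beta> * (norm (G x))\<^sup>2)"
          by (simp only: real_norm_def abs_of_nonneg)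
      qed
      show "(\<lambda>x. (A x *v G x) \<bullet> (f' (u x) *\<^sub>R G x)) \<in> borel_measurable ?M"
        by (simp add: AGm)
    qed
    show "AE x in ?M. \<alpha> * (norm (f' (u x) *\<^sub>R G x))\<^sup>2 \<le> (A x *v G x) \<bullet> (f' (u x) *\<^sub>R G x)"
    proof (rule AE_I2)
      fix x assume "x \<in> space ?M"
      then have x: "x \<in> \<Omega>" by simp
      have "\<alpha> * (norm (f' (u x) *\<^sub>R G x))\<^sup>2 = (f' (u x))\<^sup>2 * (\<alpha> * (norm (G x))\<^sup>2)"
        by (simp add: power_mult_distrib)
      also have "\<dots> \<le> f' (u x) * (\<alpha> * (norm (G x))\<^sup>2)"
        using f'sq \<alpha> by (intro mult_right_mono) auto
      also have "\<dots> \<le> f' (u x) * ((A x *v G x) \<bullet> G x)"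
        using f(4) AG(1)[OF x] by (intro mult_left_mono) auto
      finally show "\<alpha> * (norm (f' (u x) *\<^sub>R G x))\<^sup>2 \<le> (A x *v G x) \<bullet> (f' (u x) *\<^sub>R G x)" by simp
    qed
  qed
  also have "\<dots> = (\<integral>x. h x * f (u x) \<partial>?M)"
    by (rule eq[OF W0_grad_compose[OF W \<Omega> lip f(1-6)]])
  also have "\<dots> \<le> (\<integral>x. \<bar>h x\<bar> * \<bar>f (u x)\<bar> \<partial>?M)"
    by (rule integral_mono[OF hf int]) (metis abs_ge_self abs_mult)
  finally show "\<alpha> * (\<integral>x. (norm (f' (u x) *\<^sub>R G x))\<^sup>2 \<partial>?M) \<le> (\<integral>x. \<bar>h x\<bar> * \<bar>f (u x)\<bar> \<partial>?M)" .
qed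

text \<open>
  The energy of the truncation is bounded by \<open>(h - k) / \<alpha>\<close> times the integral of \<open>\<bar>f\<bar>\<close> over \<open>{\<bar>u\<bar> > k}\<close>,
  and its modulus is \<open>h - k\<close> on \<open>{\<bar>u\<bar> > h}\<close>. The argument runs with \<open>smooth_trunc e k h\<close>, which differs from
  the truncation by at most \<open>4 * e\<close>; the error only enters through the integral of \<open>\<bar>f\<bar>\<close> over \<open>\<Omega>\<close> and disappears as
  \<open>e\<close> tends to zero.
\<close>

lemma level_set_decay:
  fixes X :: "'m::finite \<Rightarrow> real^'n::finite \<Rightarrow> real^'n" and A :: "real^'n \<Rightarrow> real^'m^'m"
  assumes sob: "\<And>u G t. W0_grad 2 X \<Omega> u G \<Longrightarrow> 0 < t \<Longrightarrow>
      measure (lebesgue_on \<Omega>) {x \<in> \<Omega>. t < \<bar>u x\<bar>}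
        \<le> C * ((\<integral>x. (norm (G x))\<^sup>2 \<partial>lebesgue_on \<Omega>) / t\<^sup>2) powr q"
    and C: "0 < C" and q: "0 < q"
    and \<Omega>: "\<Omega> \<in> lmeasurable" and lip: "locally_lipschitz_fields X"
    and ell: "elliptic_matrix \<Omega> \<alpha> \<beta> A" and \<alpha>: "0 < \<alpha>"
    and f: "Lp_fun p \<Omega> f" and p: "1 < p" and sol: "weak_solution X \<Omega> A f u"
    and kh: "0 \<le> k" "k < h"
  shows "measure (lebesgue_on \<Omega>) {x \<in> \<Omega>. h < \<bar>u x\<bar>}
    \<le> C * (8 * Lp_norm p \<Omega> f / \<alpha> / (h - k) *
        measure (lebesgue_on \<Omega>) {x \<in> \<Omega>. k < \<bar>u x\<bar>} powr (1 - 1 / p)) powr q"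
proof -
  let ?M = "lebesgue_on \<Omega>"
  have \<Omega>s: "\<Omega> \<in> sets lebesgue" using \<Omega> by auto
  interpret M: finite_measure ?M using \<Omega> by (rule finite_measure_lebesgue_on)
  obtain G where W: "W0_grad 2 X \<Omega> u G" and eq: "\<And>v H. W0_grad 2 X \<Omega> v H \<Longrightarrow>
      (\<integral>x. (A x *v G x) \<bullet> H x \<partial>?M) = (\<integral>x. f x * v x \<partial>?M)"
    using sol unfolding weak_solution_def by blast
  have [measurable]: "u \<in> borel_measurable ?M" using W unfolding W0_grad_def Lp_fun_def by auto
  have [measurable]: "f \<in> borel_measurable ?M" and fp: "integrable ?M (\<lambda>x. \<bar>f x\<bar> powr p)"
    using f unfolding Lp_fun_def by auto
  define S where "S = {x \<in> \<Omega>. k < \<bar>u x\<bar>}"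
  have S[measurable]: "S \<in> sets ?M"
  proof -
    have "{x \<in> space ?M. k < \<bar>u x\<bar>} \<in> sets ?M" by measurable
    then show ?thesis by (simp add: S_def)
  qed
  have fS: "set_integrable ?M S (\<lambda>x. \<bar>f x\<bar>)"
    and J: "(LINT x:S|?M. \<bar>f x\<bar>) \<le> 2 * Lp_norm p \<Omega> f * measure ?M S powr (1 - 1 / p)"
    using Holder_on_set[OF _ _ fp p S] by (auto simp: Lp_norm_def M.emeasure_finite less_top[symmetric])
  have "set_integrable ?M (space ?M) (\<lambda>x. \<bar>f x\<bar>)"
    using Holder_on_set(1)[OF _ _ fp p sets.top] by (auto simp: M.emeasure_finite less_top[symmetric])
  then have fi: "integrable ?M (\<lambda>x. \<bar>f x\<bar>)"
    unfolding set_integrable_def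
    by (rule Bochner_Integration.integrable_cong[OF refl, THEN iffD1, rotated]) simp
  then have fi': "integrable ?M f" by (simp add: integrable_abs_iff)
  let ?J = "LINT x:S|?M. \<bar>f x\<bar>" and ?I = "\<integral>x. \<bar>f x\<bar> \<partial>?M"
  let ?A = "measure ?M {x \<in> \<Omega>. h < \<bar>u x\<bar>}"
  have I0: "?I \<ge> 0" by (auto intro: integral_nonneg_AE)
  have J0: "?J \<ge> 0" unfolding set_lebesgue_integral_def by (auto intro: integral_nonneg_AE)
  have bound: "?A \<le> C * (((h - k) * ?J + 4 * e * ?I) / \<alpha> / ((h - k) / 2)\<^sup>2) powr q"
    if e: "0 < e" "8 * e < h - k" for e
  proof -
    let ?\<psi> = "smooth_trunc e k h" and ?\<psi>' = "smooth_trunc' e k h"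
    note approx = smooth_trunc_approx[OF e(1), of k h]
    have bd: "\<bar>?\<psi> s\<bar> \<le> h - k + 4 * e" for s
      using approx[of s] trunc_facts(1)[OF kh, of s] by linarith
    note \<psi> = smooth_real_smooth_trunc[OF e(1), of k h] smooth_trunc_0[of e k h]
      DERIV_smooth_trunc[OF e(1), of k h] smooth_trunc'_bounds[OF e(1) kh]
      isCont_smooth_trunc'[OF e(1), where k = k and h = h]
    note en = weak_solution_energy[OF W \<Omega> lip eq ell \<alpha> fi' \<psi> bd]
    let ?E = "\<integral>x. (norm (?\<psi>' (u x) *\<^sub>R G x))\<^sup>2 \<partial>?M"
    have E0: "?E \<ge> 0" by (auto intro: integral_nonneg_AE)
    have iS: "integrable ?M (\<lambda>x. indicat_real S x * \<bar>f x\<bar>)"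
      using fS by (simp add: set_integrable_def)
    have "\<alpha> * ?E \<le> (\<integral>x. \<bar>f x\<bar> * \<bar>?\<psi> (u x)\<bar> \<partial>?M)" by (rule en(2))
    also have "\<dots> \<le> (\<integral>x. (h - k) * (indicat_real S x * \<bar>f x\<bar>) + 4 * e * \<bar>f x\<bar> \<partial>?M)"
    proof (rule integral_mono[OF en(1)])
      show "integrable ?M (\<lambda>x. (h - k) * (indicat_real S x * \<bar>f x\<bar>) + 4 * e * \<bar>f x\<bar>)"
        using iS fi by (intro Bochner_Integration.integrable_add integrable_mult_right)
      fix x assume "x \<in> space ?M"
      then have x: "x \<in> \<Omega>" by simp
      have "\<bar>trunc k h (u x)\<bar> \<le> (h - k) * indicat_real S x"
        using trunc_facts(1,2)[OF kh, of "u x"] x by (auto simp: S_def indicator_def)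
      then have "\<bar>?\<psi> (u x)\<bar> \<le> (h - k) * indicat_real S x + 4 * e"
        using approx[of "u x"] by linarith
      from mult_left_mono[OF this abs_ge_zero[of "f x"]]
      show "\<bar>f x\<bar> * \<bar>?\<psi> (u x)\<bar> \<le> (h - k) * (indicat_real S x * \<bar>f x\<bar>) + 4 * e * \<bar>f x\<bar>"
        by (simp add: algebra_simps)
    qed
    also have "\<dots> = (h - k) * ?J + 4 * e * ?I"
      using iS fi by (subst Bochner_Integration.integral_add) (auto simp: set_lebesgue_integral_def)
    finally have E: "?E \<le> ((h - k) * ?J + 4 * e * ?I) / \<alpha>" using \<alpha> by (simp add: field_simps)
    have "{x \<in> \<Omega>. h < \<bar>u x\<bar>} \<subseteq> {x \<in> \<Omega>. (h - k) / 2 < \<bar>?\<psi> (u x)\<bar>}"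
    proof safe
      fix x assume "h < \<bar>u x\<bar>"
      then have "\<bar>trunc k h (u x)\<bar> = h - k" using trunc_facts(3)[OF kh, of "u x"] by simp
      then show "(h - k) / 2 < \<bar>?\<psi> (u x)\<bar>" using approx[of "u x"] e by (simp add: abs_if split: if_splits)
    qed
    moreover have "{x \<in> \<Omega>. (h - k) / 2 < \<bar>?\<psi> (u x)\<bar>} \<in> sets ?M"
    proof -
      have [measurable]: "?\<psi> \<in> borel_measurable borel"
        using DERIV_isCont[OF \<psi>(3)] by (intro borel_measurable_continuous_onI continuous_at_imp_continuous_on) auto
      have "{x \<in> space ?M. (h - k) / 2 < \<bar>?\<psi> (u x)\<bar>} \<in> sets ?M" by measurable
      then show ?thesis by simp
    qed
    ultimately have "?A \<le> measure ?M {x \<in> \<Omega>. (h - k) / 2 < \<bar>?\<psi> (u x)\<bar>}"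
      by (rule M.finite_measure_mono)
    also have "\<dots> \<le> C * (?E / ((h - k) / 2)\<^sup>2) powr q"
      by (rule sob[OF W0_grad_compose[OF W \<Omega> lip \<psi>]]) (use kh in simp)
    also have "\<dots> \<le> C * (((h - k) * ?J + 4 * e * ?I) / \<alpha> / ((h - k) / 2)\<^sup>2) powr q"
      using E E0 C q by (intro mult_left_mono powr_mono2 divide_right_mono) auto
    finally show ?thesis .
  qed
  have "((\<lambda>e. C * (((h - k) * ?J + 4 * e * ?I) / \<alpha> / ((h - k) / 2)\<^sup>2) powr q)
      \<longlongrightarrow> C * (((h - k) * ?J + 4 * 0 * ?I) / \<alpha> / ((h - k) / 2)\<^sup>2) powr q) (at_right 0)"
    using q kh \<alpha> J0 I0
    by (intro tendsto_intros tendsto_powr') (auto simp: eventually_at_right_less intro!: eventually_at_rightI[of 0 1])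
  moreover have "\<forall>\<^sub>F e in at_right 0. ?A \<le> C * (((h - k) * ?J + 4 * e * ?I) / \<alpha> / ((h - k) / 2)\<^sup>2) powr q"
    using bound kh by (intro eventually_at_rightI[of 0 "(h - k) / 8"]) auto
  ultimately have "?A \<le> C * (((h - k) * ?J + 4 * 0 * ?I) / \<alpha> / ((h - k) / 2)\<^sup>2) powr q"
    by (rule tendsto_lowerbound) simp
  also have "((h - k) * ?J + 4 * 0 * ?I) / \<alpha> / ((h - k) / 2)\<^sup>2 = 4 / \<alpha> / (h - k) * ?J"
  proof -
    have "(d * ?J + 4 * 0 * ?I) / \<alpha> / (d / 2)\<^sup>2 = 4 / \<alpha> / d * ?J" if "d > 0" for d
      using that by (simp add: field_simps power2_eq_square)
    then show ?thesis using kh by simp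
  qed
  also have "C * (4 / \<alpha> / (h - k) * ?J) powr q
      \<le> C * (8 * Lp_norm p \<Omega> f / \<alpha> / (h - k) * measure ?M S powr (1 - 1 / p)) powr q"
  proof (intro mult_left_mono powr_mono2)
    have "4 / \<alpha> / (h - k) * ?J \<le> 4 / \<alpha> / (h - k) * (2 * Lp_norm p \<Omega> f * measure ?M S powr (1 - 1 / p))"
      using J \<alpha> kh by (intro mult_left_mono) auto
    then show "4 / \<alpha> / (h - k) * ?J \<le> 8 * Lp_norm p \<Omega> f / \<alpha> / (h - k) * measure ?M S powr (1 - 1 / p)"
      by (simp add: mult.assoc)
  qed (use q C J0 \<alpha> kh in auto)
  finally show ?thesis by (simp add: S_def)
qed

text \<open>
  Along the levels \<open>d * (1 - 1 / 2 ^ n)\<close> the decay hypothesis propagates the bound \<open>a0 * \<theta> ^ n\<close>: the choice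
  of \<open>\<theta>\<close> makes the gain \<open>\<theta> powr ((b - 1) * n)\<close> cancel the loss \<open>2 powr (q * n)\<close> from the shrinking gaps between
  the levels.
\<close>

lemma Stampacchia_iteration:
  fixes a :: "real \<Rightarrow> real"
  assumes decay: "\<And>k h. 0 \<le> k \<Longrightarrow> k < h \<Longrightarrow> a h \<le> (K / (h - k)) powr q * a k powr b"
    and anti: "\<And>k h. 0 \<le> k \<Longrightarrow> k \<le> h \<Longrightarrow> a h \<le> a k" and nonneg: "\<And>k. 0 \<le> k \<Longrightarrow> 0 \<le> a k"
    and K: "0 \<le> K" and q: "0 < q" and b: "1 < b" and a0: "a 0 \<le> a0" "0 < a0"
    and d: "0 < d" "2 * K * (a0 powr (b - 1) * 2 powr (q / (b - 1))) powr (1 / q) \<le> d"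
  shows "a d = 0"
proof -
  define \<theta> where "\<theta> = 2 powr (- q / (b - 1))"
  have \<theta>: "0 < \<theta>" "\<theta> < 1" using q b by (auto simp: \<theta>_def powr_less_one)
  have \<theta>b: "\<theta> powr (b - 1) = 2 powr (- q)" using b by (simp add: \<theta>_def powr_powr)
  define k where "k = (\<lambda>n::nat. d * (1 - 1 / 2 ^ n))"
  have k: "0 \<le> k n" "k n \<le> d" "k n < k (Suc n)" "k (Suc n) - k n = d / 2 ^ Suc n" for n
    using d(1) by (auto simp: k_def field_simps)
  have small: "(2 * K / d) powr q * a0 powr (b - 1) \<le> \<theta>"
  proof -
    have "2 * K / d * (a0 powr (b - 1) / \<theta>) powr (1 / q) \<le> 1"
      using d by (simp add: \<theta>_def powr_minus field_simps)
    then have "(2 * K / d * (a0 powr (b - 1) / \<theta>) powr (1 / q)) powr q \<le> 1 powr q"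
      using K d \<theta> q by (intro powr_mono2) auto
    moreover have "(2 * K / d * (a0 powr (b - 1) / \<theta>) powr (1 / q)) powr q
        = (2 * K / d) powr q * (a0 powr (b - 1) / \<theta>)"
    proof -
      have "((a0 powr (b - 1) / \<theta>) powr (1 / q)) powr q = a0 powr (b - 1) / \<theta>"
        unfolding powr_powr using q \<theta> by simp
      moreover have "(2 * K / d * (a0 powr (b - 1) / \<theta>) powr (1 / q)) powr q
          = (2 * K / d) powr q * ((a0 powr (b - 1) / \<theta>) powr (1 / q)) powr q"
        by (intro powr_mult)
      ultimately show ?thesis by simp
    qed
    ultimately have "(2 * K / d) powr q * (a0 powr (b - 1) / \<theta>) \<le> 1" by simp
    then show ?thesis using \<theta> by (simp add: field_simps)
  qed
  have "a (k n) \<le> a0 * \<theta> ^ n" for n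
  proof (induction n)
    case 0
    then show ?case using a0 by (simp add: k_def)
  next
    case (Suc n)
    have "a (k (Suc n)) \<le> (K / (k (Suc n) - k n)) powr q * a (k n) powr b"
      using k by (intro decay)
    also have "\<dots> \<le> (K / (k (Suc n) - k n)) powr q * (a0 * \<theta> ^ n) powr b"
      using Suc nonneg k b by (intro mult_left_mono powr_mono2) auto
    also have "K / (k (Suc n) - k n) = 2 * K / d * 2 ^ n" using d by (simp add: k(4))
    also have "(2 * K / d * 2 ^ n) powr q = (2 * K / d) powr q * (2 powr q) ^ n"
      using K d by (subst powr_mult) (auto simp: powr_power powr_realpow[symmetric] powr_powr mult.commute)
    also have "(a0 * \<theta> ^ n) powr b = a0 powr b * (\<theta> powr b) ^ n"
      using a0 \<theta> by (subst powr_mult) (auto simp: powr_power powr_realpow[symmetric] powr_powr mult.commute)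
    also have "\<theta> powr b = \<theta> * 2 powr (- q)"
      using \<theta> by (simp add: \<theta>b[symmetric] powr_mult_base)
    also have "a0 powr b = a0 * a0 powr (b - 1)" using a0 by (simp add: powr_mult_base)
    also have "(2 * K / d) powr q * (2 powr q) ^ n * (a0 * a0 powr (b - 1) * (\<theta> * 2 powr (- q)) ^ n)
        = ((2 * K / d) powr q * a0 powr (b - 1)) * (a0 * \<theta> ^ n) * (2 powr q * 2 powr (- q)) ^ n"
      by (simp add: power_mult_distrib)
    also have "(2::real) powr q * 2 powr (- q) = 1" by (simp flip: powr_add)
    also have "((2 * K / d) powr q * a0 powr (b - 1)) * (a0 * \<theta> ^ n) * 1 ^ n \<le> \<theta> * (a0 * \<theta> ^ n) * 1 ^ n"
      using small a0 \<theta> by (intro mult_right_mono) auto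
    finally show ?case by (simp add: mult_ac)
  qed
  then have "a d \<le> a0 * \<theta> ^ n" for n using anti[OF k(1,2)] by (meson order_trans)
  moreover have "(\<lambda>n. a0 * \<theta> ^ n) \<longlonglongrightarrow> a0 * 0"
    using \<theta> by (intro tendsto_intros LIMSEQ_power_zero) auto
  ultimately have "a d \<le> a0 * 0" by (intro LIMSEQ_le_const) auto
  then show ?thesis using nonneg[of d] d(1) by simp
qed

theorem theorem4p2:
  fixes X :: "'m::finite \<Rightarrow> real^'n::finite \<Rightarrow> real^'n"
    and \<Omega> :: "(real^'n) set"
    and Q p \<alpha> :: real
  assumes "CARD('n) \<ge> 2"
    and "open \<Omega>" and "bounded \<Omega>"
    and "locally_lipschitz_fields X"
    and "subunit_connected X \<Omega>"
    and "d_X_continuous X \<Omega>"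
    and "Q > 2" and "X_doubling X \<Omega> Q"
    and "X_poincare X \<Omega>"
    and "p > Q / 2"
    and "\<alpha> > 0"
  shows "\<exists>C::real. \<forall>\<beta> (A :: real^'n \<Rightarrow> real^'m^'m) f u.
           \<alpha> < \<beta> \<longrightarrow> elliptic_matrix \<Omega> \<alpha> \<beta> A \<longrightarrow> Lp_fun p \<Omega> f \<longrightarrow> weak_solution X \<Omega> A f u \<longrightarrow>
           Linf_fun \<Omega> u \<and> Linf_norm \<Omega> u \<le> C * Lp_norm p \<Omega> f"
proof (cases "\<Omega> = {}")
  case True
  have "Linf_fun \<Omega> u \<and> Linf_norm \<Omega> u \<le> 0 * Lp_norm p \<Omega> f" for f u :: "real^'n \<Rightarrow> real"
  proof
    have sp: "space (lebesgue_on \<Omega>) = {}" using True by simp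
    have m: "g \<in> borel_measurable (lebesgue_on \<Omega>)" for g :: "real^'n \<Rightarrow> 'z::topological_space"
      using sp by (simp add: measurable_def)
    show "Linf_fun \<Omega> u" unfolding Linf_fun_def using m sp by (auto intro!: exI[of _ 0] AE_I2)
    have "esssup (lebesgue_on \<Omega>) (\<lambda>x. ereal \<bar>u x\<bar>) \<le> - \<infinity>"
      using m sp by (intro esssup_I AE_I2) auto
    then show "Linf_norm \<Omega> u \<le> 0 * Lp_norm p \<Omega> f" unfolding Linf_norm_def by simp
  qed
  then show ?thesis by blast
next
  case False
  interpret poincare_domain X \<Omega> Q
    using assms False by unfold_locales auto
  let ?M = "lebesgue_on \<Omega>"
  have \<Omega>: "\<Omega> \<in> lmeasurable" using assms by (simp add: lmeasurable_open)
  interpret M: finite_measure ?M using \<Omega> by (rule finite_measure_lebesgue_on)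
  have p: "p > 1" using assms by linarith
  \<comment> \<open>Admissible for the Sobolev inequality below \<open>2 / Q\<close>, and above \<open>1 / p\<close> for the exponent \<open>b\<close> to exceed one.\<close>
  define \<sigma> where "\<sigma> = (1 / p + 2 / Q) / 2"
  have "1 / p < 2 / Q" using assms p by (simp add: field_simps)
  then have "1 / p < \<sigma>" "\<sigma> < 2 / Q" by (auto simp: \<sigma>_def)
  moreover have "0 < 1 / p" using p by simp
  ultimately have \<sigma>: "1 / p < \<sigma>" "\<sigma> < 2 / Q" "0 < \<sigma>" by linarith+
  have "2 / Q < 1" using assms by simp
  then have \<sigma>1: "\<sigma> < 1" using \<sigma> by linarith
  define q where "q = 1 / (1 - \<sigma>)"
  have q: "0 < q" using \<sigma>1 by (simp add: q_def)
  define b where "b = q * (1 - 1 / p)"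
  have b: "1 < b" using \<sigma> \<sigma>1 by (simp add: b_def q_def)
  obtain C where C: "C > 0" and sob: "\<And>u G t. W0_grad 2 X \<Omega> u G \<Longrightarrow> 0 < t \<Longrightarrow>
      measure ?M {x \<in> \<Omega>. t < \<bar>u x\<bar>} \<le> C * ((\<integral>x. (norm (G x))\<^sup>2 \<partial>?M) / t\<^sup>2) powr q"
    using weak_Sobolev[OF \<sigma>(3,2) \<sigma>1] unfolding q_def by blast
  \<comment> \<open>The summand 1 is only there to make \<open>a0\<close> visibly positive.\<close>
  define a0 where "a0 = measure ?M \<Omega> + 1"
  have a0: "0 < a0" by (simp add: a0_def add_nonneg_pos)
  define c where "c = 2 * (C powr (1 / q) * 8 / \<alpha>) * (a0 powr (b - 1) * 2 powr (q / (b - 1))) powr (1 / q)"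
  have c: "0 \<le> c" using assms by (simp add: c_def)
  have "Linf_fun \<Omega> u \<and> Linf_norm \<Omega> u \<le> c * Lp_norm p \<Omega> f"
    if ell: "elliptic_matrix \<Omega> \<alpha> \<beta> A" and f: "Lp_fun p \<Omega> f" and sol: "weak_solution X \<Omega> A f u"
    for \<beta> and A :: "real^'n \<Rightarrow> real^'m^'m" and f u
  proof -
    have um[measurable]: "u \<in> borel_measurable ?M"
      using sol unfolding weak_solution_def W0_grad_def Lp_fun_def by auto
    let ?F = "Lp_norm p \<Omega> f"
    have F: "0 \<le> ?F" by (simp add: Lp_norm_def)
    define a where "a = (\<lambda>k. measure ?M {x \<in> \<Omega>. k < \<bar>u x\<bar>})"
    have S: "{x \<in> \<Omega>. k < \<bar>u x\<bar>} \<in> sets ?M" for k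
    proof -
      have "{x \<in> space ?M. k < \<bar>u x\<bar>} \<in> sets ?M" by measurable
      then show ?thesis by simp
    qed
    define K where "K = C powr (1 / q) * 8 / \<alpha> * ?F"
    have K: "0 \<le> K" using F assms by (simp add: K_def)
    have decay: "a h \<le> (K / (h - k)) powr q * a k powr b" if kh: "0 \<le> k" "k < h" for k h
    proof -
      have "a h \<le> C * (8 * ?F / \<alpha> / (h - k) * a k powr (1 - 1 / p)) powr q"
        unfolding a_def by (rule level_set_decay[OF sob C q \<Omega> assms(4) ell assms(11) f p sol kh])
      also have "\<dots> = (C powr (1 / q)) powr q * (8 * ?F / \<alpha> / (h - k)) powr q * (a k powr (1 - 1 / p)) powr q"
      proof -
        have "(C powr (1 / q)) powr q = C" using C q by (simp add: powr_powr)
        then show ?thesis by (simp only: powr_mult mult.assoc)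
      qed
      also have "(C powr (1 / q)) powr q * (8 * ?F / \<alpha> / (h - k)) powr q = (K / (h - k)) powr q"
        by (subst powr_mult[symmetric]) (simp add: K_def mult.assoc)
      also have "(a k powr (1 - 1 / p)) powr q = a k powr b"
        by (simp add: powr_powr b_def mult.commute)
      finally show ?thesis .
    qed
    have AE: "AE x in ?M. \<bar>u x\<bar> \<le> d" if d: "0 < d" "c * ?F \<le> d" for d
    proof -
      have "a d = 0"
      proof (rule Stampacchia_iteration[OF decay _ _ K q b _ a0 d(1)])
        show "a h \<le> a k" if "0 \<le> k" "k \<le> h" for k h
          unfolding a_def using that by (intro M.finite_measure_mono S) auto
        have "a 0 \<le> measure ?M \<Omega>" unfolding a_def using \<Omega> by (intro M.finite_measure_mono) (auto simp: sets_restrict_space)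
        then show "a 0 \<le> a0" by (simp add: a0_def)
        show "2 * K * (a0 powr (b - 1) * 2 powr (q / (b - 1))) powr (1 / q) \<le> d"
          using d(2) by (simp add: c_def K_def mult_ac)
      qed (auto simp: a_def)
      then have "emeasure ?M {x \<in> \<Omega>. d < \<bar>u x\<bar>} = 0" by (simp add: a_def M.emeasure_eq_measure)
      then have "{x \<in> \<Omega>. d < \<bar>u x\<bar>} \<in> null_sets ?M" using S by (intro null_setsI)
      then have "AE x in ?M. x \<notin> {x \<in> \<Omega>. d < \<bar>u x\<bar>}" by (rule AE_not_in)
      then show ?thesis by (rule AE_mp) (auto intro!: AE_I2)
    qed
    have cF: "0 \<le> c * ?F" using c F by simp
    \<comment> \<open>The level has to be positive, also when the norm of \<open>f\<close> is zero; hence the additional \<open>e\<close>.\<close>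
    have "Linf_norm \<Omega> u \<le> c * ?F + e" if e: "0 < e" for e
    proof -
      let ?d = "c * ?F + e" and ?s = "esssup ?M (\<lambda>x. ereal \<bar>u x\<bar>)"
      have d: "0 < ?d" using cF e by linarith
      have "?s \<le> ereal ?d"
        using AE[of ?d] d e by (intro esssup_I) auto
      then show ?thesis
        unfolding Linf_norm_def using d by (cases ?s) auto
    qed
    then have "Linf_norm \<Omega> u \<le> c * ?F" by (rule field_le_epsilon)
    moreover have "Linf_fun \<Omega> u"
      unfolding Linf_fun_def using AE[of "c * ?F + 1"] cF um by auto
    ultimately show ?thesis by blast
  qed
  then show ?thesis by blast
qed

end
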